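(* Let $\varepsilon>0$ be a fixed parameter and let $c>0$ be an absolute constant. Given a weighted $k$-Median instance $((V,d),C',\mathbb{F},k,w)$ with $n=|V|$, client weights $w_j\in[1,n]$, polynomially bounded aspect ratio, and $|C'|\le c\,\varepsilon^{-2}k\log n$, there is a $(1+2/e+O(\varepsilon))$-approximation algorithm that runs in time $f(k,\varepsilon)\,n^{O(1)}$ for some function $f$.
   Context: A weighted $k$-Median instance $((V,d),C',\mathbb{F},k,w)$ consists of a finite metric space $(V,d)$, clients $C'\subseteq V$ with weights $w_j>0$, facility locations $\mathbb{F}\subseteq V$, and an integer $k\ge1$; the goal is to choose $F\subseteq\mathbb{F}$ with $|F|=k$ minimizing $\sum_{j\in C'}w_j\,d(j,F)$, where $d(j,F)=\min_{f\in F}d(j,f)$. The aspect ratio of $(V,d)$ is $\max_{x,y}d(x,y)/\min_{x\ne y}d(x,y)$; polynomially bounded means it is at most $n^{O(1)}$. *)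

theory Defs
  imports "HOL-Analysis.Abstract_Metric_Spaces"
begin

section \<open>Weighted k-Median\<close>

text \<open>
  The assumption \<open>k \<le> card F\<close> only expresses that a feasible solution exists.
\<close>

locale weighted_kmedian = Metric_space V d
  for V :: "'a set" and d :: "'a \<Rightarrow> 'a \<Rightarrow> real" +
  fixes C :: "'a set" and w :: "'a \<Rightarrow> real" and F :: "'a set" and k :: nat
  assumes finite_points: "finite V"
    and clients: "C \<subseteq> V"
    and weights: "\<And>j. j \<in> C \<Longrightarrow> w j > 0"
    and facilities: "F \<subseteq> V"
    and k_bounds: "1 \<le> k" "k \<le> card F"

definition dist_to_set :: "('a \<Rightarrow> 'a \<Rightarrow> real) \<Rightarrow> 'a \<Rightarrow> 'a set \<Rightarrow> real" where
  "dist_to_set d j S = Min (d j ` S)"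

definition kmedian_cost :: "('a \<Rightarrow> 'a \<Rightarrow> real) \<Rightarrow> 'a set \<Rightarrow> ('a \<Rightarrow> real) \<Rightarrow> 'a set \<Rightarrow> real" where
  "kmedian_cost d C w S = (\<Sum>j\<in>C. w j * dist_to_set d j S)"

definition feasible :: "'a set \<Rightarrow> nat \<Rightarrow> 'a set set" where
  "feasible F k = {S. S \<subseteq> F \<and> card S = k}"

definition kmedian_opt ::
  "('a \<Rightarrow> 'a \<Rightarrow> real) \<Rightarrow> 'a set \<Rightarrow> ('a \<Rightarrow> real) \<Rightarrow> 'a set \<Rightarrow> nat \<Rightarrow> real" where
  "kmedian_opt d C w F k = Min (kmedian_cost d C w ` feasible F k)"

definition approx_solution ::
  "real \<Rightarrow> ('a \<Rightarrow> 'a \<Rightarrow> real) \<Rightarrow> 'a set \<Rightarrow> ('a \<Rightarrow> real) \<Rightarrow> 'a set \<Rightarrow> nat \<Rightarrow> 'a set \<Rightarrow> bool" where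
  "approx_solution r d C w F k S \<longleftrightarrow>
     S \<in> feasible F k \<and> kmedian_cost d C w S \<le> r * kmedian_opt d C w F k"

text \<open>A space with fewer than two points has no positive distance; its ratio is set to 1.\<close>

definition aspect_ratio :: "'a set \<Rightarrow> ('a \<Rightarrow> 'a \<Rightarrow> real) \<Rightarrow> real" where
  "aspect_ratio V d =
     (if card V < 2 then 1
      else Max {d x y |x y. x \<in> V \<and> y \<in> V} / Min {d x y |x y. x \<in> V \<and> y \<in> V \<and> x \<noteq> y})"


section \<open>Real RAM\<close>

text \<open>
  Running time is measured on a deterministic real RAM, programmed in a while-language.
  Memory consists of named one-dimensional arrays of natural numbers and of reals; a scalar
  variable is cell 0 of an array. Naturals (used for addresses and counters) can be added,
  subtracted (truncating at 0) and compared, but not multiplied in one step; reals admit the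
  four field operations (with \<open>x / 0 = 0\<close>) and comparison. There is no rounding of a real to
  a natural, and there are no real literals, so a program cannot carry information in the
  digits of a real constant.

  An assignment or the evaluation of a guard takes one step. As the expressions in a program
  have a fixed size, this agrees with counting single operations up to a constant factor that
  depends only on the program.
\<close>

datatype nexp =
    NConst nat
  | NLoad string nexp
  | NAdd nexp nexp
  | NSub nexp nexp

datatype rexp =
    RNat nexp
  | RLoad string nexp
  | RAdd rexp rexp
  | RSub rexp rexp
  | RMul rexp rexp
  | RDiv rexp rexp

datatype bexp =
    NLess nexp nexp
  | RLess rexp rexp
  | BNot bexp
  | BAnd bexp bexp

datatype com =
    Skip
  | NStore string nexp nexp
  | RStore string nexp rexp
  | Seq com com
  | Cond bexp com com
  | While bexp com

record state =
  nmem :: "string \<Rightarrow> nat \<Rightarrow> nat"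
  rmem :: "string \<Rightarrow> nat \<Rightarrow> real"

primrec nval :: "state \<Rightarrow> nexp \<Rightarrow> nat" where
  "nval s (NConst m) = m"
| "nval s (NLoad x a) = nmem s x (nval s a)"
| "nval s (NAdd a b) = nval s a + nval s b"
| "nval s (NSub a b) = nval s a - nval s b"

primrec rval :: "state \<Rightarrow> rexp \<Rightarrow> real" where
  "rval s (RNat a) = real (nval s a)"
| "rval s (RLoad x a) = rmem s x (nval s a)"
| "rval s (RAdd a b) = rval s a + rval s b"
| "rval s (RSub a b) = rval s a - rval s b"
| "rval s (RMul a b) = rval s a * rval s b"
| "rval s (RDiv a b) = rval s a / rval s b"

primrec bval :: "state \<Rightarrow> bexp \<Rightarrow> bool" where
  "bval s (NLess a b) \<longleftrightarrow> nval s a < nval s b"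
| "bval s (RLess a b) \<longleftrightarrow> rval s a < rval s b"
| "bval s (BNot b) \<longleftrightarrow> \<not> bval s b"
| "bval s (BAnd a b) \<longleftrightarrow> bval s a \<and> bval s b"

definition nstore :: "string \<Rightarrow> nat \<Rightarrow> nat \<Rightarrow> state \<Rightarrow> state" where
  "nstore x i v s = s\<lparr>nmem := (nmem s)(x := (nmem s x)(i := v))\<rparr>"

definition rstore :: "string \<Rightarrow> nat \<Rightarrow> real \<Rightarrow> state \<Rightarrow> state" where
  "rstore x i v s = s\<lparr>rmem := (rmem s)(x := (rmem s x)(i := v))\<rparr>"

text \<open>\<open>exec P s t s'\<close>: started in \<open>s\<close>, program \<open>P\<close> halts in \<open>s'\<close> after exactly \<open>t\<close> steps.\<close>

inductive exec :: "com \<Rightarrow> state \<Rightarrow> nat \<Rightarrow> state \<Rightarrow> bool" where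
  exec_Skip: "exec Skip s 1 s"
| exec_NStore: "exec (NStore x i a) s 1 (nstore x (nval s i) (nval s a) s)"
| exec_RStore: "exec (RStore x i a) s 1 (rstore x (nval s i) (rval s a) s)"
| exec_Seq: "exec p s t s' \<Longrightarrow> exec q s' u s'' \<Longrightarrow> exec (Seq p q) s (t + u) s''"
| exec_CondT: "bval s b \<Longrightarrow> exec p s t s' \<Longrightarrow> exec (Cond b p q) s (1 + t) s'"
| exec_CondF: "\<not> bval s b \<Longrightarrow> exec q s t s' \<Longrightarrow> exec (Cond b p q) s (1 + t) s'"
| exec_WhileF: "\<not> bval s b \<Longrightarrow> exec (While b p) s 1 s"
| exec_WhileT: "bval s b \<Longrightarrow> exec p s t s' \<Longrightarrow> exec (While b p) s' u s'' \<Longrightarrow>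
    exec (While b p) s (1 + t + u) s''"

inductive_cases exec_SkipE: "exec Skip s t s'"
inductive_cases exec_NStoreE: "exec (NStore x i a) s t s'"
inductive_cases exec_RStoreE: "exec (RStore x i a) s t s'"
inductive_cases exec_SeqE: "exec (Seq p q) s t s'"
inductive_cases exec_CondE: "exec (Cond b p q) s t s'"
inductive_cases exec_WhileE: "exec (While b p) s t s'"

lemma exec_deterministic:
  "exec p s t s' \<Longrightarrow> exec p s u s'' \<Longrightarrow> u = t \<and> s'' = s'"
proof (induction arbitrary: u s'' rule: exec.induct)
  case exec_Skip
  from exec_Skip.prems show ?case by (elim exec_SkipE) simp
next
  case exec_NStore
  from exec_NStore.prems show ?case by (elim exec_NStoreE) simp
next
  case exec_RStore
  from exec_RStore.prems show ?case by (elim exec_RStoreE) simp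
next
  case (exec_Seq p s t s' q v r)
  from exec_Seq.prems obtain t1 t2 s1
    where "u = t1 + t2" "exec p s t1 s1" "exec q s1 t2 s''" by (rule exec_SeqE)
  with exec_Seq.IH show ?case by metis
next
  case (exec_CondT s b p t s' q)
  from exec_CondT.prems exec_CondT.hyps(1) obtain t1
    where "u = 1 + t1" "exec p s t1 s''" by (elim exec_CondE) simp_all
  with exec_CondT.IH show ?case by metis
next
  case (exec_CondF s b q t s' p)
  from exec_CondF.prems exec_CondF.hyps(1) obtain t1
    where "u = 1 + t1" "exec q s t1 s''" by (elim exec_CondE) simp_all
  with exec_CondF.IH show ?case by metis
next
  case (exec_WhileF s b p)
  from exec_WhileF.prems show ?case by (rule exec_WhileE) (use exec_WhileF.hyps in simp_all)
next
  case (exec_WhileT s b p t s' v r)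
  from exec_WhileT.prems obtain t1 t2 s1
    where "u = 1 + t1 + t2" "exec p s t1 s1" "exec (While b p) s1 t2 s''"
    by (rule exec_WhileE) (use exec_WhileT.hyps(1) in simp_all)
  with exec_WhileT.IH show ?case by metis
qed


section \<open>Input and output of k-Median programs\<close>

text \<open>
  A space with \<open>n\<close> points is presented to a program with its points numbered \<open>0, \<dots>, n - 1\<close>.
  Distances form an \<open>n \<times> n\<close> matrix stored row by row, and \<open>C\<close> and \<open>F\<close> are given by their
  characteristic vectors. The precision \<open>\<epsilon>\<close> is part of the input. All remaining cells are 0.
\<close>

definition kmedian_input ::
  "real \<Rightarrow> nat \<Rightarrow> (nat \<Rightarrow> nat \<Rightarrow> real) \<Rightarrow> nat set \<Rightarrow> (nat \<Rightarrow> real) \<Rightarrow> nat set \<Rightarrow> nat \<Rightarrow> state" where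
  "kmedian_input \<epsilon> n d C w F k =
     \<lparr>nmem = (\<lambda>x i.
        if x = ''n'' \<and> i = 0 then n
        else if x = ''k'' \<and> i = 0 then k
        else if x = ''client'' \<and> i \<in> C then 1
        else if x = ''facility'' \<and> i \<in> F then 1
        else 0),
      rmem = (\<lambda>x i.
        if x = ''eps'' \<and> i = 0 then \<epsilon>
        else if x = ''dist'' \<and> i < n * n then d (i div n) (i mod n)
        else if x = ''weight'' \<and> i \<in> C then w i
        else 0)\<rparr>"

definition kmedian_output :: "nat \<Rightarrow> state \<Rightarrow> nat set" where
  "kmedian_output k s = nmem s ''out'' ` {..<k}"

end

theory Submission
  imports Defs
begin

text \<open>
  Guess for each of the \<open>k\<close> optimal clusters its leader, the client closest to the optimal
  facility \<open>o\<^sub>i\<close>, and the leader's distance to \<open>o\<^sub>i\<close> up to a factor \<open>1 + \<epsilon>\<close>; this is one of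
  \<open>O(log n)\<close> radii per client, and \<open>(log n)^O(k) \<le> g(k) n\<close>. It remains to open one facility in each of the
  \<open>k\<close> guessed balls. A client \<open>j\<close> is at most \<open>d j l\<^sub>i + R\<^sub>i\<close> away from every facility in the ball with
  center \<open>l\<^sub>i\<close> and radius \<open>R\<^sub>i\<close>, and paying this bound costs at most \<open>(3 + \<epsilon>) OPT\<close> in total.

  The saving over this bound is submodular, and is maximized by the tabular greedy algorithm: fill
  a table with \<open>m = O(1 + 1/\<epsilon>)\<close> columns and one row per ball so as to minimize, entry by entry, the
  average cost of the \<open>m\<^sup>k\<close> selections that take from each row the entry of some column. One column
  divides the excess over \<open>OPT\<close> by \<open>1 + 1/m\<close>, and \<open>(1 + 1/m)\<^sup>-\<^sup>m\<close> tends to \<open>1/e\<close>; hence the best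
  selection costs about \<open>OPT + (3 - 1) OPT / e\<close>. No randomness is needed, because all
  \<open>m\<^sup>k\<close> selections can be evaluated.
\<close>

section \<open>Hoare rules with step counts\<close>

text \<open>Opening one facility per ball is a partition constraint, under which plain greedy in
  general secures only half of the best saving. The \<open>m\<close> columns act as \<open>m\<close>
  rounds of a fractional ascent in which each choice carries weight \<open>1 / m\<close>; this is
  what gains \<open>1 - 1/e\<close>.

  The bound \<open>d j l + R\<close> is built in as an artificial entry of each ball. By the
  triangle inequality it is worse than every facility of the ball, so costs are defined before
  anything is opened and only fall as the table fills. A full table no longer contains it, and the
  surrogate cost has become a true one.

  The machine shapes the rest. It has neither logarithms nor rounding, so the radii of a client are
  found by walking outwards over its actual facility distances, and the aspect ratio enters only the
  estimate of their number. It cannot multiply naturals, so the numbers of selections and guesses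
  are kept as reals, and counters are split into digits by repeated subtraction. This costs time
  linear in the counter, which is affordable because there are at most
  \<open>g(k, \<epsilon>) * n\<close> guesses.\<close>

primrec nw :: "com \<Rightarrow> string set" where
  "nw Skip = {}"
| "nw (NStore x i a) = {x}"
| "nw (RStore x i a) = {}"
| "nw (Seq p q) = nw p \<union> nw q"
| "nw (Cond b p q) = nw p \<union> nw q"
| "nw (While b p) = nw p"

primrec rw :: "com \<Rightarrow> string set" where
  "rw Skip = {}"
| "rw (NStore x i a) = {}"
| "rw (RStore x i a) = {x}"
| "rw (Seq p q) = rw p \<union> rw q"
| "rw (Cond b p q) = rw p \<union> rw q"
| "rw (While b p) = rw p"

text \<open>Non-interference is tracked for whole arrays, so that it reduces to a syntactic check of
  the names in \<open>nw\<close> and \<open>rw\<close>.\<close>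

definition frame :: "com \<Rightarrow> state \<Rightarrow> state \<Rightarrow> bool" where
  "frame p s s' \<longleftrightarrow>
     (\<forall>x. x \<notin> nw p \<longrightarrow> nmem s' x = nmem s x) \<and> (\<forall>x. x \<notin> rw p \<longrightarrow> rmem s' x = rmem s x)"

lemma nmem_nstore [simp]: "nmem (nstore x i v s) = (nmem s)(x := (nmem s x)(i := v))"
  by (simp add: nstore_def)

lemma rmem_nstore [simp]: "rmem (nstore x i v s) = rmem s"
  by (simp add: nstore_def)

lemma nmem_rstore [simp]: "nmem (rstore x i v s) = nmem s"
  by (simp add: rstore_def)

lemma rmem_rstore [simp]: "rmem (rstore x i v s) = (rmem s)(x := (rmem s x)(i := v))"
  by (simp add: rstore_def)

lemma frame_refl [simp]: "frame p s s"
  by (simp add: frame_def)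

lemma frame_trans: "frame p s s' \<Longrightarrow> frame p s' s'' \<Longrightarrow> frame p s s''"
  by (simp add: frame_def)

lemma exec_frame: "exec p s t s' \<Longrightarrow> frame p s s'"
proof (induction rule: exec.induct)
qed (auto simp: frame_def)

text \<open>Total correctness with an upper bound on the steps. As \<open>exec\<close> is
  deterministic, the run whose existence is claimed is the only one.\<close>

definition runs :: "com \<Rightarrow> state \<Rightarrow> nat \<Rightarrow> (state \<Rightarrow> bool) \<Rightarrow> bool" where
  "runs p s T Q \<longleftrightarrow> (\<exists>t s'. exec p s t s' \<and> t \<le> T \<and> Q s')"

text \<open>The frame comes for free with the final state, so a postcondition need only speak of
  what the program is meant to change.\<close>

lemma runs_mono:
  assumes "runs p s T Q" "T \<le> T'" "\<And>s'. frame p s s' \<Longrightarrow> Q s' \<Longrightarrow> Q' s'"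
  shows "runs p s T' Q'"
  using assms exec_frame unfolding runs_def by (meson le_trans)

section \<open>Execution of straight-line code by rewriting\<close>

lemma exec_Skip_iff: "exec Skip s t s' \<longleftrightarrow> t = 1 \<and> s' = s"
  by (metis exec_Skip exec_SkipE One_nat_def)

lemma exec_NStore_iff:
  "exec (NStore x i a) s t s' \<longleftrightarrow> t = 1 \<and> s' = nstore x (nval s i) (nval s a) s"
  by (metis exec_NStore exec_NStoreE One_nat_def)

lemma exec_RStore_iff:
  "exec (RStore x i a) s t s' \<longleftrightarrow> t = 1 \<and> s' = rstore x (nval s i) (rval s a) s"
  by (metis exec_RStore exec_RStoreE One_nat_def)

lemma runs_Skip [simp]: "runs Skip s T Q \<longleftrightarrow> 1 \<le> T \<and> Q s"
  by (simp add: runs_def exec_Skip_iff)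

lemma runs_NStore [simp]:
  "runs (NStore x i a) s T Q \<longleftrightarrow> 1 \<le> T \<and> Q (nstore x (nval s i) (nval s a) s)"
  by (simp add: runs_def exec_NStore_iff)

lemma runs_RStore [simp]:
  "runs (RStore x i a) s T Q \<longleftrightarrow> 1 \<le> T \<and> Q (rstore x (nval s i) (rval s a) s)"
  by (simp add: runs_def exec_RStore_iff)

lemma runs_Cond [simp]:
  "runs (Cond b p q) s T Q \<longleftrightarrow>
     1 \<le> T \<and> (if bval s b then runs p s (T - 1) Q else runs q s (T - 1) Q)"
proof
  assume "runs (Cond b p q) s T Q"
  then obtain t s' where t: "exec (Cond b p q) s t s'" "t \<le> T" "Q s'"
    by (auto simp: runs_def)
  from t(1) show "1 \<le> T \<and> (if bval s b then runs p s (T - 1) Q else runs q s (T - 1) Q)" (is ?G)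
  proof (rule exec_CondE)
    fix u assume "t = Suc u" "bval s b" "exec p s u s'"
    with t(2,3) show ?G by (auto simp: runs_def intro!: exI[of _ u] exI[of _ s'])
  next
    fix u assume "t = Suc u" "\<not> bval s b" "exec q s u s'"
    with t(2,3) show ?G by (auto simp: runs_def intro!: exI[of _ u] exI[of _ s'])
  qed
next
  assume R: "1 \<le> T \<and> (if bval s b then runs p s (T - 1) Q else runs q s (T - 1) Q)"
  show "runs (Cond b p q) s T Q"
  proof (cases "bval s b")
    case True
    with R obtain u s' where "exec p s u s'" "u \<le> T - 1" "Q s'" by (auto simp: runs_def)
    with True R exec_CondT[of s b p u s' q] show ?thesis
      unfolding runs_def by (intro exI[of _ "1 + u"] exI[of _ s']) auto
  next
    case False
    with R obtain u s' where "exec q s u s'" "u \<le> T - 1" "Q s'" by (auto simp: runs_def)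
    with False R exec_CondF[of s b q u s' p] show ?thesis
      unfolding runs_def by (intro exI[of _ "1 + u"] exI[of _ s']) auto
  qed
qed

lemma runs_Seq:
  assumes "runs p s U (\<lambda>s'. runs q s' W Q)" "U + W \<le> T"
  shows "runs (Seq p q) s T Q"
proof -
  obtain t s' u s'' where "exec p s t s'" "t \<le> U" "exec q s' u s''" "u \<le> W" "Q s''"
    using assms(1) by (auto simp: runs_def)
  with exec_Seq[of p s t s' q u s''] assms(2) show ?thesis
    unfolding runs_def by (intro exI[of _ "t + u"] exI[of _ s'']) auto
qed

lemma runs_seq:
  assumes "runs p s U Q1" "U + W \<le> T" "\<And>s'. frame p s s' \<Longrightarrow> Q1 s' \<Longrightarrow> runs q s' W Q"
  shows "runs (Seq p q) s T Q"
  by (rule runs_Seq[OF runs_mono[OF assms(1) order.refl assms(3)] assms(2)])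

lemma runs_Seq_iff:
  "runs (Seq p q) s T Q \<longleftrightarrow> (\<exists>t s'. exec p s t s' \<and> t \<le> T \<and> runs q s' (T - t) Q)"
proof
  assume "runs (Seq p q) s T Q"
  then obtain t s' where t: "exec (Seq p q) s t s'" "t \<le> T" "Q s'" by (auto simp: runs_def)
  from t(1) obtain u v s1 where "t = u + v" "exec p s u s1" "exec q s1 v s'" by (rule exec_SeqE)
  with t have "runs q s1 (T - u) Q" "u \<le> T"
    unfolding runs_def by (auto intro!: exI[of _ v] exI[of _ s'])
  with \<open>exec p s u s1\<close> show "\<exists>t s'. exec p s t s' \<and> t \<le> T \<and> runs q s' (T - t) Q" by blast
next
  assume "\<exists>t s'. exec p s t s' \<and> t \<le> T \<and> runs q s' (T - t) Q"
  then obtain t s' where "exec p s t s'" "t \<le> T" "runs q s' (T - t) Q" by blast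
  then show "runs (Seq p q) s T Q"
    by (intro runs_Seq[of p s t q "T - t"]) (auto simp: runs_def)
qed

lemma runs_Seq_NStore [simp]:
  "runs (Seq (NStore x i a) q) s T Q \<longleftrightarrow>
     1 \<le> T \<and> runs q (nstore x (nval s i) (nval s a) s) (T - 1) Q"
  unfolding runs_Seq_iff exec_NStore_iff by auto

lemma runs_Seq_RStore [simp]:
  "runs (Seq (RStore x i a) q) s T Q \<longleftrightarrow>
     1 \<le> T \<and> runs q (rstore x (nval s i) (rval s a) s) (T - 1) Q"
  unfolding runs_Seq_iff exec_RStore_iff by auto

text \<open>Nesting to the right exposes the first command, to which the rewrite rules for
  assignments and conditionals apply; the simplifier thereby executes loop-free code.\<close>

lemma runs_Seq_assoc [simp]: "runs (Seq (Seq p q) r) s T Q \<longleftrightarrow> runs (Seq p (Seq q r)) s T Q"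
proof -
  have "exec (Seq (Seq p q) r) s t s' \<longleftrightarrow> exec (Seq p (Seq q r)) s t s'" for t s'
  proof
    assume "exec (Seq (Seq p q) r) s t s'"
    then obtain u v s1 where 1: "t = u + v" "exec (Seq p q) s u s1" "exec r s1 v s'"
      by (rule exec_SeqE)
    from 1(2) obtain u1 u2 s2 where 2: "u = u1 + u2" "exec p s u1 s2" "exec q s2 u2 s1"
      by (rule exec_SeqE)
    show "exec (Seq p (Seq q r)) s t s'"
      using exec_Seq[OF 2(2) exec_Seq[OF 2(3) 1(3)]] 1(1) 2(1) by (simp add: add.assoc)
  next
    assume "exec (Seq p (Seq q r)) s t s'"
    then obtain u v s1 where 1: "t = u + v" "exec p s u s1" "exec (Seq q r) s1 v s'"
      by (rule exec_SeqE)
    from 1(3) obtain u1 u2 s2 where 2: "v = u1 + u2" "exec q s1 u1 s2" "exec r s2 u2 s'"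
      by (rule exec_SeqE)
    show "exec (Seq (Seq p q) r) s t s'"
      using exec_Seq[OF exec_Seq[OF 1(2) 2(2)] 2(3)] 1(1) 2(1) by (simp add: add.assoc)
  qed
  then show ?thesis by (simp add: runs_def)
qed

lemma runs_Seq_Cond [simp]:
  "runs (Seq (Cond b p1 p2) q) s T Q \<longleftrightarrow>
     1 \<le> T \<and> (if bval s b then runs (Seq p1 q) s (T - 1) Q else runs (Seq p2 q) s (T - 1) Q)"
proof -
  \<comment> \<open>Moves the step spent on the guard from the running time into the budget,
    whichever branch is taken.\<close>
  have shift: "(\<exists>t s'. (\<exists>u. t = Suc u \<and> X u s') \<and> t \<le> T \<and> R s' (T - t)) \<longleftrightarrow>
      1 \<le> T \<and> (\<exists>u s'. X u s' \<and> u \<le> T - 1 \<and> R s' (T - 1 - u))" for X and R :: "state \<Rightarrow> nat \<Rightarrow> bool"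
  proof -
    have "(\<exists>t s'. (\<exists>u. t = Suc u \<and> X u s') \<and> t \<le> T \<and> R s' (T - t)) \<longleftrightarrow>
        (\<exists>u s'. X u s' \<and> Suc u \<le> T \<and> R s' (T - Suc u))" by blast
    then show ?thesis by (cases T) auto
  qed
  show ?thesis
  proof (cases "bval s b")
    case True
    have ex: "exec (Cond b p1 p2) s t s' \<longleftrightarrow> (\<exists>u. t = Suc u \<and> exec p1 s u s')" for t s'
      using True exec_CondT[of s b p1 _ s' p2] by (auto elim: exec_CondE)
    have "runs (Seq (Cond b p1 p2) q) s T Q \<longleftrightarrow> 1 \<le> T \<and> runs (Seq p1 q) s (T - 1) Q"
      unfolding runs_Seq_iff ex by (rule shift)
    with True show ?thesis by simp
  next
    case False
    have ex: "exec (Cond b p1 p2) s t s' \<longleftrightarrow> (\<exists>u. t = Suc u \<and> exec p2 s u s')" for t s'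
      using False exec_CondF[of s b p2 _ s' p1] by (auto elim: exec_CondE)
    have "runs (Seq (Cond b p1 p2) q) s T Q \<longleftrightarrow> 1 \<le> T \<and> runs (Seq p2 q) s (T - 1) Q"
      unfolding runs_Seq_iff ex by (rule shift)
    with False show ?thesis by simp
  qed
qed

text \<open>The invariant carries the number of completed rounds. That there are at most
  \<open>N\<close> is not assumed but follows each time from the invariant and the true guard; the
  last 1 pays for the failing guard.\<close>

lemma runs_While:
  assumes init: "I 0 s"
    and step: "\<And>i s'. frame p s s' \<Longrightarrow> I i s' \<Longrightarrow> bval s' b \<Longrightarrow> i < N \<and> runs p s' T (I (Suc i))"
    and post: "\<And>i s'. frame p s s' \<Longrightarrow> I i s' \<Longrightarrow> \<not> bval s' b \<Longrightarrow> Q s'"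
  shows "runs (While b p) s (N * (T + 1) + 1) Q"
proof -
  have *: "i \<le> N \<Longrightarrow> frame p s s' \<Longrightarrow> I i s' \<Longrightarrow> runs (While b p) s' ((N - i) * (T + 1) + 1) Q"
    for i s'
  proof (induction "N - i" arbitrary: i s' rule: less_induct)
    case less
    show ?case
    proof (cases "bval s' b")
      case False
      with post[OF less.prems(2,3)] exec_WhileF[of s' b p] show ?thesis
        unfolding runs_def by (intro exI[of _ 1] exI[of _ s']) auto
    next
      case True
      from step[OF less.prems(2,3) True] obtain t s1 where
        i: "i < N" and t: "exec p s' t s1" "t \<le> T" "I (Suc i) s1" by (auto simp: runs_def)
      have "frame p s s1" using less.prems(2) exec_frame[OF t(1)] frame_trans by blast
      then have "runs (While b p) s1 ((N - Suc i) * (T + 1) + 1) Q"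
        using i less.hyps[of "Suc i" s1] t(3) by auto
      then obtain u s2 where u: "exec (While b p) s1 u s2" "u \<le> (N - Suc i) * (T + 1) + 1" "Q s2"
        by (auto simp: runs_def)
      have "(N - i) * (T + 1) = (N - Suc i) * (T + 1) + (T + 1)"
        using i by (metis Suc_diff_Suc add.commute mult_Suc)
      with t(2) u(2) have "1 + t + u \<le> (N - i) * (T + 1) + 1" by linarith
      with exec_WhileT[OF True t(1) u(1)] u(3) show ?thesis unfolding runs_def by blast
    qed
  qed
  from *[of 0 s] init show ?thesis by simp
qed

abbreviation NV :: "string \<Rightarrow> nexp" where "NV x \<equiv> NLoad x (NConst 0)"
abbreviation RV :: "string \<Rightarrow> rexp" where "RV x \<equiv> RLoad x (NConst 0)"
abbreviation NSet :: "string \<Rightarrow> nexp \<Rightarrow> com" where "NSet x a \<equiv> NStore x (NConst 0) a"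
abbreviation RSet :: "string \<Rightarrow> rexp \<Rightarrow> com" where "RSet x a \<equiv> RStore x (NConst 0) a"
abbreviation NInc :: "string \<Rightarrow> com" where "NInc x \<equiv> NSet x (NAdd (NV x) (NConst 1))"

text \<open>The guard is left free because the bounds \<open>m ^ k\<close> and \<open>nb ^ k\<close>
  of some loops are available only as reals.\<close>

definition For :: "string \<Rightarrow> bexp \<Rightarrow> com \<Rightarrow> com" where
  "For v b p = Seq (NSet v (NConst 0)) (While b (Seq p (NInc v)))"

lemma nw_For [simp]: "nw (For v b p) = insert v (nw p)"
  by (auto simp: For_def)

lemma rw_For [simp]: "rw (For v b p) = rw p"
  by (auto simp: For_def)

text \<open>The body has to restore the invariant for the state after the increment of
  \<open>v\<close>. A round pays 2 extra steps for guard and increment; the final 2 are the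
  initialization and the failing guard.\<close>

lemma runs_For:
  assumes v: "v \<notin> nw p"
    and init: "I 0 (nstore v 0 0 s)"
    and guard: "\<And>s'. frame (For v b p) s s' \<Longrightarrow> bval s' b \<longleftrightarrow> nmem s' v 0 < N"
    and step: "\<And>i s'. i < N \<Longrightarrow> frame (For v b p) s s' \<Longrightarrow> nmem s' v 0 = i \<Longrightarrow> I i s' \<Longrightarrow>
                 runs p s' T (\<lambda>s''. I (Suc i) (nstore v 0 (Suc i) s''))"
    and post: "\<And>s'. frame (For v b p) s s' \<Longrightarrow> I N s' \<Longrightarrow> Q s'"
    and time: "N * (T + 2) + 2 \<le> T'"
  shows "runs (For v b p) s T' Q"
proof -
  let ?s = "nstore v 0 0 s" and ?p = "Seq p (NInc v)"
  let ?J = "\<lambda>i s'. i \<le> N \<and> nmem s' v 0 = i \<and> I i s'"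
  have fr: "frame (For v b p) s s'" if "frame ?p ?s s'" for s'
    using that by (auto simp: frame_def)
  have "runs (While b ?p) ?s (N * (T + 1 + 1) + 1) Q"
  proof (rule runs_While[where I = ?J])
    show "?J 0 ?s" using init by simp
  next
    fix i s' assume A: "frame ?p ?s s'" "?J i s'" "bval s' b"
    with guard[OF fr[OF A(1)]] have i: "i < N" by simp
    have "runs ?p s' (T + 1) (?J (Suc i))"
    proof (rule runs_seq[OF step[OF i fr[OF A(1)]]])
      fix s'' assume B: "frame p s' s''" "I (Suc i) (nstore v 0 (Suc i) s'')"
      then have "nmem s'' v 0 = i" using A(2) v by (simp add: frame_def)
      then show "runs (NInc v) s'' 1 (?J (Suc i))" using B i by simp
    qed (use A in simp_all)
    with i show "i < N \<and> runs ?p s' (T + 1) (?J (Suc i))" by simp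
  next
    fix i s' assume A: "frame ?p ?s s'" "?J i s'" "\<not> bval s' b"
    with guard[OF fr[OF A(1)]] have "i = N" by simp
    with A(2) post[OF fr[OF A(1)]] show "Q s'" by simp
  qed
  then have "runs (While b ?p) ?s (N * (T + 2) + 1) Q" by simp
  then show ?thesis unfolding For_def
    by (intro runs_Seq[where U = 1 and W = "N * (T + 2) + 1"]) (use time in auto)
qed

section \<open>Tabular greedy\<close>

text \<open>Here \<open>g i e j\<close> is the cost of serving \<open>j\<close> by entry
  \<open>e\<close> of part \<open>i\<close>, and \<open>g_le\<close> makes the default entry 0 the
  worst one. No metric is involved.\<close>

locale tabular =
  fixes k m :: nat and C :: "'c set" and w :: "'c \<Rightarrow> real"
    and g :: "nat \<Rightarrow> nat \<Rightarrow> 'c \<Rightarrow> real" and E :: "nat \<Rightarrow> nat set"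
  assumes fin: "finite C" and w_nonneg: "\<And>j. j \<in> C \<Longrightarrow> 0 \<le> w j"
    and k_pos: "0 < k" and m_pos: "0 < m"
    and g_le: "\<And>i e j. i < k \<Longrightarrow> e \<in> E i \<Longrightarrow> j \<in> C \<Longrightarrow> g i e j \<le> g i 0 j"
begin

definition near :: "(nat \<Rightarrow> nat) \<Rightarrow> 'c \<Rightarrow> real" where
  "near e j = Min ((\<lambda>i. g i (e i) j) ` {..<k})"

definition scost :: "(nat \<Rightarrow> nat) \<Rightarrow> real" where
  "scost e = (\<Sum>j\<in>C. w j * near e j)"

definition Om :: "(nat \<Rightarrow> nat) set" where
  "Om = {..<k} \<rightarrow>\<^sub>E {..<m}"

definition sel :: "(nat \<Rightarrow> nat \<Rightarrow> nat) \<Rightarrow> (nat \<Rightarrow> nat) \<Rightarrow> nat \<Rightarrow> nat" where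
  "sel T c = (\<lambda>i. T (c i) i)"

text \<open>This is \<open>m ^ k\<close> times the expected cost when every part draws its column
  uniformly and independently.\<close>

definition total :: "(nat \<Rightarrow> nat \<Rightarrow> nat) \<Rightarrow> real" where
  "total T = (\<Sum>c\<in>Om. scost (sel T c))"

definition put :: "(nat \<Rightarrow> nat \<Rightarrow> nat) \<Rightarrow> nat \<Rightarrow> nat \<Rightarrow> nat \<Rightarrow> nat \<Rightarrow> nat \<Rightarrow> nat" where
  "put T q i a = T(q := (T q)(i := a))"

text \<open>The first index of a table is the column, the second the part; an entry \<open>0\<close> is an unfilled
  one.\<close>

inductive greedy :: "nat \<Rightarrow> nat \<Rightarrow> (nat \<Rightarrow> nat \<Rightarrow> nat) \<Rightarrow> bool" where
  start: "(\<And>q i. q < m \<Longrightarrow> i < k \<Longrightarrow> T q i = 0) \<Longrightarrow> greedy 0 0 T"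
| step: "greedy q i T \<Longrightarrow> q < m \<Longrightarrow> i < k \<Longrightarrow> a \<in> E i \<Longrightarrow>
    (\<And>x. x \<in> E i \<Longrightarrow> total (put T q i a) \<le> total (put T q i x)) \<Longrightarrow>
    (\<And>q' i'. q' < m \<Longrightarrow> i' < k \<Longrightarrow> T' q' i' = put T q i a q' i') \<Longrightarrow> greedy q (Suc i) T'"
| wrap: "greedy q k T \<Longrightarrow> greedy (Suc q) 0 T"

lemma near_le: "i < k \<Longrightarrow> near e j \<le> g i (e i) j"
  unfolding near_def by (rule Min_le) auto

lemma near_geI: "(\<And>i. i < k \<Longrightarrow> x \<le> g i (e i) j) \<Longrightarrow> x \<le> near e j"
  unfolding near_def using k_pos by (subst Min_ge_iff) auto

lemma scost_cong: "(\<And>i. i < k \<Longrightarrow> e i = e' i) \<Longrightarrow> scost e = scost e'"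
  unfolding scost_def near_def
  by (intro sum.cong refl arg_cong2[where f = "(*)"] arg_cong[where f = Min] image_cong) auto

lemma finite_Om [simp]: "finite Om"
  unfolding Om_def by (simp add: finite_PiE)

lemma card_Om: "card Om = m ^ k"
  unfolding Om_def by (simp add: card_PiE)

lemma OmD: "c \<in> Om \<Longrightarrow> i < k \<Longrightarrow> c i < m"
  unfolding Om_def by auto

lemma Om_upd: "c \<in> Om \<Longrightarrow> i < k \<Longrightarrow> v < m \<Longrightarrow> c(i := v) \<in> Om"
  unfolding Om_def by (auto simp: PiE_iff extensional_def)

lemma total_cong: "(\<And>q i. q < m \<Longrightarrow> i < k \<Longrightarrow> T q i = T' q i) \<Longrightarrow> total T = total T'"
  unfolding total_def sel_def by (intro sum.cong refl scost_cong) (auto dest: OmD)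

text \<open>Overwriting coordinate \<open>i\<close> by \<open>q\<close> is an
  \<open>m\<close>-to-one map onto the selections with \<open>c i = q\<close>. Those selections, the
  only ones that see a new entry in column \<open>q\<close> of part \<open>i\<close>, thus carry a
  \<open>1 / m\<close> share of the sum on the left.\<close>

lemma sum_Om_upd:
  fixes h :: "(nat \<Rightarrow> nat) \<Rightarrow> real"
  assumes "i < k" "q < m"
  shows "(\<Sum>c\<in>Om. h (c(i := q))) = real m * (\<Sum>c\<in>{c\<in>Om. c i = q}. h c)"
proof -
  let ?u = "\<lambda>c. c(i := q)" and ?S = "{c\<in>Om. c i = q}"
  have "(\<Sum>c\<in>Om. h (?u c)) = (\<Sum>y\<in>?S. \<Sum>c\<in>{c\<in>Om. ?u c = y}. h (?u c))"
    by (rule sum.group[symmetric]) (auto intro: Om_upd assms)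
  also have "\<dots> = (\<Sum>y\<in>?S. real m * h y)"
  proof (rule sum.cong[OF refl])
    fix y assume y: "y \<in> ?S"
    have eq: "{c\<in>Om. ?u c = y} = (\<lambda>v. y(i := v)) ` {..<m}"
    proof (intro equalityI subsetI)
      fix c assume c: "c \<in> {c\<in>Om. ?u c = y}"
      then have "c = y(i := c i)" by (metis (mono_tags) mem_Collect_eq fun_upd_triv fun_upd_upd)
      with c assms show "c \<in> (\<lambda>v. y(i := v)) ` {..<m}" by (auto dest: OmD)
    qed (use y assms in \<open>auto intro: Om_upd\<close>)
    have "inj_on (\<lambda>v. y(i := v)) {..<m}" by (rule inj_onI) (metis fun_upd_same)
    then have "card {c\<in>Om. ?u c = y} = m" unfolding eq by (simp add: card_image)
    then show "(\<Sum>c\<in>{c\<in>Om. ?u c = y}. h (?u c)) = real m * h y" by simp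
  qed
  finally show ?thesis by (simp add: sum_distrib_left)
qed

text \<open>The marginal saving of \<open>b\<close> when it is added on top of every selection,
  displacing nothing.\<close>

definition excess :: "(nat \<Rightarrow> nat \<Rightarrow> nat) \<Rightarrow> nat \<Rightarrow> nat \<Rightarrow> real" where
  "excess T i b = (\<Sum>c\<in>Om. \<Sum>j\<in>C. w j * max 0 (near (sel T c) j - g i b j))"

text \<open>The greedy choice \<open>a\<close> is at least as good as \<open>b\<close>. Putting
  \<open>b\<close> into an unfilled cell realizes its marginal saving on the selections through that
  cell, a \<open>1 / m\<close> share. The saving is then measured in the table after the step, where
  it can only be smaller.\<close>

lemma greedy_gain:
  assumes i: "i < k" "q < m" and T0: "T q i = 0" and a: "a \<in> E i" and b: "b \<in> E i"
    and val: "\<And>q'. q' < m \<Longrightarrow> T q' i \<in> insert 0 (E i)"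
    and best: "total (put T q i a) \<le> total (put T q i b)"
  shows "total (put T q i a) + excess (put T q i a) i b / real m \<le> total T"
proof -
  let ?A = "put T q i a" and ?B = "put T q i b"
  define h where "h = (\<lambda>c. \<Sum>j\<in>C. w j * max 0 (near (sel T c) j - g i b j))"
  \<comment> \<open>The right-hand side is the minimum of the old cost and \<open>g i b j\<close>:
    the displaced entry is the default, so no earlier saving is lost.\<close>
  have min: "near (sel ?B c) j \<le> near (sel T c) j - max 0 (near (sel T c) j - g i b j)"
    if "c \<in> Om" "c i = q" "j \<in> C" for c j
  proof -
    have "near (sel ?B c) j \<le> near (sel T c) j"
    proof (rule near_geI)
      fix i' assume i': "i' < k"
      have "near (sel ?B c) j \<le> g i' (sel ?B c i') j" by (rule near_le[OF i'])
      also have "\<dots> \<le> g i' (sel T c i') j"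
        using T0 that g_le[OF i(1) b that(3)] by (auto simp: sel_def put_def)
      finally show "near (sel ?B c) j \<le> g i' (sel T c i') j" .
    qed
    moreover have "near (sel ?B c) j \<le> g i b j"
      using near_le[OF i(1), of "sel ?B c" j] that(2) by (simp add: sel_def put_def)
    ultimately show ?thesis by (simp add: max_def)
  qed
  have "scost (sel ?B c) \<le> scost (sel T c) - (if c i = q then h c else 0)" if c: "c \<in> Om" for c
  proof (cases "c i = q")
    case True
    have "scost (sel ?B c) \<le> (\<Sum>j\<in>C. w j * (near (sel T c) j - max 0 (near (sel T c) j - g i b j)))"
      unfolding scost_def by (intro sum_mono mult_left_mono min c True w_nonneg)
    also have "\<dots> = scost (sel T c) - h c"
      unfolding scost_def h_def by (simp add: right_diff_distrib sum_subtractf)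
    finally show ?thesis using True by simp
  next
    case False
    have "scost (sel ?B c) = scost (sel T c)"
      by (rule scost_cong) (use False in \<open>auto simp: sel_def put_def\<close>)
    with False show ?thesis by simp
  qed
  then have "total ?B \<le> (\<Sum>c\<in>Om. scost (sel T c) - (if c i = q then h c else 0))"
    unfolding total_def by (rule sum_mono)
  also have "\<dots> = total T - (\<Sum>c\<in>{c\<in>Om. c i = q}. h c)"
    unfolding total_def by (simp add: sum_subtractf sum.inter_filter)
  also have "(\<Sum>c\<in>{c\<in>Om. c i = q}. h c) = (\<Sum>c\<in>Om. h (c(i := q))) / real m"
    using sum_Om_upd[OF i, of h] m_pos by simp
  finally have "total ?A + (\<Sum>c\<in>Om. h (c(i := q))) / real m \<le> total T" using best by simp
  \<comment> \<open>In \<open>T\<close> the selection \<open>c(i := q)\<close> uses the default in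
    part \<open>i\<close>. Whatever \<open>c\<close> uses there in the new table is no worse, so
    less remains to be saved by \<open>b\<close>.\<close>
  moreover have "excess ?A i b \<le> (\<Sum>c\<in>Om. h (c(i := q)))"
    unfolding excess_def h_def
  proof (intro sum_mono mult_left_mono w_nonneg max.mono order.refl diff_right_mono)
    fix c j assume c: "c \<in> Om" and j: "j \<in> C"
    show "near (sel ?A c) j \<le> near (sel T (c(i := q))) j"
    proof (rule near_geI)
      fix i' assume i': "i' < k"
      have "near (sel ?A c) j \<le> g i' (sel ?A c i') j" by (rule near_le[OF i'])
      also have "\<dots> \<le> g i' (sel T (c(i := q)) i') j"
      proof (cases "i' = i")
        case True
        have "sel ?A c i \<in> insert 0 (E i)" using a val[OF OmD[OF c i(1)]]
          by (auto simp: sel_def put_def)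
        then have "g i (sel ?A c i) j \<le> g i 0 j" using g_le[OF i(1) _ j] by (metis insertE order.refl)
        then show ?thesis using True T0 by (simp add: sel_def)
      qed (auto simp: sel_def put_def)
      finally show "near (sel ?A c) j \<le> g i' (sel T (c(i := q)) i') j" .
    qed
  qed
  ultimately show ?thesis using m_pos
    by (smt (verit, best) divide_right_mono of_nat_0_le_iff)
qed

text \<open>Diminishing returns: filling a cell lowers \<open>near\<close>, and with it the saving
  that any further entry could bring.\<close>

lemma excess_mono:
  assumes i: "i < k" and T0: "T q i = 0" and a: "a \<in> E i"
  shows "excess (put T q i a) i' b \<le> excess T i' b"
  unfolding excess_def
proof (intro sum_mono mult_left_mono w_nonneg max.mono order.refl diff_right_mono)
  fix c j assume c: "c \<in> Om" and j: "j \<in> C"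
  show "near (sel (put T q i a) c) j \<le> near (sel T c) j"
  proof (rule near_geI)
    fix l assume l: "l < k"
    have "near (sel (put T q i a) c) j \<le> g l (sel (put T q i a) c l) j" by (rule near_le[OF l])
    also have "\<dots> \<le> g l (sel T c l) j"
      using T0 g_le[OF i a j] by (auto simp: sel_def put_def)
    finally show "near (sel (put T q i a) c) j \<le> g l (sel T c l) j" .
  qed
qed

lemma excess_cong: "(\<And>q i. q < m \<Longrightarrow> i < k \<Longrightarrow> T q i = T' q i) \<Longrightarrow> excess T i b = excess T' i b"
  unfolding excess_def near_def sel_def
  by (intro sum.cong refl arg_cong2[where f = "(*)"] arg_cong2[where f = max]
      arg_cong2[where f = "(-)"] arg_cong[where f = Min] image_cong) (auto dest: OmD)

text \<open>Cells are filled column by column, and by increasing part within a column, so the filled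
  ones form a lexicographic initial segment.\<close>

lemma greedy_entries:
  assumes "greedy q i T" "q' < m" "i' < k"
  shows "(if q' < q \<or> q' = q \<and> i' < i then T q' i' \<in> E i' else T q' i' = 0)"
  using assms
proof (induction arbitrary: q' i' rule: greedy.induct)
  case (step q i T a T')
  then show ?case by (fastforce simp: put_def less_Suc_eq)
next
  case (wrap q T)
  then show ?case by (smt (verit) less_Suc_eq less_zeroE)
qed simp

text \<open>A filled column lowers the excess \<open>D\<close> of the average cost over the optimum so that
  \<open>D' + D' / m \<le> D\<close>: the gains are bounded through the table after the column, an implicit Euler
  step, so that scenarios meeting two new entries need no separate treatment.\<close>

lemma greedy_bound:
  assumes opt: "\<And>i. i < k \<Longrightarrow> b i \<in> E i"
    and asg: "\<And>j. j \<in> C \<Longrightarrow> s j < k"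
    and gr: "greedy q i T"
  defines "opt \<equiv> \<Sum>j\<in>C. w j * g (s j) (b (s j)) j"
  shows "q \<le> m \<Longrightarrow> total T + (\<Sum>i'<i. excess T i' (b i')) / real m
     \<le> real (m ^ k) * (opt + (scost (\<lambda>_. 0) - opt) / (1 + 1 / real m) ^ q)"
  using gr
proof (induction rule: greedy.induct)
  case (start T)
  have "total T = (\<Sum>c\<in>Om. scost (\<lambda>_. 0))"
    unfolding total_def by (intro sum.cong refl scost_cong) (use start in \<open>auto simp: sel_def dest: OmD\<close>)
  then show ?case by (simp add: card_Om)
next
  case (step q i T a T')
  let ?A = "put T q i a"
  have ent: "T q i = 0" "\<And>q'. q' < m \<Longrightarrow> T q' i \<in> insert 0 (E i)"
    using greedy_entries[OF step.hyps(1)] step.hyps(2,3) by (fastforce split: if_splits)+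
  have T': "total T' = total ?A" "excess T' l (b l) = excess ?A l (b l)" for l
    by (intro total_cong excess_cong step.hyps(6); assumption)+
  \<comment> \<open>The gain of this step pays for the excess of part \<open>i\<close>; the excesses
    of the earlier parts of the column have only shrunk. So the invariant collects all
    \<open>k\<close> of them by the end of the column.\<close>
  have "total ?A + excess ?A i (b i) / real m \<le> total T"
    by (rule greedy_gain) (use step.hyps ent opt in auto)
  moreover have "(\<Sum>i'<i. excess ?A i' (b i')) / real m \<le> (\<Sum>i'<i. excess T i' (b i')) / real m"
    by (intro divide_right_mono sum_mono excess_mono) (use step.hyps ent in auto)
  ultimately show ?case using step.IH[OF step.prems] unfolding T' by (simp add: add_divide_distrib)
next
  case (wrap q T)
  let ?S = "\<Sum>i'<k. excess T i' (b i')" and ?M = "real (m ^ k)"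
  \<comment> \<open>The distance to the optimum is at most the sum of the \<open>k\<close> collected
    excesses: for client \<open>j\<close> the summand of its own part \<open>s j\<close> already
    suffices, and the others are nonnegative.\<close>
  have "total T - ?M * opt = (\<Sum>c\<in>Om. \<Sum>j\<in>C. w j * (near (sel T c) j - g (s j) (b (s j)) j))"
    unfolding total_def scost_def opt_def by (simp add: right_diff_distrib sum_subtractf card_Om)
  also have "\<dots> \<le> (\<Sum>c\<in>Om. \<Sum>j\<in>C. \<Sum>i'<k. w j * max 0 (near (sel T c) j - g i' (b i') j))"
  proof (intro sum_mono)
    fix c j assume j: "j \<in> C"
    have "w j * (near (sel T c) j - g (s j) (b (s j)) j)
        \<le> w j * max 0 (near (sel T c) j - g (s j) (b (s j)) j)"
      by (intro mult_left_mono w_nonneg j) simp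
    also have "\<dots> \<le> (\<Sum>i'<k. w j * max 0 (near (sel T c) j - g i' (b i') j))"
      by (rule member_le_sum) (use asg j w_nonneg in auto)
    finally show "w j * (near (sel T c) j - g (s j) (b (s j)) j)
        \<le> (\<Sum>i'<k. w j * max 0 (near (sel T c) j - g i' (b i') j))" .
  qed
  also have "\<dots> = ?S"
    unfolding excess_def by (subst (2) sum.swap, subst sum.swap) (rule refl)
  finally have le: "(total T - ?M * opt) / real m \<le> ?S / real m"
    by (rule divide_right_mono) simp
  let ?r = "1 + 1 / real m"
  have "total T + ?S / real m \<le> ?M * opt + ?M * ((scost (\<lambda>_. 0) - opt) / ?r ^ q)"
    using wrap.IH wrap.prems by (simp add: distrib_left)
  moreover have "(total T - ?M * opt) * ?r = total T - ?M * opt + (total T - ?M * opt) / real m"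
    by (simp add: distrib_left)
  ultimately have "(total T - ?M * opt) * ?r \<le> ?M * ((scost (\<lambda>_. 0) - opt) / ?r ^ q)"
    using le by linarith
  moreover have "0 < ?r" using m_pos by (simp add: add_pos_pos)
  ultimately have "total T - ?M * opt \<le> ?M * ((scost (\<lambda>_. 0) - opt) / ?r ^ q) / ?r"
    by (subst pos_le_divide_eq)
  then show ?case by (simp add: algebra_simps)
qed

text \<open>Raise \<open>1 - x \<le> exp (- x)\<close> at \<open>x = 1 / (m + 1)\<close> to the
  power \<open>m + 1\<close>; the left side is then the inverse of \<open>1 + 1 / m\<close>. Only
  \<open>m\<close> columns are available, and the missing power is the surplus factor on the
  right.\<close>

lemma inverse_growth_le: "1 / (1 + 1 / real m) ^ m \<le> exp (-1) * (1 + 1 / real m)"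
proof -
  have "1 - 1 / real (Suc m) \<le> exp (- (1 / real (Suc m)))"
    using exp_ge_add_one_self[of "- (1 / real (Suc m))"] by simp
  moreover have "1 - 1 / real (Suc m) = 1 / (1 + 1 / real m)"
    using m_pos by (simp add: field_simps)
  ultimately have "(1 / (1 + 1 / real m)) ^ Suc m \<le> exp (- (1 / real (Suc m))) ^ Suc m"
    by (intro power_mono) auto
  also have "\<dots> = exp (-1)"
    by (subst exp_of_nat_mult[symmetric]) (simp add: field_simps)
  finally have "1 / (1 + 1 / real m) ^ m * (1 / (1 + 1 / real m)) \<le> exp (-1)"
    by (simp add: power_divide mult.commute)
  then have "1 / (1 + 1 / real m) ^ m * (1 / (1 + 1 / real m)) * (1 + 1 / real m)
      \<le> exp (-1) * (1 + 1 / real m)"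
    by (intro mult_right_mono) auto
  moreover have "1 + 1 / real m \<noteq> 0" by (smt (verit) of_nat_0_le_iff divide_nonneg_nonneg)
  ultimately show ?thesis by simp
qed

text \<open>Some selection costs at most the average. The initial gap is replaced by a nonnegative
  bound \<open>B\<close>, since \<open>inverse_growth_le\<close> may only be multiplied by a
  nonnegative number.\<close>

lemma greedy_approximation:
  assumes opt: "\<And>i. i < k \<Longrightarrow> b i \<in> E i"
    and asg: "\<And>j. j \<in> C \<Longrightarrow> s j < k"
    and gr: "greedy m 0 T"
  defines "opt \<equiv> \<Sum>j\<in>C. w j * g (s j) (b (s j)) j"
  assumes start: "scost (\<lambda>_. 0) - opt \<le> B" and B: "0 \<le> B"
  shows "\<exists>c\<in>Om. scost (sel T c) \<le> opt + exp (-1) * (1 + 1 / real m) * B"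
proof (rule ccontr)
  let ?R = "opt + exp (-1) * (1 + 1 / real m) * B"
  assume "\<not> ?thesis"
  then have "?R < scost (sel T c)" if "c \<in> Om" for c using that by force
  moreover have "Om \<noteq> {}" using card_Om m_pos by (metis card.empty power_not_zero less_not_refl)
  ultimately have "(\<Sum>c\<in>Om. ?R) < total T"
    unfolding total_def by (intro sum_strict_mono) auto
  then have "real (m ^ k) * ?R < total T" by (simp add: card_Om)
  also have "total T \<le> real (m ^ k) * (opt + (scost (\<lambda>_. 0) - opt) / (1 + 1 / real m) ^ m)"
    using greedy_bound[OF opt asg gr] by (simp add: opt_def)
  also have "\<dots> \<le> real (m ^ k) * ?R"
  proof (intro mult_left_mono add_left_mono)
    have "(scost (\<lambda>_. 0) - opt) / (1 + 1 / real m) ^ m \<le> B / (1 + 1 / real m) ^ m"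
      by (intro divide_right_mono start) simp
    also have "\<dots> = (1 / (1 + 1 / real m) ^ m) * B" by simp
    also have "\<dots> \<le> exp (-1) * (1 + 1 / real m) * B"
      by (intro mult_right_mono inverse_growth_le B)
    finally show "(scost (\<lambda>_. 0) - opt) / (1 + 1 / real m) ^ m \<le> exp (-1) * (1 + 1 / real m) * B" .
  qed simp
  finally show False by simp
qed

end

section \<open>Digits\<close>

text \<open>Base-\<open>b\<close> expansion numbers the selections and the guesses, so that one
  counter enumerates them. The restriction makes the result extensional, as \<open>PiE\<close>
  requires.\<close>

definition digits :: "nat \<Rightarrow> nat \<Rightarrow> nat \<Rightarrow> nat \<Rightarrow> nat" where
  "digits k b x = (\<lambda>i\<in>{..<k}. x div b ^ i mod b)"

lemma digits_inject:
  fixes x y b :: nat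
  shows
  "(\<And>i. i < k \<Longrightarrow> x div b ^ i mod b = y div b ^ i mod b) \<Longrightarrow> x < b ^ k \<Longrightarrow> y < b ^ k \<Longrightarrow> x = y"
proof (induction k arbitrary: x y)
  case (Suc k)
  have "x div b = y div b"
  proof (rule Suc.IH)
    fix i assume "i < k"
    then have "x div b ^ Suc i mod b = y div b ^ Suc i mod b" by (intro Suc.prems(1)) simp
    then show "x div b div b ^ i mod b = y div b div b ^ i mod b"
      by (simp only: power_Suc div_mult2_eq)
  qed (use Suc.prems in \<open>auto simp: less_mult_imp_div_less mult.commute\<close>)
  moreover have "x mod b = y mod b" using Suc.prems(1)[of 0] by simp
  ultimately show ?case by (metis mult_div_mod_eq)
qed simp

lemma bij_betw_digits: "bij_betw (digits k b) {..<b ^ k} ({..<k} \<rightarrow>\<^sub>E {..<b})"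
proof -
  have inj: "inj_on (digits k b) {..<b ^ k}"
  proof (rule inj_onI)
    fix x y assume xy: "x \<in> {..<b ^ k}" "y \<in> {..<b ^ k}" "digits k b x = digits k b y"
    show "x = y"
    proof (rule digits_inject)
      fix i assume "i < k"
      with fun_cong[OF xy(3), of i] show "x div b ^ i mod b = y div b ^ i mod b"
        by (simp add: digits_def)
    qed (use xy in auto)
  qed
  have "digits k b ` {..<b ^ k} \<subseteq> {..<k} \<rightarrow>\<^sub>E {..<b}"
  proof
    fix c assume "c \<in> digits k b ` {..<b ^ k}"
    then obtain x where x: "x < b ^ k" "c = digits k b x" by auto
    show "c \<in> {..<k} \<rightarrow>\<^sub>E {..<b}"
    proof (cases "b = 0")
      case True
      with x have "k = 0" by (cases k) auto
      with x show ?thesis by (auto simp: digits_def)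
    qed (use x in \<open>auto simp: digits_def\<close>)
  qed
  \<comment> \<open>Surjectivity is counted: an injective image of \<open>b ^ k\<close> numbers
    inside a set of \<open>b ^ k\<close> functions.\<close>
  then have "digits k b ` {..<b ^ k} = {..<k} \<rightarrow>\<^sub>E {..<b}"
    by (rule card_subset_eq[rotated]) (simp_all add: finite_PiE card_PiE card_image[OF inj])
  with inj show ?thesis by (simp add: bij_betw_def)
qed

section \<open>The greedy table for k-Median\<close>

text \<open>The smallest positive distance serves as \<open>\<mu>\<close>. With fewer than two
  points all distances are 0 and any positive number would do.\<close>

lemma aspect_ratio_bound:
  fixes n :: nat
  assumes "Metric_space {..<n} d" "aspect_ratio {..<n} d \<le> R" "0 \<le> R"
  shows "\<exists>\<mu>>0. (\<forall>x<n. \<forall>y<n. x \<noteq> y \<longrightarrow> \<mu> \<le> d x y) \<and> (\<forall>x<n. \<forall>y<n. d x y \<le> \<mu> * R)"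
proof (cases "n < 2")
  case True
  interpret Metric_space "{..<n}" d by fact
  have "x = y" if "x < n" "y < n" for x y using True that by simp
  moreover have "d x x = 0" if "x < n" for x using that by (simp add: mdist_zero)
  ultimately show ?thesis using assms(3) by (intro exI[of _ 1]) (metis mult_1 zero_less_one)
next
  case False
  interpret Metric_space "{..<n}" d by fact
  let ?D = "{d x y |x y. x \<in> {..<n} \<and> y \<in> {..<n}}"
  let ?P = "{d x y |x y. x \<in> {..<n} \<and> y \<in> {..<n} \<and> x \<noteq> y}"
  have fD: "finite ?D" by (rule finite_image_set2) auto
  have fP: "finite ?P" by (rule finite_subset[OF _ fD]) auto
  have "d 0 1 \<in> ?P" using False by (intro CollectI exI[of _ 0] exI[of _ 1]) auto
  then have ne: "?P \<noteq> {}" by blast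
  have pos: "0 < Min ?P" using Min_in[OF fP ne] by (auto simp: mdist_pos_less)
  moreover have "\<mu> \<le> d x y" if "x < n" "y < n" "x \<noteq> y" "\<mu> = Min ?P" for x y \<mu>
    unfolding that(4) by (rule Min_le[OF fP]) (use that in auto)
  moreover have "d x y \<le> Min ?P * R" if "x < n" "y < n" for x y
  proof -
    have "d x y \<le> Max ?D" by (rule Max_ge[OF fD]) (use that in auto)
    also have "Max ?D \<le> Min ?P * R"
      using assms(2) False pos by (simp add: aspect_ratio_def divide_le_eq mult.commute)
    finally show ?thesis .
  qed
  ultimately show ?thesis by (intro exI[of _ "Min ?P"]) auto
qed

text \<open>An entry \<open>Suc x\<close> stands for the facility \<open>x\<close>.\<close>

definition dentry :: "('a \<Rightarrow> nat \<Rightarrow> real) \<Rightarrow> (nat \<Rightarrow> nat) \<Rightarrow> (nat \<Rightarrow> real) \<Rightarrow> nat \<Rightarrow> nat \<Rightarrow> 'a \<Rightarrow> real" where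
  "dentry d ctr rad i e j = (if e = 0 then d j (ctr i) + rad i else d j (e - 1))"

definition ball_entries :: "(nat \<Rightarrow> nat \<Rightarrow> real) \<Rightarrow> nat set \<Rightarrow> (nat \<Rightarrow> nat) \<Rightarrow> (nat \<Rightarrow> real) \<Rightarrow> nat \<Rightarrow> nat set" where
  "ball_entries d F ctr rad i = Suc ` {x \<in> F. d (ctr i) x \<le> rad i}"

locale kmedian_nat = weighted_kmedian "{..<n}" d C w F k
  for n :: nat and d C w F k
begin

lemma C_less: "j \<in> C \<Longrightarrow> j < n" using clients by auto
lemma F_less: "x \<in> F \<Longrightarrow> x < n" using facilities by auto
lemma finite_C [simp]: "finite C" using clients finite_subset by blast
lemma finite_F [simp]: "finite F" using facilities finite_subset by blast
lemma k_le_n: "k \<le> n" using k_bounds(2) card_mono[OF _ facilities] by simp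

text \<open>The triangle inequality through the center of the ball yields
  \<open>g_le\<close>.\<close>

lemma tabularI:
  assumes "\<And>i. i < k \<Longrightarrow> ctr i < n" "0 < m"
  shows "tabular k m C w (dentry d ctr rad) (ball_entries d F ctr rad)"
proof
  fix i e j assume A: "i < k" "e \<in> ball_entries d F ctr rad i" "j \<in> C"
  then obtain x where x: "x \<in> F" "d (ctr i) x \<le> rad i" "e = Suc x"
    by (auto simp: ball_entries_def)
  have "d j x \<le> d j (ctr i) + d (ctr i) x"
    by (rule triangle) (use x A assms C_less F_less in auto)
  with x show "dentry d ctr rad i e j \<le> dentry d ctr rad i 0 j" by (simp add: dentry_def)
qed (use assms k_bounds weights less_imp_le in auto)

section \<open>Optimal clusters and the good guess\<close>

lemma finite_feasible: "finite (feasible F k)"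
  unfolding feasible_def by simp

text \<open>Here \<open>h\<close> enumerates an optimal solution, \<open>s\<close> assigns each
  client to a nearest member, and \<open>l\<close> picks the leaders.\<close>

lemma opt_leaders:
  assumes "C \<noteq> {}"
  shows "\<exists>s l h. (\<forall>j\<in>C. s j < k \<and> d (l (s j)) (h (s j)) \<le> d j (h (s j))) \<and>
    (\<forall>i<k. l i \<in> C \<and> h i \<in> F) \<and> (\<Sum>j\<in>C. w j * d j (h (s j))) = kmedian_opt d C w F k"
proof -
  have ne: "feasible F k \<noteq> {}"
    using obtain_subset_with_card_n[OF k_bounds(2)] unfolding feasible_def by blast
  have "kmedian_opt d C w F k \<in> kmedian_cost d C w ` feasible F k"
    unfolding kmedian_opt_def by (rule Min_in) (use finite_feasible ne in auto)
  then obtain S where S: "S \<subseteq> F" "card S = k" "kmedian_cost d C w S = kmedian_opt d C w F k"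
    by (auto simp: feasible_def)
  have fS: "finite S" "S \<noteq> {}" using S k_bounds finite_subset[OF S(1)] by auto
  obtain h where h: "bij_betw h {..<k} S"
    using ex_bij_betw_nat_finite[OF fS(1)] S(2) by (auto simp: atLeast0LessThan)
  have "\<exists>i<k. d j (h i) = dist_to_set d j S" for j
  proof -
    have "dist_to_set d j S \<in> d j ` S" unfolding dist_to_set_def by (rule Min_in) (use fS in auto)
    with h show ?thesis by (force simp: bij_betw_def)
  qed
  then obtain s where s: "s j < k" "d j (h (s j)) = dist_to_set d j S" for j by metis
  \<comment> \<open>An empty cluster has no leader; any client stands in for it, which is where
    \<open>C \<noteq> {}\<close> is used.\<close>
  have "\<exists>l\<in>C. \<forall>j\<in>C. s j = i \<longrightarrow> d l (h i) \<le> d j (h i)" for i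
  proof (cases "\<exists>j\<in>C. s j = i")
    case True
    let ?X = "{j\<in>C. s j = i}"
    from True obtain l where "is_arg_min (\<lambda>j. d j (h i)) (\<lambda>j. j \<in> ?X) l"
      using ex_is_arg_min_if_finite[of ?X "\<lambda>j. d j (h i)"] by auto
    then show ?thesis by (auto simp: is_arg_min_linorder)
  qed (use assms in auto)
  then obtain l where l: "l i \<in> C" "\<And>j. j \<in> C \<Longrightarrow> s j = i \<Longrightarrow> d (l i) (h i) \<le> d j (h i)" for i
    by metis
  have hF: "h i \<in> F" if "i < k" for i
    using that h S(1) by (auto simp: bij_betw_def)
  have "(\<Sum>j\<in>C. w j * d j (h (s j))) = kmedian_opt d C w F k"
    using S(3) by (simp add: kmedian_cost_def s)
  then show ?thesis
    by (intro exI[of _ s] exI[of _ l] exI[of _ h] conjI ballI allI impI)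
      (simp_all only: s(1) l(1) hF l(2)[OF _ refl])
qed

lemma kmedian_opt_nonneg: "0 \<le> kmedian_opt d C w F k"
proof (cases "C = {}")
  case True
  have ne: "feasible F k \<noteq> {}"
    using obtain_subset_with_card_n[OF k_bounds(2)] unfolding feasible_def by blast
  then have "kmedian_cost d C w ` feasible F k = {0}"
    using True by (auto simp: kmedian_cost_def)
  then show ?thesis by (simp add: kmedian_opt_def)
next
  case False
  from opt_leaders[OF False] show ?thesis
  proof (elim exE conjE)
    fix s l h assume "(\<Sum>j\<in>C. w j * d j (h (s j))) = kmedian_opt d C w F k"
    moreover have "0 \<le> (\<Sum>j\<in>C. w j * d j (h (s j)))"
      by (intro sum_nonneg mult_nonneg_nonneg) (auto intro: less_imp_le weights)
    ultimately show ?thesis by simp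
  qed
qed

text \<open>The first part keeps every ball nonempty, so that the greedy choice exists even for
  useless guesses; the second part guarantees that a good guess is among them.\<close>

definition covering :: "real \<Rightarrow> nat \<Rightarrow> (nat \<Rightarrow> nat) \<Rightarrow> (nat \<Rightarrow> real) \<Rightarrow> bool" where
  "covering \<epsilon> nb bc br \<longleftrightarrow>
     (\<forall>b<nb. bc b \<in> C \<and> (\<exists>x\<in>F. d (bc b) x \<le> br b)) \<and>
     (\<forall>j\<in>C. \<forall>x\<in>F. \<exists>b<nb. bc b = j \<and> d j x \<le> br b \<and> br b \<le> (1 + \<epsilon>) * d j x)"

abbreviation guess_greedy where
  "guess_greedy m bc br L \<equiv> tabular.greedy k m C w
     (dentry d (bc \<circ> L) (br \<circ> L)) (ball_entries d F (bc \<circ> L) (br \<circ> L))"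

abbreviation guess_cost where
  "guess_cost bc br L \<equiv> tabular.scost k C w (dentry d (bc \<circ> L) (br \<circ> L))"

text \<open>Part \<open>i\<close> is given a ball around its leader that contains the optimal
  facility \<open>h i\<close>. The table is universally quantified because ties in the greedy choice
  are left open.\<close>

lemma good_guess:
  assumes eps: "0 < \<epsilon>" and m: "1 + \<epsilon> \<le> real m * \<epsilon>" and C: "C \<noteq> {}"
    and cov: "covering \<epsilon> nb bc br"
  shows "\<exists>L \<in> {..<k} \<rightarrow>\<^sub>E {..<nb}. \<forall>T. guess_greedy m bc br L m 0 T \<longrightarrow>
    (\<exists>c \<in> {..<k} \<rightarrow>\<^sub>E {..<m}. guess_cost bc br L (\<lambda>i. T (c i) i)
       \<le> (1 + 2 / exp 1 + 3 * \<epsilon>) * kmedian_opt d C w F k)"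
proof -
  obtain s l h where asg: "\<forall>j\<in>C. s j < k \<and> d (l (s j)) (h (s j)) \<le> d j (h (s j))"
    and lh: "\<forall>i<k. l i \<in> C \<and> h i \<in> F"
    and opt: "(\<Sum>j\<in>C. w j * d j (h (s j))) = kmedian_opt d C w F k"
    using opt_leaders[OF C] by (elim exE conjE) (rule that)
  note s = bspec[OF asg, THEN conjunct1] and lead = bspec[OF asg, THEN conjunct2]
  have l: "l i \<in> C" and h: "h i \<in> F" if "i < k" for i using lh that by simp_all
  let ?opt = "kmedian_opt d C w F k"
  have "\<forall>i<k. \<exists>b<nb. bc b = l i \<and> d (l i) (h i) \<le> br b \<and> br b \<le> (1 + \<epsilon>) * d (l i) (h i)"
    using cov l h unfolding covering_def by blast
  then obtain L0 where L0: "\<And>i. i < k \<Longrightarrow> L0 i < nb \<and> bc (L0 i) = l i \<and>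
      d (l i) (h i) \<le> br (L0 i) \<and> br (L0 i) \<le> (1 + \<epsilon>) * d (l i) (h i)"
    by metis
  define L where "L = restrict L0 {..<k}"
  have L: "L i < nb" "bc (L i) = l i" "d (l i) (h i) \<le> br (L i)" "br (L i) \<le> (1 + \<epsilon>) * d (l i) (h i)"
    if "i < k" for i using L0[OF that] that by (simp_all add: L_def)
  have "0 < real m * \<epsilon>" using m eps by linarith
  then have m0: "0 < m" using eps by (simp add: zero_less_mult_iff)
  interpret tabular k m C w "dentry d (bc \<circ> L) (br \<circ> L)" "ball_entries d F (bc \<circ> L) (br \<circ> L)"
    by (rule tabularI) (use L l C_less m0 in auto)
  have opt': "(\<Sum>j\<in>C. w j * dentry d (bc \<circ> L) (br \<circ> L) (s j) (Suc (h (s j))) j) = ?opt"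
    using opt by (simp add: dentry_def)
  \<comment> \<open>The default sends \<open>j\<close> to its optimal facility, on to the leader,
    and adds the radius: \<open>d j h + d l h + (1 + \<epsilon>) * d l h\<close>. As the leader is
    no farther from \<open>h\<close> than \<open>j\<close> is, this is at most
    \<open>(3 + \<epsilon>) * d j h\<close>.\<close>
  have base: "scost (\<lambda>_. 0) - ?opt \<le> (2 + \<epsilon>) * ?opt"
  proof -
    have "scost (\<lambda>_. 0) \<le> (\<Sum>j\<in>C. w j * ((3 + \<epsilon>) * d j (h (s j))))"
      unfolding scost_def
    proof (intro sum_mono mult_left_mono w_nonneg)
      fix j assume j: "j \<in> C"
      note sj = s[OF j]
      have "near (\<lambda>_. 0) j \<le> d j (l (s j)) + br (L (s j))"
        using near_le[OF sj, of "\<lambda>_. 0" j] L[OF sj] by (simp add: dentry_def)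
      also have "\<dots> \<le> (d j (h (s j)) + d (l (s j)) (h (s j))) + (1 + \<epsilon>) * d (l (s j)) (h (s j))"
        using triangle[of j "h (s j)" "l (s j)"] j sj l[OF sj] h[OF sj] C_less F_less L(4)[OF sj]
          commute[of "l (s j)" "h (s j)"]
        by (intro add_mono) auto
      also have "\<dots> = d j (h (s j)) + (2 + \<epsilon>) * d (l (s j)) (h (s j))" by (simp add: algebra_simps)
      also have "\<dots> \<le> d j (h (s j)) + (2 + \<epsilon>) * d j (h (s j))"
        by (intro add_left_mono mult_left_mono lead j) (use eps in simp)
      finally show "near (\<lambda>_. 0) j \<le> (3 + \<epsilon>) * d j (h (s j))" by (simp add: algebra_simps)
    qed
    also have "\<dots> = (3 + \<epsilon>) * ?opt"
      unfolding opt[symmetric] by (simp add: sum_distrib_left mult.left_commute)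
    finally show ?thesis by (simp add: algebra_simps)
  qed
  \<comment> \<open>The choice of \<open>m\<close> means
    \<open>1 / m \<le> \<epsilon> / (1 + \<epsilon>)\<close>, so
    \<open>(1 + 1 / m) * (2 + \<epsilon>)\<close> is at most
    \<open>2 + \<epsilon> + 2 * \<epsilon>\<close>. Bounding \<open>exp (-1)\<close> by 1 in front
    of \<open>3 * \<epsilon>\<close> gives the final constant 3.\<close>
  have bound: "?opt + exp (-1) * (1 + 1 / real m) * ((2 + \<epsilon>) * ?opt) \<le> (1 + 2 / exp 1 + 3 * \<epsilon>) * ?opt"
  proof -
    have "1 / real m \<le> \<epsilon> / (1 + \<epsilon>)" using m eps m0 by (simp add: field_simps)
    then have "(1 + 1 / real m) * (2 + \<epsilon>) \<le> (1 + \<epsilon> / (1 + \<epsilon>)) * (2 + \<epsilon>)"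
      by (intro mult_right_mono) (use eps in auto)
    also have "\<dots> = 2 + \<epsilon> + \<epsilon> * ((2 + \<epsilon>) / (1 + \<epsilon>))" by (simp add: algebra_simps)
    also have "(2 + \<epsilon>) / (1 + \<epsilon>) \<le> 2" using eps by (simp add: divide_le_eq)
    finally have "(1 + 1 / real m) * (2 + \<epsilon>) \<le> 2 + 3 * \<epsilon>" using eps by simp
    then have "exp (-1) * ((1 + 1 / real m) * (2 + \<epsilon>)) \<le> exp (-1) * (2 + 3 * \<epsilon>)"
      by (intro mult_left_mono) auto
    also have "\<dots> = 2 / exp 1 + exp (-1) * (3 * \<epsilon>)"
      by (simp add: algebra_simps exp_minus inverse_eq_divide)
    also have "exp (-1) * (3 * \<epsilon>) \<le> 1 * (3 * \<epsilon>)"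
      by (intro mult_right_mono) (use eps in auto)
    finally have "?opt + exp (-1) * ((1 + 1 / real m) * (2 + \<epsilon>)) * ?opt
        \<le> ?opt + (2 / exp 1 + 3 * \<epsilon>) * ?opt"
      by (intro add_left_mono mult_right_mono kmedian_opt_nonneg) auto
    then show ?thesis by (simp add: algebra_simps)
  qed
  show ?thesis
  proof (rule bexI[of _ L], intro allI impI)
    show "L \<in> {..<k} \<rightarrow>\<^sub>E {..<nb}" using L(1) by (auto simp: L_def)
    fix T assume T: "greedy m 0 T"
    have "\<exists>c\<in>Om. scost (sel T c) \<le> ?opt + exp (-1) * (1 + 1 / real m) * ((2 + \<epsilon>) * ?opt)"
      using greedy_approximation[where b = "\<lambda>i. Suc (h i)" and s = s and T = T and B = "(2 + \<epsilon>) * ?opt"]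
        T s base eps kmedian_opt_nonneg L h unfolding opt' by (auto simp: ball_entries_def)
    then show "\<exists>c\<in>{..<k} \<rightarrow>\<^sub>E {..<m}. scost (\<lambda>i. T (c i) i) \<le> (1 + 2 / exp 1 + 3 * \<epsilon>) * ?opt"
      using bound unfolding Om_def sel_def by (meson order_trans)
  qed
qed

end

section \<open>Evaluating a table\<close>

text \<open>
  Arrays of the program: \<open>row i = i * n\<close> replaces the missing multiplication of naturals; ball \<open>b\<close> has
  center \<open>bc b\<close> and radius \<open>br b\<close>, part \<open>i\<close> belongs to ball \<open>lead i\<close>; \<open>tbl\<close> stores the entry in column \<open>q\<close>
  of part \<open>i\<close> at address \<open>q * n + i\<close>, and \<open>dig i\<close> is the column which the current selection uses
  for part \<open>i\<close>. The real scalars \<open>M\<close> and \<open>G\<close> hold the numbers \<open>m\<^sup>k\<close> and \<open>nb\<^sup>k\<close> of selections and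
  guesses.
\<close>

definition Decode :: "string \<Rightarrow> string \<Rightarrow> string \<Rightarrow> com" where
  "Decode src b arr =
     Seq (NSet ''z'' (NV src))
     (For ''a'' (NLess (NV ''a'') (NV ''k''))
       (Seq (NSet ''y'' (NConst 0))
       (Seq (While (BNot (NLess (NV ''z'') (NV b)))
              (Seq (NSet ''z'' (NSub (NV ''z'') (NV b))) (NInc ''y'')))
       (Seq (NStore arr (NV ''a'') (NV ''z'')) (NSet ''z'' (NV ''y''))))))"

lemma nw_Decode [simp]: "nw (Decode src b arr) = {''z'', ''a'', ''y'', arr}"
  and rw_Decode [simp]: "rw (Decode src b arr) = {}"
  by (auto simp: Decode_def)

text \<open>Each digit is split off by at most \<open>x\<close> subtractions, so the value of the
  counter itself is paid \<open>k\<close> times.\<close>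

definition decode_time :: "nat \<Rightarrow> nat \<Rightarrow> nat" where
  "decode_time k x = k * (3 * x + 6) + 3"

lemma runs_Decode:
  assumes names: "b \<notin> {''z'', ''a'', ''y'', arr}" "arr \<notin> {''z'', ''a'', ''y'', ''k''}"
    and s: "nmem s src 0 = x" "nmem s b 0 = B" "nmem s ''k'' 0 = k" and B: "0 < B"
  shows "runs (Decode src b arr) s (decode_time k x) (\<lambda>s'. \<forall>i<k. nmem s' arr i = x div B ^ i mod B)"
proof -
  let ?div = "While (BNot (NLess (NV ''z'') (NV b)))
              (Seq (NSet ''z'' (NSub (NV ''z'') (NV b))) (NInc ''y''))"
  have division: "runs ?div s (z * 3 + 1) (\<lambda>s'. nmem s' ''z'' 0 = z mod B \<and> nmem s' ''y'' 0 = z div B)"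
    if "nmem s ''z'' 0 = z" "nmem s ''y'' 0 = 0" "nmem s b 0 = B" for s z
  proof -
    have "runs ?div s (z * (2 + 1) + 1) (\<lambda>s'. nmem s' ''z'' 0 = z mod B \<and> nmem s' ''y'' 0 = z div B)"
    proof (rule runs_While[where I = "\<lambda>i s'. nmem s' ''z'' 0 + i * B = z \<and> nmem s' ''y'' 0 = i"])
      fix i s'
      assume A: "frame (Seq (NSet ''z'' (NSub (NV ''z'') (NV b))) (NInc ''y'')) s s'"
        "nmem s' ''z'' 0 + i * B = z \<and> nmem s' ''y'' 0 = i" "bval s' (BNot (NLess (NV ''z'') (NV b)))"
      have b: "nmem s' b 0 = B" using A(1) that(3) names by (simp add: frame_def)
      have le: "B \<le> nmem s' ''z'' 0" using A(3) b by simp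
      \<comment> \<open>After \<open>i\<close> subtractions at least \<open>B \<ge> 1\<close> is
        left, so the dividend bounds the number of rounds.\<close>
      have "i \<le> i * B" using B by simp
      then have "i < z" using A(2) le B by linarith
      with A b le show "i < z \<and> runs (Seq (NSet ''z'' (NSub (NV ''z'') (NV b))) (NInc ''y'')) s' 2
          (\<lambda>s'. nmem s' ''z'' 0 + Suc i * B = z \<and> nmem s' ''y'' 0 = Suc i)"
        by simp
    next
      fix i s'
      assume A: "frame (Seq (NSet ''z'' (NSub (NV ''z'') (NV b))) (NInc ''y'')) s s'"
        "nmem s' ''z'' 0 + i * B = z \<and> nmem s' ''y'' 0 = i" "\<not> bval s' (BNot (NLess (NV ''z'') (NV b)))"
      have b: "nmem s' b 0 = B" using A(1) that(3) names by (simp add: frame_def)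
      have "nmem s' ''z'' 0 < B" using A(3) b by simp
      with A(2) show "nmem s' ''z'' 0 = z mod B \<and> nmem s' ''y'' 0 = z div B" by auto
    qed (use that in simp)
    then show ?thesis by simp
  qed
  have "runs (For ''a'' (NLess (NV ''a'') (NV ''k''))
       (Seq (NSet ''y'' (NConst 0)) (Seq ?div
       (Seq (NStore arr (NV ''a'') (NV ''z'')) (NSet ''z'' (NV ''y''))))))
     (nstore ''z'' 0 x s) (k * (3 * x + 6) + 2) (\<lambda>s'. \<forall>i<k. nmem s' arr i = x div B ^ i mod B)"
  proof (rule runs_For[where N = k and T = "3 * x + 4" and
        I = "\<lambda>i s'. nmem s' ''z'' 0 = x div B ^ i \<and> (\<forall>i'<i. nmem s' arr i' = x div B ^ i' mod B)"],
      goal_cases)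
    case (4 i s')
    let ?s = "nstore ''y'' 0 0 s'"
    have b: "nmem ?s b 0 = B" "nmem ?s ''z'' 0 = x div B ^ i" "nmem ?s ''y'' 0 = 0"
      using 4 names s by (auto simp: frame_def)
    have "x div B ^ i \<le> x" by simp
    then have "x div B ^ i * 3 + 1 + 2 \<le> 3 + 3 * x" by linarith
    have "runs (Seq ?div (Seq (NStore arr (NV ''a'') (NV ''z'')) (NSet ''z'' (NV ''y'')))) ?s (3 + 3 * x)
        (\<lambda>s'. nmem (nstore ''a'' 0 (Suc i) s') ''z'' 0 = x div B ^ Suc i \<and>
          (\<forall>i'<Suc i. nmem (nstore ''a'' 0 (Suc i) s') arr i' = x div B ^ i' mod B))"
    proof (rule runs_seq[OF division[OF b(2,3,1)]], fact)
      fix s'' assume A: "frame ?div ?s s''"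
        "nmem s'' ''z'' 0 = x div B ^ i mod B \<and> nmem s'' ''y'' 0 = x div B ^ i div B"
      have "nmem s'' arr = nmem s' arr" "nmem s'' ''a'' = nmem s' ''a''"
        using A(1) names by (auto simp: frame_def)
      with A 4 names show "runs (Seq (NStore arr (NV ''a'') (NV ''z'')) (NSet ''z'' (NV ''y''))) s'' 2
        (\<lambda>s'. nmem (nstore ''a'' 0 (Suc i) s') ''z'' 0 = x div B ^ Suc i \<and>
          (\<forall>i'<Suc i. nmem (nstore ''a'' 0 (Suc i) s') arr i' = x div B ^ i' mod B))"
        by (auto simp: less_Suc_eq div_mult2_eq mult.commute[of B])
    qed
    with names show ?case by simp
  next
    case (3 s')
    moreover have "''k'' \<noteq> arr" using names by blast
    ultimately have "nmem s' ''k'' 0 = k" using s by (simp add: frame_def)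
    then show ?case by simp
  qed (use names s in auto)
  with s show ?thesis by (simp add: Decode_def decode_time_def)
qed

text \<open>There is no infinite start value for the running minimum \<open>u\<close>; the test says
  \<open>i = 0 \<or> t < u\<close>, written with the available connectives. The flags
  \<open>has\<close>, \<open>bh\<close> and \<open>fd\<close> play the role of \<open>i = 0\<close>
  in later minima.\<close>

definition Near :: com where
  "Near = For ''i'' (NLess (NV ''i'') (NV ''k''))
     (Seq (NSet ''e'' (NLoad ''tbl'' (NAdd (NLoad ''row'' (NLoad ''dig'' (NV ''i''))) (NV ''i''))))
     (Seq (Cond (NLess (NConst 0) (NV ''e''))
            (RSet ''t'' (RLoad ''dist'' (NAdd (NLoad ''row'' (NV ''j'')) (NSub (NV ''e'') (NConst 1)))))
            (RSet ''t'' (RAdd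
              (RLoad ''dist'' (NAdd (NLoad ''row'' (NV ''j'')) (NLoad ''bc'' (NLoad ''lead'' (NV ''i'')))))
              (RLoad ''br'' (NLoad ''lead'' (NV ''i''))))))
     (Cond (BNot (BAnd (NLess (NConst 0) (NV ''i'')) (BNot (RLess (RV ''t'') (RV ''u'')))))
       (RSet ''u'' (RV ''t'')) Skip)))"

lemma nw_Near [simp]: "nw Near = {''i'', ''e''}"
  and rw_Near [simp]: "rw Near = {''t'', ''u''}"
  by (auto simp: Near_def)

definition CostOf :: com where
  "CostOf = Seq (RSet ''v'' (RNat (NConst 0)))
     (For ''j'' (NLess (NV ''j'') (NV ''n''))
       (Cond (NLess (NConst 0) (NLoad ''client'' (NV ''j'')))
         (Seq Near (RSet ''v'' (RAdd (RV ''v'') (RMul (RLoad ''weight'' (NV ''j'')) (RV ''u'')))))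
         Skip))"

lemma nw_CostOf [simp]: "nw CostOf = {''i'', ''e'', ''j''}"
  and rw_CostOf [simp]: "rw CostOf = {''t'', ''u'', ''v''}"
  by (auto simp: CostOf_def)

definition Total :: com where
  "Total = Seq (RSet ''V'' (RNat (NConst 0)))
     (For ''c'' (RLess (RNat (NV ''c'')) (RV ''M''))
       (Seq (Decode ''c'' ''m'' ''dig'') (Seq CostOf (RSet ''V'' (RAdd (RV ''V'') (RV ''v''))))))"

lemma nw_Total [simp]: "nw Total = {''i'', ''e'', ''j'', ''c'', ''z'', ''a'', ''y'', ''dig''}"
  and rw_Total [simp]: "rw Total = {''t'', ''u'', ''v'', ''V''}"
  by (auto simp: Total_def)

definition cost_time :: "nat \<Rightarrow> nat \<Rightarrow> nat" where
  "cost_time n k = n * (7 * k + 6) + 3"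

definition total_time :: "nat \<Rightarrow> nat \<Rightarrow> nat \<Rightarrow> nat" where
  "total_time n k M = M * (decode_time k M + cost_time n k + 3) + 3"

section \<open>Evaluation of selections and tables\<close>

context kmedian_nat
begin

text \<open>The array \<open>row\<close> serves the distance matrix, with indices below
  \<open>n\<close>, and the table, with indices up to \<open>m\<close>, where \<open>row m\<close>
  is the size of the table.\<close>

definition base :: "real \<Rightarrow> nat \<Rightarrow> state \<Rightarrow> bool" where
  "base \<epsilon> m s \<longleftrightarrow> nmem s ''n'' 0 = n \<and> nmem s ''k'' 0 = k \<and> rmem s ''eps'' 0 = \<epsilon> \<and>
     (\<forall>x. nmem s ''client'' x = (if x \<in> C then 1 else 0)) \<and>
     (\<forall>x. nmem s ''facility'' x = (if x \<in> F then 1 else 0)) \<and>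
     (\<forall>j<n. \<forall>x<n. rmem s ''dist'' (j * n + x) = d j x) \<and>
     (\<forall>j\<in>C. rmem s ''weight'' j = w j) \<and>
     nmem s ''m'' 0 = m \<and> (\<forall>i\<le>n + m. nmem s ''row'' i = i * n)"

lemma base_frame:
  assumes "base \<epsilon> m s" "frame p s s'"
    "nw p \<inter> {''n'', ''k'', ''client'', ''facility'', ''m'', ''row''} = {}"
    "rw p \<inter> {''eps'', ''dist'', ''weight''} = {}"
  shows "base \<epsilon> m s'"
proof -
  have "nmem s' x = nmem s x" if "x \<in> {''n'', ''k'', ''client'', ''facility'', ''m'', ''row''}" for x
  proof -
    have "x \<notin> nw p" using assms(3) that by auto
    with assms(2) show ?thesis by (simp add: frame_def)
  qed
  moreover have "rmem s' x = rmem s x" if "x \<in> {''eps'', ''dist'', ''weight''}" for x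
  proof -
    have "x \<notin> rw p" using assms(4) that by auto
    with assms(2) show ?thesis by (simp add: frame_def)
  qed
  ultimately show ?thesis using assms(1) unfolding base_def by simp
qed

end

text \<open>The guess \<open>L\<close> is arbitrary: the program has to halt and to keep a valid
  solution also when the guess is wrong.\<close>

locale kmedian_guess = kmedian_nat +
  fixes \<epsilon> :: real and m nb :: nat and bc :: "nat \<Rightarrow> nat" and br :: "nat \<Rightarrow> real" and L :: "nat \<Rightarrow> nat"
  assumes m_pos': "0 < m"
    and balls: "\<And>b. b < nb \<Longrightarrow> bc b \<in> C \<and> (\<exists>x\<in>F. d (bc b) x \<le> br b)"
    and guess: "\<And>i. i < k \<Longrightarrow> L i < nb"
begin

sublocale tabular k m C w "dentry d (bc \<circ> L) (br \<circ> L)" "ball_entries d F (bc \<circ> L) (br \<circ> L)"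
  by (rule tabularI) (use m_pos' balls guess C_less in auto)

abbreviation gd where "gd \<equiv> dentry d (bc \<circ> L) (br \<circ> L)"
abbreviation entries where "entries \<equiv> ball_entries d F (bc \<circ> L) (br \<circ> L)"

lemma entries_ne: "i < k \<Longrightarrow> entries i \<noteq> {}"
  using balls[OF guess] by (auto simp: ball_entries_def)

lemma entries_le: "e \<in> entries i \<Longrightarrow> 0 < e \<and> e \<le> n"
  using F_less by (auto simp: ball_entries_def Suc_le_eq)

definition ready :: "state \<Rightarrow> bool" where
  "ready s \<longleftrightarrow> base \<epsilon> m s \<and> rmem s ''M'' 0 = real (m ^ k) \<and>
     nmem s ''bc'' = bc \<and> rmem s ''br'' = br \<and> (\<forall>i<k. nmem s ''lead'' i = L i)"

lemma ready_frame:
  assumes "ready s" "frame p s s'"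
    "nw p \<inter> {''n'', ''k'', ''client'', ''facility'', ''m'', ''row'', ''bc'', ''lead''} = {}"
    "rw p \<inter> {''eps'', ''dist'', ''weight'', ''M'', ''br''} = {}"
  shows "ready s'"
proof -
  have "base \<epsilon> m s'"
  proof (rule base_frame[OF _ assms(2)])
    show "base \<epsilon> m s" using assms(1) by (simp add: ready_def)
  qed (use assms(3,4) in simp_all)
  moreover have "nmem s' x = nmem s x" if "x \<in> {''bc'', ''lead''}" for x
  proof -
    have "x \<notin> nw p" using assms(3) that by auto
    with assms(2) show ?thesis by (simp add: frame_def)
  qed
  moreover have "rmem s' x = rmem s x" if "x \<in> {''M'', ''br''}" for x
  proof -
    have "x \<notin> rw p" using assms(4) that by auto
    with assms(2) show ?thesis by (simp add: frame_def)
  qed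
  ultimately show ?thesis using assms(1) unfolding ready_def by simp
qed

text \<open>The stride is \<open>n\<close>, which reuses \<open>row\<close>;
  \<open>k \<le> n\<close> keeps the addresses of different cells apart.\<close>

definition tab :: "state \<Rightarrow> nat \<Rightarrow> nat \<Rightarrow> nat" where
  "tab s q i = nmem s ''tbl'' (q * n + i)"

text \<open>Admits unfilled cells as well as facilities, and makes \<open>e - 1\<close> a valid
  column of the distance matrix for \<open>e > 0\<close>.\<close>

definition tab_ok :: "state \<Rightarrow> bool" where
  "tab_ok s \<longleftrightarrow> (\<forall>q<m. \<forall>i<k. tab s q i \<le> n)"

lemma runs_Near:
  assumes s: "ready s" "tab_ok s" and j: "nmem s ''j'' 0 = j" "j < n"
    and dig: "\<And>i. i < k \<Longrightarrow> nmem s ''dig'' i = c i" "\<And>i. i < k \<Longrightarrow> c i < m"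
  shows "runs Near s (k * 7 + 2) (\<lambda>s'. rmem s' ''u'' 0 = near (sel (tab s) c) j)"
  unfolding Near_def
\<comment> \<open>The invariant claims nothing for \<open>i = 0\<close>, where \<open>Min\<close> of
  the empty set is unspecified.\<close>
proof (rule runs_For[where N = k and T = 5 and
      I = "\<lambda>i s'. 0 < i \<longrightarrow> rmem s' ''u'' 0 = Min ((\<lambda>i. gd i (sel (tab s) c i) j) ` {..<i})"],
    goal_cases)
  case (3 s')
  have "nmem s' ''k'' 0 = k" using s 3 by (simp add: frame_def ready_def base_def)
  then show ?case by simp
next
  case (4 i s')
  let ?e = "sel (tab s) c i"
  have s': "nmem s' ''tbl'' = nmem s ''tbl''" "nmem s' ''row'' = nmem s ''row''" "nmem s' ''dig'' = nmem s ''dig''"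
    "nmem s' ''bc'' = nmem s ''bc''" "nmem s' ''lead'' = nmem s ''lead''" "nmem s' ''j'' = nmem s ''j''"
    "rmem s' ''dist'' = rmem s ''dist''" "rmem s' ''br'' = rmem s ''br''"
    using 4(2) by (simp_all add: frame_def)
  have rows: "nmem s ''row'' (c i) = c i * n" "nmem s ''row'' j = j * n"
    using s(1) dig(2)[OF 4(1)] j(2) by (simp_all add: ready_def base_def)
  have e: "nmem s ''tbl'' (c i * n + i) = ?e" by (simp add: sel_def tab_def)
  have lead: "nmem s ''lead'' i = L i" "nmem s ''bc'' = bc" "rmem s ''br'' = br"
    using s(1) 4(1) by (simp_all add: ready_def)
  have "?e \<le> n" using s(2) dig(2)[OF 4(1)] 4(1) by (simp add: tab_ok_def sel_def)
  then have "?e - 1 < n" if "?e \<noteq> 0" using that by simp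
  moreover have "rmem s ''dist'' (j * n + x) = d j x" if "x < n" for x
    using s(1) j(2) that by (simp add: ready_def base_def)
  ultimately have d1: "rmem s ''dist'' (j * n + (?e - 1)) = d j (?e - 1)" if "?e \<noteq> 0"
    using that by blast
  have d0: "rmem s ''dist'' (j * n + bc (L i)) = d j (bc (L i))"
    using s(1) j(2) balls[OF guess[OF 4(1)]] C_less by (simp add: ready_def base_def)
  have j': "nmem s' ''j'' 0 = j" using s' j by simp
  let ?t = "gd i ?e j" and ?M = "\<lambda>i. Min ((\<lambda>i. gd i (sel (tab s) c i) j) ` {..<i})"
  have Suc: "?M (Suc i) = (if i = 0 then ?t else min ?t (?M i))"
    by (simp add: lessThan_Suc lessThan_empty_iff)
  define s2 where "s2 = rstore ''t'' 0 ?t (nstore ''e'' 0 ?e s')"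
  have t: "rmem s2 ''t'' 0 = ?t" "rmem s2 ''u'' = rmem s' ''u''" "nmem s2 ''i'' 0 = i"
    using 4(3) by (simp_all add: s2_def)
  have "runs (Cond (BNot (BAnd (NLess (NConst 0) (NV ''i'')) (BNot (RLess (RV ''t'') (RV ''u'')))))
       (RSet ''u'' (RV ''t'')) Skip) s2 2 (\<lambda>s''. rmem s'' ''u'' 0 = ?M (Suc i))"
    unfolding Suc using 4(4) by (auto simp: t)
  then show ?case
    using 4(3) j' d0 d1
    by (cases "?e = 0") (simp_all add: s2_def s' rows e lead(2,3) lead(1) dig(1)[OF 4(1)] dentry_def)
next
  case (5 s')
  then show ?case using k_pos by (simp add: near_def)
qed simp_all

lemma runs_CostOf:
  assumes s: "ready s" "tab_ok s"
    and dig: "\<And>i. i < k \<Longrightarrow> nmem s ''dig'' i = c i" "\<And>i. i < k \<Longrightarrow> c i < m"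
  shows "runs CostOf s (cost_time n k) (\<lambda>s'. rmem s' ''v'' 0 = scost (sel (tab s) c))"
proof -
  let ?s = "rstore ''v'' 0 0 s"
  let ?P = "Cond (NLess (NConst 0) (NLoad ''client'' (NV ''j'')))
         (Seq Near (RSet ''v'' (RAdd (RV ''v'') (RMul (RLoad ''weight'' (NV ''j'')) (RV ''u'')))))
         Skip"
  have "runs (For ''j'' (NLess (NV ''j'') (NV ''n'')) ?P) ?s (n * (7 * k + 6) + 2)
    (\<lambda>s'. rmem s' ''v'' 0 = scost (sel (tab s) c))"
  proof (rule runs_For[where N = n and T = "7 * k + 4" and
        I = "\<lambda>j s'. rmem s' ''v'' 0 = (\<Sum>j\<in>C \<inter> {..<j}. w j * near (sel (tab s) c) j)"],
      goal_cases)
    case (3 s')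
    have "nmem s' ''n'' 0 = n" using s 3 by (simp add: frame_def ready_def base_def)
    then show ?case by simp
  next
    case (4 j s')
    have fr: "frame CostOf s s'" using 4(2) by (auto simp: frame_def)
    have r: "ready s'" by (rule ready_frame[OF s(1) fr]) auto
    have t: "tab_ok s'" "tab s' = tab s"
      using s(2) fr by (simp_all add: tab_ok_def tab_def frame_def fun_eq_iff)
    have dig': "nmem s' ''dig'' = nmem s ''dig''" using fr by (simp add: frame_def)
    have cl: "nmem s' ''client'' j = (if j \<in> C then 1 else 0)" "j \<in> C \<Longrightarrow> rmem s' ''weight'' j = w j"
      using r by (simp_all add: ready_def base_def)
    show ?case
    proof (cases "j \<in> C")
      case True
      have "runs (Seq Near (RSet ''v'' (RAdd (RV ''v'') (RMul (RLoad ''weight'' (NV ''j'')) (RV ''u'')))))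
          s' (3 + 7 * k) (\<lambda>s''. rmem (nstore ''j'' 0 (Suc j) s'') ''v'' 0 =
            (\<Sum>j\<in>C \<inter> {..<Suc j}. w j * near (sel (tab s) c) j))"
      proof (rule runs_seq[where U = "k * 7 + 2" and W = 1,
            OF runs_Near[where j = j and c = c, OF r t(1) 4(3,1)]])
        fix s'' assume A: "frame Near s' s''" "rmem s'' ''u'' 0 = near (sel (tab s') c) j"
        have "nmem s'' ''j'' 0 = j" "rmem s'' ''v'' = rmem s' ''v''" "rmem s'' ''weight'' j = w j"
          using A(1) 4(3) cl(2)[OF True] by (simp_all add: frame_def)
        moreover have "C \<inter> {..<Suc j} = insert j (C \<inter> {..<j})" using True by auto
        ultimately show "runs (RSet ''v'' (RAdd (RV ''v'') (RMul (RLoad ''weight'' (NV ''j'')) (RV ''u''))))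
          s'' 1 (\<lambda>s''. rmem (nstore ''j'' 0 (Suc j) s'') ''v'' 0 =
            (\<Sum>j\<in>C \<inter> {..<Suc j}. w j * near (sel (tab s) c) j))"
          using 4(4) A(2) by (simp add: t)
      qed (use dig dig' in simp_all)
      with True cl 4(3) show ?thesis by simp
    next
      case False
      then have "C \<inter> {..<Suc j} = C \<inter> {..<j}" by (auto simp: less_Suc_eq)
      with False cl 4 show ?thesis by simp
    qed
  next
    case (5 s')
    have "C \<inter> {..<n} = C" using clients by auto
    with 5 show ?case by (simp add: scost_def)
  qed simp_all
  then show ?thesis by (simp add: CostOf_def cost_time_def)
qed

lemma total_digits: "total T = (\<Sum>c<m ^ k. scost (sel T (digits k m c)))"
  unfolding total_def Om_def by (rule sum.reindex_bij_betw[OF bij_betw_digits, symmetric])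

lemma digits_less: "i < k \<Longrightarrow> digits k m c i < m"
  using m_pos by (simp add: digits_def)

text \<open>Shared by \<open>Total\<close> and \<open>Scan\<close>; the second conjunct allows
  \<open>Scan\<close> to copy the selection that has just been evaluated.\<close>

lemma runs_scenario:
  assumes s: "ready s" "tab_ok s" "nmem s ''c'' 0 = c" "c < m ^ k"
  shows "runs (Seq (Decode ''c'' ''m'' ''dig'') CostOf) s (decode_time k (m ^ k) + cost_time n k)
    (\<lambda>s'. rmem s' ''v'' 0 = scost (sel (tab s) (digits k m c)) \<and>
      (\<forall>i<k. nmem s' ''dig'' i = digits k m c i))"
proof -
  have m: "nmem s ''m'' 0 = m" "nmem s ''k'' 0 = k" using s(1) by (simp_all add: ready_def base_def)
  have time: "decode_time k c \<le> decode_time k (m ^ k)"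
    using s(4) by (simp add: decode_time_def)
  have D: "runs (Decode ''c'' ''m'' ''dig'') s (decode_time k c)
      (\<lambda>s'. \<forall>i<k. nmem s' ''dig'' i = c div m ^ i mod m)"
    by (rule runs_Decode) (use s m m_pos in simp_all)
  show ?thesis
  proof (rule runs_seq[OF D, where W = "cost_time n k"])
    fix s' assume A: "frame (Decode ''c'' ''m'' ''dig'') s s'"
      "\<forall>i<k. nmem s' ''dig'' i = c div m ^ i mod m"
    have r: "ready s'" by (rule ready_frame[OF s(1) A(1)]) auto
    have t: "tab_ok s'" "tab s' = tab s"
      using s(2) A(1) by (simp_all add: tab_ok_def tab_def frame_def fun_eq_iff)
    have dig: "nmem s' ''dig'' i = digits k m c i" if "i < k" for i
      using A(2) that by (simp add: digits_def)
    show "runs CostOf s' (cost_time n k) (\<lambda>s'. rmem s' ''v'' 0 = scost (sel (tab s) (digits k m c)) \<and>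
      (\<forall>i<k. nmem s' ''dig'' i = digits k m c i))"
      by (rule runs_mono[OF runs_CostOf[where c = "digits k m c", OF r t(1) dig digits_less]])
        (use t(2) dig in \<open>auto simp: frame_def\<close>)
  qed (use time in simp)
qed

lemma runs_Total:
  assumes s: "ready s" "tab_ok s"
  shows "runs Total s (total_time n k (m ^ k)) (\<lambda>s'. rmem s' ''V'' 0 = total (tab s))"
proof -
  let ?s = "rstore ''V'' 0 0 s"
  have "runs (For ''c'' (RLess (RNat (NV ''c'')) (RV ''M''))
       (Seq (Decode ''c'' ''m'' ''dig'') (Seq CostOf (RSet ''V'' (RAdd (RV ''V'') (RV ''v''))))))
    ?s (m ^ k * (decode_time k (m ^ k) + cost_time n k + 3) + 2) (\<lambda>s'. rmem s' ''V'' 0 = total (tab s))"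
  proof (rule runs_For[where N = "m ^ k" and T = "decode_time k (m ^ k) + cost_time n k + 1" and
        I = "\<lambda>c s'. rmem s' ''V'' 0 = (\<Sum>c<c. scost (sel (tab s) (digits k m c)))"],
      goal_cases)
    case (3 s')
    have "rmem s' ''M'' 0 = real (m ^ k)" using s 3 by (simp add: frame_def ready_def)
    then show ?case by (simp del: of_nat_power)
  next
    case (4 c s')
    have fr: "frame Total s s'" using 4(2) by (auto simp: frame_def)
    have r: "ready s'" by (rule ready_frame[OF s(1) fr]) auto
    have t: "tab_ok s'" "tab s' = tab s"
      using s(2) fr by (simp_all add: tab_ok_def tab_def frame_def fun_eq_iff)
    show ?case
      unfolding runs_Seq_assoc[symmetric]
    proof (rule runs_seq[OF runs_scenario[OF r t(1) 4(3,1)], where W = 1])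
      fix s'' assume "frame (Seq (Decode ''c'' ''m'' ''dig'') CostOf) s' s''"
        "rmem s'' ''v'' 0 = scost (sel (tab s') (digits k m c)) \<and> (\<forall>i<k. nmem s'' ''dig'' i = digits k m c i)"
      with 4(4) show "runs (RSet ''V'' (RAdd (RV ''V'') (RV ''v''))) s'' 1
        (\<lambda>s''. rmem (nstore ''c'' 0 (Suc c) s'') ''V'' 0 = (\<Sum>c<Suc c. scost (sel (tab s) (digits k m c))))"
        by (simp add: frame_def t)
    qed simp
  next
    case (5 s')
    then show ?case by (simp add: total_digits)
  qed (simp_all add: algebra_simps)
  then show ?thesis by (simp add: Total_def total_time_def)
qed

end

section \<open>Running the greedy algorithm for all guesses\<close>

text \<open>Trial entries are written into the table itself, where \<open>Total\<close> evaluates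
  them; the last store installs the winner.\<close>

definition Pick :: com where
  "Pick = Seq (NSet ''has'' (NConst 0))
    (Seq (For ''x'' (NLess (NV ''x'') (NV ''n''))
      (Cond (BAnd (NLess (NConst 0) (NLoad ''facility'' (NV ''x'')))
              (BNot (RLess (RLoad ''br'' (NLoad ''lead'' (NV ''p'')))
                (RLoad ''dist'' (NAdd (NLoad ''row'' (NLoad ''bc'' (NLoad ''lead'' (NV ''p'')))) (NV ''x''))))))
        (Seq (NStore ''tbl'' (NAdd (NLoad ''row'' (NV ''q'')) (NV ''p'')) (NAdd (NV ''x'') (NConst 1)))
        (Seq Total
        (Cond (BNot (BAnd (NLess (NConst 0) (NV ''has'')) (BNot (RLess (RV ''V'') (RV ''bv'')))))
          (Seq (RSet ''bv'' (RV ''V''))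
          (Seq (NSet ''bx'' (NAdd (NV ''x'') (NConst 1))) (NSet ''has'' (NConst 1))))
          Skip)))
        Skip))
    (NStore ''tbl'' (NAdd (NLoad ''row'' (NV ''q'')) (NV ''p'')) (NV ''bx'')))"

lemma nw_Pick [simp]: "nw Pick = {''has'', ''x'', ''bx'', ''tbl''} \<union> nw Total"
  and rw_Pick [simp]: "rw Pick = {''bv''} \<union> rw Total"
  unfolding Pick_def by (auto simp del: nw_Total rw_Total)

definition Fill :: com where
  "Fill = For ''q'' (NLess (NV ''q'') (NV ''m'')) (For ''p'' (NLess (NV ''p'') (NV ''k'')) Pick)"

lemma nw_Fill [simp]: "nw Fill = {''q'', ''p''} \<union> nw Pick"
  and rw_Fill [simp]: "rw Fill = rw Pick"
  unfolding Fill_def by (auto simp del: nw_Pick rw_Pick)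

definition Reset :: com where
  "Reset = For ''a'' (NLess (NV ''a'') (NLoad ''row'' (NV ''m''))) (NStore ''tbl'' (NV ''a'') (NConst 0))"

lemma nw_Reset [simp]: "nw Reset = {''a'', ''tbl''}"
  and rw_Reset [simp]: "rw Reset = {}"
  by (auto simp: Reset_def)

text \<open>The record \<open>best\<close>, \<open>bh\<close>, \<open>sol\<close> is never reset, so
  it ranges over all guesses.\<close>

definition Scan :: com where
  "Scan = For ''c'' (RLess (RNat (NV ''c'')) (RV ''M''))
    (Seq (Seq (Decode ''c'' ''m'' ''dig'') CostOf)
    (Cond (BNot (BAnd (NLess (NConst 0) (NV ''bh'')) (BNot (RLess (RV ''v'') (RV ''best'')))))
      (Seq (RSet ''best'' (RV ''v''))
      (Seq (NSet ''bh'' (NConst 1))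
      (For ''i'' (NLess (NV ''i'') (NV ''k''))
        (NStore ''sol'' (NV ''i'')
          (NSub (NLoad ''tbl'' (NAdd (NLoad ''row'' (NLoad ''dig'' (NV ''i''))) (NV ''i''))) (NConst 1))))))
      Skip))"

lemma nw_Scan [simp]: "nw Scan = {''c'', ''bh'', ''i'', ''sol''} \<union> nw (Decode ''c'' ''m'' ''dig'') \<union> nw CostOf"
  and rw_Scan [simp]: "rw Scan = {''best''} \<union> rw CostOf"
  unfolding Scan_def by (auto simp del: nw_Decode nw_CostOf rw_CostOf)

definition Main :: com where
  "Main = For ''g'' (RLess (RNat (NV ''g'')) (RV ''G''))
    (Seq (Decode ''g'' ''nb'' ''lead'') (Seq Reset (Seq Fill Scan)))"

lemma nw_Main [simp]:
  "nw Main = {''g''} \<union> nw (Decode ''g'' ''nb'' ''lead'') \<union> nw Reset \<union> nw Fill \<union> nw Scan"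
  and rw_Main [simp]: "rw Main = rw Fill \<union> rw Scan"
  unfolding Main_def by (auto simp del: nw_Decode nw_Reset nw_Fill nw_Scan rw_Fill rw_Scan)

definition pick_time :: "nat \<Rightarrow> nat \<Rightarrow> nat \<Rightarrow> nat" where
  "pick_time n k M = n * (total_time n k M + 8) + 4"

definition fill_time :: "nat \<Rightarrow> nat \<Rightarrow> nat \<Rightarrow> nat \<Rightarrow> nat" where
  "fill_time n k m M = m * (k * (pick_time n k M + 2) + 4) + 2"

definition scan_time :: "nat \<Rightarrow> nat \<Rightarrow> nat \<Rightarrow> nat" where
  "scan_time n k M = M * (decode_time k M + cost_time n k + 3 * k + 7) + 2"

definition main_time :: "nat \<Rightarrow> nat \<Rightarrow> nat \<Rightarrow> nat \<Rightarrow> nat \<Rightarrow> nat" where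
  "main_time n k m M G =
     G * (decode_time k G + (m * n * 3 + 2) + fill_time n k m M + scan_time n k M + 2) + 2"

section \<open>Correctness of the greedy filling and of the search over guesses\<close>

context kmedian_nat
begin

definition best_ok :: "state \<Rightarrow> bool" where
  "best_ok s \<longleftrightarrow> (0 < nmem s ''bh'' 0 \<longrightarrow> (\<forall>i<k. nmem s ''sol'' i \<in> F) \<and>
     (\<Sum>j\<in>C. w j * Min ((\<lambda>i. d j (nmem s ''sol'' i)) ` {..<k})) \<le> rmem s ''best'' 0)"

text \<open>The other half of the specification: \<open>best_ok\<close> says that the record is
  attained, \<open>upto s r\<close> that it is at most \<open>r\<close>. As the record only
  improves, such bounds persist, and no minimum over all guesses has to be named.\<close>

definition upto :: "state \<Rightarrow> real \<Rightarrow> bool" where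
  "upto s r \<longleftrightarrow> 0 < nmem s ''bh'' 0 \<and> rmem s ''best'' 0 \<le> r"

lemma best_frame:
  assumes "frame p s s'" "nw p \<inter> {''bh'', ''sol''} = {}" "''best'' \<notin> rw p"
  shows "best_ok s' = best_ok s" "upto s' = upto s"
proof -
  have "nmem s' x = nmem s x" if "x \<in> {''bh'', ''sol''}" for x
    using assms(1,2) that unfolding frame_def by blast
  moreover have "rmem s' ''best'' = rmem s ''best''"
    using assms(1,3) unfolding frame_def by blast
  ultimately show "best_ok s' = best_ok s" "upto s' = upto s"
    by (simp_all add: best_ok_def upto_def fun_eq_iff)
qed

lemma address_eq_iff: "i < n \<Longrightarrow> i' < n \<Longrightarrow> q * n + i = q' * n + i' \<longleftrightarrow> q = q' \<and> i = i'"
proof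
  assume "i < n" "i' < n" "q * n + i = q' * n + i'"
  then show "q = q' \<and> i = i'"
    by (metis add.commute add_left_cancel div_mult_self1 div_less add_0 not_less_zero)
qed simp

end

context kmedian_guess
begin

lemma ready_nstore [simp]:
  assumes "x \<notin> {''n'', ''k'', ''client'', ''facility'', ''m'', ''row'', ''bc'', ''lead''}"
  shows "ready (nstore x i v s) = ready s"
proof -
  let ?p = "NStore x (NConst i) (NConst v)"
  have "nw ?p \<inter> {''n'', ''k'', ''client'', ''facility'', ''m'', ''row'', ''bc'', ''lead''} = {}"
    using assms by simp
  moreover have "rw ?p \<inter> {''eps'', ''dist'', ''weight'', ''M'', ''br''} = {}" by simp
  moreover have "frame ?p s (nstore x i v s)" "frame ?p (nstore x i v s) s"
    by (simp_all add: frame_def)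
  ultimately show ?thesis by (metis ready_frame)
qed

lemma tab_nstore [simp]: "x \<noteq> ''tbl'' \<Longrightarrow> tab (nstore x i v s) = tab s"
  by (simp add: tab_def fun_eq_iff)

lemma tab_rstore [simp]: "tab (rstore x i v s) = tab s"
  by (simp add: tab_def fun_eq_iff)

lemma tab_nstore_tbl:
  "i < k \<Longrightarrow> i' < k \<Longrightarrow> tab (nstore ''tbl'' (q * n + i) v s) q' i' = (if q' = q \<and> i' = i then v else tab s q' i')"
  using k_le_n by (simp add: tab_def address_eq_iff conj_commute)

lemma tab_frame: "frame p s s' \<Longrightarrow> ''tbl'' \<notin> nw p \<Longrightarrow> tab s' = tab s"
  by (simp add: tab_def frame_def fun_eq_iff)

lemma runs_Pick:
  assumes s: "ready s" "tab_ok s" and q: "nmem s ''q'' 0 = q" "q < m" and p: "nmem s ''p'' 0 = p" "p < k"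
  shows "runs Pick s (pick_time n k (m ^ k)) (\<lambda>s'. tab_ok s' \<and>
    (\<exists>a\<in>entries p. (\<forall>x\<in>entries p. total (put (tab s) q p a) \<le> total (put (tab s) q p x)) \<and>
      (\<forall>q'<m. \<forall>i'<k. tab s' q' i' = put (tab s) q p a q' i')))"
proof -
  let ?tt = "total_time n k (m ^ k)"
  let ?upd = "Cond (BNot (BAnd (NLess (NConst 0) (NV ''has'')) (BNot (RLess (RV ''V'') (RV ''bv'')))))
          (Seq (RSet ''bv'' (RV ''V''))
          (Seq (NSet ''bx'' (NAdd (NV ''x'') (NConst 1))) (NSet ''has'' (NConst 1))))
          Skip"
  define val where "val = (\<lambda>e. total (put (tab s) q p e))"
  \<comment> \<open>Facility \<open>x\<close> is entry \<open>Suc x\<close>, so after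
    \<open>x\<close> rounds exactly the entries \<open>e \<le> x\<close> have been tried. The cell
    under trial may hold a leftover candidate and is only bounded by \<open>n\<close>.\<close>
  define I where "I = (\<lambda>x s'. (\<forall>q'<m. \<forall>i'<k. (q', i') \<noteq> (q, p) \<longrightarrow> tab s' q' i' = tab s q' i') \<and>
    tab s' q p \<le> n \<and>
    (if nmem s' ''has'' 0 = 0 then \<forall>e\<in>entries p. x < e
     else nmem s' ''bx'' 0 \<in> entries p \<and> rmem s' ''bv'' 0 = val (nmem s' ''bx'' 0) \<and>
       (\<forall>e\<in>entries p. e \<le> x \<longrightarrow> rmem s' ''bv'' 0 \<le> val e)))"
  have loop: "runs (For ''x'' (NLess (NV ''x'') (NV ''n''))
      (Cond (BAnd (NLess (NConst 0) (NLoad ''facility'' (NV ''x'')))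
              (BNot (RLess (RLoad ''br'' (NLoad ''lead'' (NV ''p'')))
                (RLoad ''dist'' (NAdd (NLoad ''row'' (NLoad ''bc'' (NLoad ''lead'' (NV ''p'')))) (NV ''x''))))))
        (Seq (NStore ''tbl'' (NAdd (NLoad ''row'' (NV ''q'')) (NV ''p'')) (NAdd (NV ''x'') (NConst 1)))
        (Seq Total ?upd)) Skip)) (nstore ''has'' 0 0 s) (n * (?tt + 8) + 2) (I n)"
  proof (rule runs_For[where N = n and T = "?tt + 6" and I = I], goal_cases)
    case 2
    show ?case using s(2) q p entries_le by (auto simp: I_def tab_ok_def)
  next
    case (3 s')
    have "nmem s' ''n'' 0 = n" using s 3 by (simp add: frame_def ready_def base_def)
    then show ?case by simp
  next
    case (4 x s')
    have fr: "frame Pick s s'" using 4(2) by (auto simp: frame_def)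
    have r: "ready s'" by (rule ready_frame[OF s(1) fr]) auto
    have qp: "nmem s' ''q'' 0 = q" "nmem s' ''p'' 0 = p" using fr q p by (simp_all add: frame_def)
    have lead: "nmem s' ''lead'' p = L p" "nmem s' ''bc'' = bc" "rmem s' ''br'' = br"
      using r p(2) by (simp_all add: ready_def)
    have bn: "bc (L p) < n" using balls[OF guess[OF p(2)]] C_less by simp
    have rows: "nmem s' ''row'' q = q * n" "nmem s' ''row'' (bc (L p)) = bc (L p) * n"
      "rmem s' ''dist'' (bc (L p) * n + x) = d (bc (L p)) x"
      "nmem s' ''facility'' x = (if x \<in> F then 1 else 0)"
      using r bn q(2) 4(1) by (simp_all add: ready_def base_def)
    have mem: "Suc x \<in> entries p \<longleftrightarrow> x \<in> F \<and> \<not> br (L p) < d (bc (L p)) x"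
      by (auto simp: ball_entries_def not_less)
    show ?case
    proof (cases "Suc x \<in> entries p")
      case False
      have lt: "Suc x < e" if "e \<in> entries p" "x < e" for e
        using that False by (metis Suc_lessI)
      have le: "e \<le> x" if "e \<in> entries p" "e \<le> Suc x" for e
        using that False by (metis le_SucE)
      have "I (Suc x) (nstore ''x'' 0 (Suc x) s')"
        using 4(4) lt le by (simp add: I_def split: if_splits) (metis le)
      with False 4(3) mem show ?thesis by (simp add: qp lead rows)
    next
      case True
      let ?s1 = "nstore ''tbl'' (q * n + p) (Suc x) s'"
      have same: "\<not> (q' = q \<and> i' = p) \<Longrightarrow> tab s' q' i' = tab s q' i'" if "q' < m" "i' < k" for q' i'
        using 4(4) that by (simp add: I_def)
      have t1: "tab ?s1 q' i' = put (tab s) q p (Suc x) q' i'" if "q' < m" "i' < k" for q' i'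
        using same[OF that] that p by (auto simp: tab_nstore_tbl put_def)
      have ok1: "tab_ok ?s1"
        unfolding tab_ok_def
      proof (intro allI impI)
        fix q' i' assume a: "q' < m" "i' < k"
        show "tab ?s1 q' i' \<le> n" unfolding t1[OF a] using s(2) 4(1) a by (simp add: tab_ok_def put_def)
      qed
      have tot: "total (tab ?s1) = val (Suc x)" unfolding val_def by (rule total_cong) (rule t1)
      have "runs (Seq Total ?upd) ?s1 (4 + ?tt) (\<lambda>s''. I (Suc x) (nstore ''x'' 0 (Suc x) s''))"
      proof (rule runs_seq[OF runs_Total[OF _ ok1], where W = 4])
        fix s'' assume A: "frame Total ?s1 s''" "rmem s'' ''V'' 0 = total (tab ?s1)"
        have m: "nmem s'' ''x'' 0 = x" "nmem s'' ''has'' = nmem s' ''has''" "nmem s'' ''bx'' = nmem s' ''bx''"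
          "rmem s'' ''bv'' = rmem s' ''bv''" "tab s'' = tab ?s1"
          using A(1) 4(3) by (simp_all add: frame_def tab_def fun_eq_iff)
        have V: "rmem s'' ''V'' 0 = val (Suc x)" using A(2) tot by simp
        have tb: "(\<forall>q'<m. \<forall>i'<k. (q', i') \<noteq> (q, p) \<longrightarrow> tab s'' q' i' = tab s q' i') \<and> tab s'' q p \<le> n"
          using 4(1) q p by (auto simp: m t1 put_def)
        have fst: "\<forall>e\<in>entries p. x < e" if "nmem s' ''has'' 0 = 0"
          using 4(4) that by (simp add: I_def)
        have old: "nmem s' ''bx'' 0 \<in> entries p" "rmem s' ''bv'' 0 = val (nmem s' ''bx'' 0)"
          "\<And>e. e \<in> entries p \<Longrightarrow> e \<le> x \<Longrightarrow> rmem s' ''bv'' 0 \<le> val e" if "nmem s' ''has'' 0 \<noteq> 0"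
          using 4(4) that unfolding I_def by auto
        show "runs ?upd s'' 4 (\<lambda>s''. I (Suc x) (nstore ''x'' 0 (Suc x) s''))"
        proof (cases "nmem s' ''has'' 0 \<noteq> 0 \<and> \<not> val (Suc x) < rmem s' ''bv'' 0")
          case keep: True
          then have "rmem s' ''bv'' 0 \<le> val e" if "e \<in> entries p" "e \<le> Suc x" for e
            using old(3)[of e] that by (cases "e = Suc x") auto
          with keep old tb show ?thesis by (simp add: I_def m V)
        next
          case new: False
          then have "val (Suc x) \<le> val e" if "e \<in> entries p" "e \<le> Suc x" for e
            using old(3)[of e] fst that by (cases "e = Suc x") force+
          with new True tb show ?thesis by (auto simp: I_def m V)
        qed
      qed (simp_all add: r)
      moreover have "x \<in> F" "\<not> br (L p) < d (bc (L p)) x" using True mem by simp_all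
      ultimately show ?thesis by (simp add: qp lead rows 4(3))
    qed
  qed (auto simp: algebra_simps)
  have "runs (Seq (For ''x'' (NLess (NV ''x'') (NV ''n''))
      (Cond (BAnd (NLess (NConst 0) (NLoad ''facility'' (NV ''x'')))
              (BNot (RLess (RLoad ''br'' (NLoad ''lead'' (NV ''p'')))
                (RLoad ''dist'' (NAdd (NLoad ''row'' (NLoad ''bc'' (NLoad ''lead'' (NV ''p'')))) (NV ''x''))))))
        (Seq (NStore ''tbl'' (NAdd (NLoad ''row'' (NV ''q'')) (NV ''p'')) (NAdd (NV ''x'') (NConst 1)))
        (Seq Total ?upd)) Skip))
    (NStore ''tbl'' (NAdd (NLoad ''row'' (NV ''q'')) (NV ''p'')) (NV ''bx'')))
    (nstore ''has'' 0 0 s) (n * (?tt + 8) + 3) (\<lambda>s'. tab_ok s' \<and>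
    (\<exists>a\<in>entries p. (\<forall>x\<in>entries p. total (put (tab s) q p a) \<le> total (put (tab s) q p x)) \<and>
      (\<forall>q'<m. \<forall>i'<k. tab s' q' i' = put (tab s) q p a q' i')))"
  proof (rule runs_seq[OF loop, where W = 1], simp, goal_cases)
    case (1 s')
    have fr: "frame Pick s s'" using 1(1) by (auto simp: frame_def)
    have r: "ready s'" by (rule ready_frame[OF s(1) fr]) auto
    have qp: "nmem s' ''q'' 0 = q" "nmem s' ''p'' 0 = p" using fr q p by (simp_all add: frame_def)
    have row: "nmem s' ''row'' q = q * n" using r q(2) by (simp add: ready_def base_def)
    \<comment> \<open>The ball contains a facility, so the search cannot come back empty and
      \<open>bx\<close> is meaningful.\<close>
    have has: "nmem s' ''has'' 0 \<noteq> 0"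
    proof
      assume "nmem s' ''has'' 0 = 0"
      then have "\<forall>e\<in>entries p. n < e" using 1(2) by (simp add: I_def)
      with entries_ne[OF p(2)] entries_le show False by fastforce
    qed
    let ?a = "nmem s' ''bx'' 0" and ?s = "nstore ''tbl'' (q * n + p) (nmem s' ''bx'' 0) s'"
    have a: "?a \<in> entries p" "\<And>e. e \<in> entries p \<Longrightarrow> val ?a \<le> val e"
      using 1(2) has entries_le by (auto simp: I_def)
    have same: "\<not> (q' = q \<and> i' = p) \<Longrightarrow> tab s' q' i' = tab s q' i'" if "q' < m" "i' < k" for q' i'
      using 1(2) that by (simp add: I_def)
    have t: "tab ?s q' i' = put (tab s) q p ?a q' i'" if "q' < m" "i' < k" for q' i'
      using same[OF that] that p by (auto simp: tab_nstore_tbl put_def)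
    have "tab_ok ?s"
      unfolding tab_ok_def
    proof (intro allI impI)
      fix q' i' assume b: "q' < m" "i' < k"
      show "tab ?s q' i' \<le> n"
        unfolding t[OF b] using s(2) entries_le[OF a(1)] b by (simp add: tab_ok_def put_def)
    qed
    with a t show ?case by (auto simp: qp row val_def)
  qed
  then show ?thesis by (simp add: Pick_def pick_time_def numeral_eq_Suc)
qed

lemma runs_Fill:
  assumes s: "ready s" "\<And>q i. q < m \<Longrightarrow> i < k \<Longrightarrow> tab s q i = 0"
  shows "runs Fill s (fill_time n k m (m ^ k)) (\<lambda>s'. greedy m 0 (tab s'))"
  unfolding Fill_def
proof (rule runs_For[where N = m and T = "k * (pick_time n k (m ^ k) + 2) + 2" and
      I = "\<lambda>q s'. greedy q 0 (tab s')"], goal_cases)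
  case (3 s')
  have "nmem s' ''m'' 0 = m" using s 3 by (simp add: frame_def ready_def base_def)
  then show ?case by simp
next
  case (4 q s')
  have fr: "frame Fill s s'" using 4(2) by (auto simp: frame_def Fill_def)
  have r: "ready s'" by (rule ready_frame[OF s(1) fr]) auto
  show ?case
  proof (rule runs_For[where N = k and T = "pick_time n k (m ^ k)" and
        I = "\<lambda>p s'. greedy q p (tab s')"], goal_cases)
    case (3 s'')
    have "nmem s'' ''k'' 0 = k" using r 3 by (simp add: frame_def ready_def base_def)
    then show ?case by simp
  next
    case (4 p s'')
    have r': "ready s''" by (rule ready_frame[OF r 4(2)]) auto
    have q: "nmem s'' ''q'' 0 = q" using 4(2) \<open>nmem s' ''q'' 0 = q\<close> by (simp add: frame_def)
    have ok: "tab_ok s''"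
      unfolding tab_ok_def using greedy_entries[OF 4(4)] entries_le
      by (metis le0)
    show ?case
    proof (rule runs_mono[OF runs_Pick[OF r' ok q \<open>q < m\<close> 4(3,1)] order.refl])
      fix s3 assume "tab_ok s3 \<and> (\<exists>a\<in>entries p. (\<forall>x\<in>entries p. total (put (tab s'') q p a)
         \<le> total (put (tab s'') q p x)) \<and> (\<forall>q'<m. \<forall>i'<k. tab s3 q' i' = put (tab s'') q p a q' i'))"
      then obtain a where "a \<in> entries p"
        "\<And>x. x \<in> entries p \<Longrightarrow> total (put (tab s'') q p a) \<le> total (put (tab s'') q p x)"
        "\<And>q' i'. q' < m \<Longrightarrow> i' < k \<Longrightarrow> tab s3 q' i' = put (tab s'') q p a q' i'"
        by blast
      then have "greedy q (Suc p) (tab s3)" by (rule greedy.step[OF 4(4) \<open>q < m\<close> 4(1)])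
      then show "greedy q (Suc p) (tab (nstore ''p'' 0 (Suc p) s3))" by simp
    qed
  next
    case (5 s'')
    then show ?case by (simp add: greedy.wrap)
  qed (use 4 in auto)
next
  case 2
  then show ?case using s(2) by (simp add: greedy.start)
qed (auto simp: fill_time_def algebra_simps)

lemma runs_Reset:
  assumes s: "ready s"
  shows "runs Reset s (m * n * 3 + 2) (\<lambda>s'. \<forall>q<m. \<forall>i<k. tab s' q i = 0)"
  unfolding Reset_def
proof (rule runs_For[where N = "m * n" and T = 1 and I = "\<lambda>a s'. \<forall>x<a. nmem s' ''tbl'' x = 0"],
    goal_cases)
  case (3 s')
  have "nmem s' ''row'' = nmem s ''row''" "nmem s' ''m'' = nmem s ''m''"
    using 3 by (simp_all add: frame_def)
  with s have "nmem s' ''row'' (nmem s' ''m'' 0) = m * n" by (simp add: ready_def base_def)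
  then show ?case by simp
next
  case (5 s')
  have "q * n + i < m * n" if "q < m" "i < k" for q i
  proof -
    have "q * n + i < Suc q * n" using that k_le_n by simp
    also have "\<dots> \<le> m * n" using that by (intro mult_le_mono1) simp
    finally show ?thesis .
  qed
  with 5 show ?case by (simp add: tab_def)
qed (auto simp: less_Suc_eq)

lemma runs_Scan:
  assumes s: "ready s" "best_ok s" and full: "\<And>q i. q < m \<Longrightarrow> i < k \<Longrightarrow> tab s q i \<in> entries i"
  shows "runs Scan s (scan_time n k (m ^ k)) (\<lambda>s'. best_ok s' \<and>
    (\<forall>c\<in>Om. upto s' (scost (sel (tab s) c))) \<and> (\<forall>r. upto s r \<longrightarrow> upto s' r))"
proof -
  have ok: "tab_ok s" unfolding tab_ok_def using full entries_le by blast
  define sc where "sc = (\<lambda>c. scost (sel (tab s) (digits k m c)))"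
  let ?copy = "For ''i'' (NLess (NV ''i'') (NV ''k''))
        (NStore ''sol'' (NV ''i'')
          (NSub (NLoad ''tbl'' (NAdd (NLoad ''row'' (NLoad ''dig'' (NV ''i''))) (NV ''i''))) (NConst 1)))"
  have copy: "runs ?copy s1 (3 * k + 2) (\<lambda>s2. \<forall>i<k. nmem s2 ''sol'' i = tab s (c i) i - 1)"
    if s1: "ready s1" "tab s1 = tab s" and dig: "\<And>i. i < k \<Longrightarrow> nmem s1 ''dig'' i = c i" "\<And>i. i < k \<Longrightarrow> c i < m"
    for s1 c
  proof (rule runs_For[where N = k and T = 1 and
        I = "\<lambda>i s2. \<forall>i'<i. nmem s2 ''sol'' i' = tab s (c i') i' - 1"], goal_cases)
    case (3 s2)
    have "nmem s2 ''k'' 0 = k" using s1 3 by (simp add: frame_def ready_def base_def)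
    then show ?case by simp
  next
    case (4 i s2)
    have m: "nmem s2 ''row'' = nmem s1 ''row''" "nmem s2 ''dig'' = nmem s1 ''dig''"
      "nmem s2 ''tbl'' = nmem s1 ''tbl''" using 4(2) by (simp_all add: frame_def)
    have "nmem s1 ''row'' (c i) = c i * n"
      using s1(1) dig(2)[OF 4(1)] by (simp add: ready_def base_def)
    moreover have "nmem s1 ''tbl'' (c i * n + i) = tab s (c i) i"
      using s1(2) by (simp add: tab_def fun_eq_iff)
    ultimately show ?case using 4 dig by (simp add: m less_Suc_eq)
  qed auto
  \<comment> \<open>In a full table the default no longer occurs, so the surrogate cost equals the
    true cost of the selected facilities.\<close>
  have scost_sol: "scost (sel (tab s) c) = (\<Sum>j\<in>C. w j * Min ((\<lambda>i. d j (tab s (c i) i - 1)) ` {..<k}))"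
    if "\<And>i. i < k \<Longrightarrow> c i < m" for c
    unfolding scost_def near_def
  proof (intro sum.cong refl arg_cong2[where f = "(*)"] arg_cong[where f = Min] image_cong)
    fix i j assume "i \<in> {..<k}"
    then have "tab s (c i) i \<noteq> 0" using full[of "c i" i] that entries_le by force
    then show "gd i (sel (tab s) c i) j = d j (tab s (c i) i - 1)" by (simp add: sel_def dentry_def)
  qed
  have "runs Scan s (scan_time n k (m ^ k)) (\<lambda>s'. best_ok s' \<and> (\<forall>c<m ^ k. upto s' (sc c)) \<and>
      (\<forall>r. upto s r \<longrightarrow> upto s' r))"
    unfolding Scan_def
  proof (rule runs_For[where N = "m ^ k" and T = "decode_time k (m ^ k) + cost_time n k + (3 * k + 5)" and
        I = "\<lambda>c s'. best_ok s' \<and> (\<forall>c'<c. upto s' (sc c')) \<and> (\<forall>r. upto s r \<longrightarrow> upto s' r)"],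
      goal_cases)
    case 2
    show ?case using s(2) by (simp add: best_ok_def upto_def)
  next
    case (3 s')
    have "rmem s' ''M'' 0 = real (m ^ k)" using s 3 by (simp add: frame_def ready_def)
    then show ?case by (simp del: of_nat_power)
  next
    case (4 c s')
    have fr: "frame Scan s s'" using 4(2) by (auto simp: frame_def)
    have r: "ready s'" by (rule ready_frame[OF s(1) fr]) auto
    have t: "tab s' = tab s" by (rule tab_frame[OF fr]) simp
    then have ok': "tab_ok s'" using ok by (simp add: tab_ok_def)
    show ?case
    proof (rule runs_seq[OF runs_scenario[OF r ok' 4(3,1)], where W = "3 * k + 5"], simp, goal_cases)
      case (1 s1)
      have r1: "ready s1" by (rule ready_frame[OF r 1(1)]) auto
      have t1: "tab s1 = tab s" using tab_frame[OF 1(1)] t by simp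
      have b: "best_ok s1 = best_ok s'" "upto s1 = upto s'"
        by (rule best_frame[OF 1(1)]; simp)+
      have v: "rmem s1 ''v'' 0 = sc c" using 1(2) t by (simp add: sc_def)
      have b1: "best_ok s1" "\<And>c'. c' < c \<Longrightarrow> upto s1 (sc c')" "\<And>r. upto s r \<Longrightarrow> upto s1 r"
        using 4(4) b by auto
      show ?case
      proof (cases "0 < nmem s1 ''bh'' 0 \<and> \<not> sc c < rmem s1 ''best'' 0")
        case True
        then have "upto s1 (sc c)" by (simp add: upto_def)
        then have "best_ok s1 \<and> (\<forall>c'<Suc c. upto s1 (sc c')) \<and> (\<forall>r. upto s r \<longrightarrow> upto s1 r)"
          using b1 by (auto simp: less_Suc_eq)
        with True v show ?thesis by (simp add: best_ok_def upto_def)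
      next
        case False
        let ?s2 = "nstore ''bh'' 0 1 (rstore ''best'' 0 (sc c) s1)"
        have r2: "ready ?s2" using r1 by (simp add: ready_def base_def)
        have t2: "tab ?s2 = tab s" using t1 by (simp add: tab_def fun_eq_iff)
        have "runs ?copy ?s2 (2 + 3 * k) (\<lambda>s3. let s' = nstore ''c'' 0 (Suc c) s3 in
          best_ok s' \<and> (\<forall>c'<Suc c. upto s' (sc c')) \<and> (\<forall>r. upto s r \<longrightarrow> upto s' r))"
        proof (rule runs_mono[OF copy[of ?s2 "digits k m c", OF r2 t2]])
          fix s3 assume A: "frame ?copy ?s2 s3" "\<forall>i<k. nmem s3 ''sol'' i = tab s (digits k m c i) i - 1"
          have m: "nmem s3 ''bh'' 0 = 1" "rmem s3 ''best'' 0 = sc c"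
            using A(1) by (simp_all add: frame_def)
          have "Min ((\<lambda>i. d j (nmem s3 ''sol'' i)) ` {..<k})
              = Min ((\<lambda>i. d j (tab s (digits k m c i) i - 1)) ` {..<k})" for j
            using A(2) by (intro arg_cong[where f = Min] image_cong) auto
          then have "(\<Sum>j\<in>C. w j * Min ((\<lambda>i. d j (nmem s3 ''sol'' i)) ` {..<k})) = sc c"
            unfolding sc_def by (subst scost_sol) (auto intro: digits_less)
          moreover have "nmem s3 ''sol'' i \<in> F" if "i < k" for i
            using A(2) that full[OF digits_less[OF that] that, of c] by (auto simp: ball_entries_def)
          ultimately have "best_ok s3" using m by (simp add: best_ok_def)
          \<comment> \<open>A bound on the old record presupposes that a record exists, and then the
            update happens only if the new value is strictly smaller.\<close>
          moreover have up: "upto s3 r" if "upto s1 r" for r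
            using that False m by (simp add: upto_def)
          moreover have "upto s3 (sc c)" using m by (simp add: upto_def)
          ultimately have "best_ok s3 \<and> (\<forall>c'<Suc c. upto s3 (sc c')) \<and> (\<forall>r. upto s r \<longrightarrow> upto s3 r)"
            using b1 by (auto simp: less_Suc_eq)
          moreover have eq: "best_ok (nstore ''c'' 0 (Suc c) s3) = best_ok s3"
            "upto (nstore ''c'' 0 (Suc c) s3) = upto s3"
            by (simp_all add: best_ok_def upto_def fun_eq_iff)
          ultimately show "let s' = nstore ''c'' 0 (Suc c) s3 in
            best_ok s' \<and> (\<forall>c'<Suc c. upto s' (sc c')) \<and> (\<forall>r. upto s r \<longrightarrow> upto s' r)"
            by (simp add: Let_def eq)
        qed (use 1(2) digits_less in auto)
        with False v show ?thesis by (simp add: Let_def)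
      qed
    qed
  qed (auto simp: scan_time_def algebra_simps)
  then show ?thesis
  proof (rule runs_mono[OF _ order.refl])
    fix s' assume A: "best_ok s' \<and> (\<forall>c<m ^ k. upto s' (sc c)) \<and> (\<forall>r. upto s r \<longrightarrow> upto s' r)"
    have "upto s' (scost (sel (tab s) c))" if "c \<in> Om" for c
    proof -
      from that obtain x where "x < m ^ k" "c = digits k m x"
        using bij_betw_digits[of k m] unfolding Om_def bij_betw_def by (metis imageE lessThan_iff)
      with A show ?thesis by (simp add: sc_def)
    qed
    with A show "best_ok s' \<and> (\<forall>c\<in>Om. upto s' (scost (sel (tab s) c))) \<and> (\<forall>r. upto s r \<longrightarrow> upto s' r)"
      by blast
  qed
qed

lemma runs_guess:
  assumes s: "ready s" "best_ok s"
  shows "runs (Seq Reset (Seq Fill Scan)) s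
    ((m * n * 3 + 2) + (fill_time n k m (m ^ k) + scan_time n k (m ^ k)))
    (\<lambda>s'. best_ok s' \<and> (\<exists>T. greedy m 0 T \<and> (\<forall>c\<in>Om. upto s' (scost (sel T c)))) \<and>
      (\<forall>r. upto s r \<longrightarrow> upto s' r))"
proof (rule runs_seq[OF runs_Reset[OF s(1)] order.refl])
  fix s1 assume 1: "frame Reset s s1" "\<forall>q<m. \<forall>i<k. tab s1 q i = 0"
  have r1: "ready s1" by (rule ready_frame[OF s(1) 1(1)]) auto
  have b1: "best_ok s1 = best_ok s" "upto s1 = upto s" by (rule best_frame[OF 1(1)]; simp)+
  show "runs (Seq Fill Scan) s1 (fill_time n k m (m ^ k) + scan_time n k (m ^ k))
    (\<lambda>s'. best_ok s' \<and> (\<exists>T. greedy m 0 T \<and> (\<forall>c\<in>Om. upto s' (scost (sel T c)))) \<and>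
      (\<forall>r. upto s r \<longrightarrow> upto s' r))"
  proof (rule runs_seq[OF runs_Fill[OF r1] order.refl])
    fix s2 assume 2: "frame Fill s1 s2" "greedy m 0 (tab s2)"
    have r2: "ready s2" by (rule ready_frame[OF r1 2(1)]) auto
    have b2: "best_ok s2 = best_ok s1" "upto s2 = upto s1" by (rule best_frame[OF 2(1)]; simp)+
    show "runs Scan s2 (scan_time n k (m ^ k))
      (\<lambda>s'. best_ok s' \<and> (\<exists>T. greedy m 0 T \<and> (\<forall>c\<in>Om. upto s' (scost (sel T c)))) \<and>
        (\<forall>r. upto s r \<longrightarrow> upto s' r))"
    proof (rule runs_mono[OF runs_Scan[OF r2] order.refl])
      show "best_ok s2" using s b1 b2 by simp
      show "tab s2 q i \<in> entries i" if "q < m" "i < k" for q i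
        using greedy_entries[OF 2(2)] that by auto
    qed (use 2(2) b1 b2 in auto)
  qed (use 1 in auto)
qed

end

context kmedian_nat
begin

text \<open>The table belonging to a guess is whatever the tie-breaking of the program produced,
  hence the existential \<open>T\<close>, which meets the universal one in
  \<open>good_guess\<close>.\<close>

lemma runs_Main:
  assumes m: "0 < m" and balls: "\<And>b. b < nb \<Longrightarrow> bc b \<in> C \<and> (\<exists>x\<in>F. d (bc b) x \<le> br b)"
    and s: "base \<epsilon> m s" "rmem s ''M'' 0 = real (m ^ k)" "rmem s ''G'' 0 = real (nb ^ k)"
      "nmem s ''bc'' = bc" "rmem s ''br'' = br" "nmem s ''nb'' 0 = nb" "best_ok s"
  shows "runs Main s (main_time n k m (m ^ k) (nb ^ k)) (\<lambda>s'. best_ok s' \<and>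
    (\<forall>L\<in>{..<k} \<rightarrow>\<^sub>E {..<nb}. \<exists>T. guess_greedy m bc br L m 0 T \<and>
      (\<forall>c\<in>{..<k} \<rightarrow>\<^sub>E {..<m}. upto s' (guess_cost bc br L (\<lambda>i. T (c i) i)))))"
proof -
  define R where "R = (\<lambda>s' L. \<exists>T. guess_greedy m bc br L m 0 T \<and>
      (\<forall>c\<in>{..<k} \<rightarrow>\<^sub>E {..<m}. upto s' (guess_cost bc br L (\<lambda>i. T (c i) i))))"
  let ?t = "(m * n * 3 + 2) + (fill_time n k m (m ^ k) + scan_time n k (m ^ k))"
  have "runs Main s (main_time n k m (m ^ k) (nb ^ k)) (\<lambda>s'. best_ok s' \<and> (\<forall>g<nb ^ k. R s' (digits k nb g)))"
    unfolding Main_def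
  proof (rule runs_For[where N = "nb ^ k" and T = "decode_time k (nb ^ k) + ?t" and
        I = "\<lambda>g s'. best_ok s' \<and> (\<forall>g'<g. R s' (digits k nb g'))"], goal_cases)
    case 2
    show ?case using s by (simp add: best_ok_def)
  next
    case (3 s')
    have "rmem s' ''G'' 0 = real (nb ^ k)" using s 3 by (simp add: frame_def)
    then show ?case by (simp del: of_nat_power)
  next
    case (4 g s')
    have fr: "frame Main s s'" using 4(2) by (auto simp: frame_def)
    have b: "base \<epsilon> m s'" by (rule base_frame[OF s(1) fr]) auto
    \<comment> \<open>Without balls the loop has no rounds, because \<open>k \<ge> 1\<close> makes
      \<open>nb ^ k\<close> vanish; \<open>Decode\<close> needs a positive base.\<close>
    have nb: "0 < nb" using 4(1) k_bounds by (cases nb) (auto simp: power_0_left)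
    interpret G: kmedian_guess n d C w F k \<epsilon> m nb bc br "digits k nb g"
      by unfold_locales (use m balls nb in \<open>auto simp: digits_def\<close>)
    have D: "runs (Decode ''g'' ''nb'' ''lead'') s' (decode_time k g)
        (\<lambda>s'. \<forall>i<k. nmem s' ''lead'' i = g div nb ^ i mod nb)"
      by (rule runs_Decode) (use 4(3) b nb s(6) fr in \<open>simp_all add: base_def frame_def\<close>)
    have time: "decode_time k g \<le> decode_time k (nb ^ k)"
      using 4(1) by (simp add: decode_time_def)
    show ?case
    proof (rule runs_seq[OF D, where W = ?t])
      fix s1 assume A: "frame (Decode ''g'' ''nb'' ''lead'') s' s1"
        "\<forall>i<k. nmem s1 ''lead'' i = g div nb ^ i mod nb"
      have b1: "base \<epsilon> m s1" by (rule base_frame[OF b A(1)]) auto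
      have mem: "rmem s1 ''M'' 0 = real (m ^ k)" "nmem s1 ''bc'' = bc" "rmem s1 ''br'' = br"
        using A(1) fr s by (simp_all add: frame_def)
      have r: "G.ready s1" unfolding G.ready_def using b1 A(2) mem by (simp add: digits_def)
      have k1: "best_ok s1 = best_ok s'" "upto s1 = upto s'" by (rule best_frame[OF A(1)]; simp)+
      show "runs (Seq Reset (Seq Fill Scan)) s1 ?t
        (\<lambda>s'. best_ok (nstore ''g'' 0 (Suc g) s') \<and> (\<forall>g'<Suc g. R (nstore ''g'' 0 (Suc g) s') (digits k nb g')))"
      proof (rule runs_mono[OF G.runs_guess[OF r] order.refl])
        fix s2 assume B: "best_ok s2 \<and> (\<exists>T. G.greedy m 0 T \<and> (\<forall>c\<in>G.Om. upto s2 (G.scost (G.sel T c)))) \<and>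
          (\<forall>r. upto s1 r \<longrightarrow> upto s2 r)"
        let ?s = "nstore ''g'' 0 (Suc g) s2"
        have eq: "best_ok ?s = best_ok s2" "upto ?s = upto s2"
          by (simp_all add: best_ok_def upto_def fun_eq_iff)
        have "R ?s (digits k nb g)"
          using B unfolding R_def eq G.Om_def G.sel_def by blast
        moreover have "R ?s (digits k nb g')" if "g' < g" for g'
        proof -
          have up: "upto s2 r" if "upto s' r" for r using B k1(2) that by simp
          from 4(4) that have "R s' (digits k nb g')" by blast
          then show ?thesis unfolding R_def eq using up by blast
        qed
        ultimately show "best_ok ?s \<and> (\<forall>g'<Suc g. R ?s (digits k nb g'))"
          using B eq by (auto simp: less_Suc_eq)
      qed (use 4(4) k1 in simp)
    qed (use time in simp)
  qed (auto simp: main_time_def algebra_simps)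
  then show ?thesis
  proof (rule runs_mono[OF _ order.refl])
    fix s' assume A: "best_ok s' \<and> (\<forall>g<nb ^ k. R s' (digits k nb g))"
    have "R s' L" if "L \<in> {..<k} \<rightarrow>\<^sub>E {..<nb}" for L
    proof -
      from that obtain x where "x < nb ^ k" "L = digits k nb x"
        using bij_betw_digits[of k nb] unfolding bij_betw_def by (metis imageE lessThan_iff)
      with A show ?thesis by simp
    qed
    with A show "best_ok s' \<and> (\<forall>L\<in>{..<k} \<rightarrow>\<^sub>E {..<nb}. \<exists>T. guess_greedy m bc br L m 0 T \<and>
      (\<forall>c\<in>{..<k} \<rightarrow>\<^sub>E {..<m}. upto s' (guess_cost bc br L (\<lambda>i. T (c i) i))))"
      unfolding R_def by blast
  qed
qed

end

section \<open>Setup, list of balls, and completion\<close>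

text \<open>In place of a rounding operation, counting upwards finds the least integer that is at
  least \<open>1 + 1 / \<epsilon>\<close>.\<close>

definition SetColours :: com where
  "SetColours = Seq (NSet ''m'' (NConst 1))
    (While (RLess (RMul (RNat (NV ''m'')) (RV ''eps'')) (RAdd (RNat (NConst 1)) (RV ''eps''))) (NInc ''m''))"

lemma nw_SetColours [simp]: "nw SetColours = {''m''}"
  and rw_SetColours [simp]: "rw SetColours = {}"
  by (auto simp: SetColours_def)

definition Rows :: com where
  "Rows = For ''a'' (NLess (NV ''a'') (NAdd (NV ''n'') (NV ''m'')))
    (NStore ''row'' (NAdd (NV ''a'') (NConst 1)) (NAdd (NLoad ''row'' (NV ''a'')) (NV ''n'')))"

lemma nw_Rows [simp]: "nw Rows = {''a'', ''row''}"
  and rw_Rows [simp]: "rw Rows = {}"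
  by (auto simp: Rows_def)

definition Powers :: com where
  "Powers = Seq (RSet ''M'' (RNat (NConst 1))) (Seq (RSet ''G'' (RNat (NConst 1)))
    (For ''a'' (NLess (NV ''a'') (NV ''k''))
      (Seq (RSet ''M'' (RMul (RV ''M'') (RNat (NV ''m''))))
        (RSet ''G'' (RMul (RV ''G'') (RNat (NV ''nb'')))))))"

lemma nw_Powers [simp]: "nw Powers = {''a''}"
  and rw_Powers [simp]: "rw Powers = {''M'', ''G''}"
  by (auto simp: Powers_def)

definition Next :: com where
  "Next = For ''x'' (NLess (NV ''x'') (NV ''n''))
    (Cond (BAnd (NLess (NConst 0) (NLoad ''facility'' (NV ''x'')))
            (BAnd (RLess (RV ''R'') (RLoad ''dist'' (NAdd (NLoad ''row'' (NV ''j'')) (NV ''x''))))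
              (BNot (BAnd (NLess (NConst 0) (NV ''fd''))
                (BNot (RLess (RLoad ''dist'' (NAdd (NLoad ''row'' (NV ''j'')) (NV ''x''))) (RV ''bd'')))))))
      (Seq (RSet ''bd'' (RLoad ''dist'' (NAdd (NLoad ''row'' (NV ''j'')) (NV ''x'')))) (NSet ''fd'' (NConst 1)))
      Skip)"

lemma nw_Next [simp]: "nw Next = {''x'', ''fd''}"
  and rw_Next [simp]: "rw Next = {''bd''}"
  by (auto simp: Next_def)

definition AddBall :: com where
  "AddBall = Seq (RSet ''R'' (RMul (RAdd (RNat (NConst 1)) (RV ''eps'')) (RV ''bd'')))
    (Seq (NStore ''bc'' (NV ''nb'') (NV ''j''))
    (Seq (RStore ''br'' (NV ''nb'') (RV ''R'')) (NInc ''nb'')))"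

lemma nw_AddBall [simp]: "nw AddBall = {''bc'', ''nb''}"
  and rw_AddBall [simp]: "rw AddBall = {''R'', ''br''}"
  by (auto simp: AddBall_def)

text \<open>A new radius is \<open>1 + \<epsilon>\<close> times the smallest facility distance
  beyond the last radius, which \<open>Next\<close> finds. So every ball contains a facility. The
  start \<open>R = - 1\<close>, formed by subtraction, lets distance 0 count as beyond.\<close>

definition ClientBalls :: com where
  "ClientBalls = Seq (RSet ''R'' (RSub (RNat (NConst 0)) (RNat (NConst 1))))
    (Seq (NSet ''fd'' (NConst 1))
    (While (NLess (NConst 0) (NV ''fd''))
      (Seq (NSet ''fd'' (NConst 0)) (Seq Next (Cond (NLess (NConst 0) (NV ''fd'')) AddBall Skip)))))"

lemma nw_ClientBalls [simp]: "nw ClientBalls = {''x'', ''fd'', ''bc'', ''nb''}"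
  and rw_ClientBalls [simp]: "rw ClientBalls = {''R'', ''bd'', ''br''}"
  by (auto simp: ClientBalls_def)

definition Balls :: com where
  "Balls = For ''j'' (NLess (NV ''j'') (NV ''n''))
    (Cond (NLess (NConst 0) (NLoad ''client'' (NV ''j''))) ClientBalls Skip)"

lemma nw_Balls [simp]: "nw Balls = {''j'', ''x'', ''fd'', ''bc'', ''nb''}"
  and rw_Balls [simp]: "rw Balls = {''R'', ''bd'', ''br''}"
  by (auto simp: Balls_def)

definition Add :: "nexp \<Rightarrow> com" where
  "Add e = Cond (BAnd (NLess (NV ''cnt'') (NV ''k''))
      (BAnd (NLess (NConst 0) (NLoad ''facility'' e)) (NLess (NLoad ''mark'' e) (NConst 1))))
    (Seq (NStore ''out'' (NV ''cnt'') e) (Seq (NInc ''cnt'') (NStore ''mark'' e (NConst 1)))) Skip"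

lemma nw_Add [simp]: "nw (Add e) = {''mark'', ''out'', ''cnt''}"
  and rw_Add [simp]: "rw (Add e) = {}"
  by (auto simp: Add_def)

text \<open>Balls may overlap, so the recorded selection may repeat facilities. The marks remove
  repetitions, and the second loop pads the output with further facilities, which can only lower the
  cost.\<close>

definition Finish :: com where
  "Finish = Seq (For ''a'' (NLess (NV ''a'') (NV ''k'')) (Add (NLoad ''sol'' (NV ''a''))))
    (For ''a'' (NLess (NV ''a'') (NV ''n'')) (Add (NV ''a'')))"

lemma nw_Finish [simp]: "nw Finish = {''mark'', ''out'', ''cnt'', ''a''}"
  and rw_Finish [simp]: "rw Finish = {}"
  by (auto simp: Finish_def)

definition KMedian :: com where
  "KMedian = Seq SetColours (Seq Rows (Seq Balls (Seq Powers (Seq Main Finish))))"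

definition ball_time :: "nat \<Rightarrow> nat \<Rightarrow> nat" where
  "ball_time n N = n * ((N + 1) * (5 * n + 9) + 6) + 2"

definition colours :: "real \<Rightarrow> nat" where
  "colours \<epsilon> = (LEAST m. 1 + \<epsilon> \<le> real m * \<epsilon>)"

lemma colours:
  assumes "0 < \<epsilon>"
  shows "1 + \<epsilon> \<le> real (colours \<epsilon>) * \<epsilon>" "0 < colours \<epsilon>"
proof -
  obtain t where "(1 + \<epsilon>) / \<epsilon> \<le> real t" using real_arch_simple by blast
  then have "1 + \<epsilon> \<le> real t * \<epsilon>" using assms by (simp add: pos_divide_le_eq)
  then show "1 + \<epsilon> \<le> real (colours \<epsilon>) * \<epsilon>" unfolding colours_def by (rule LeastI)
  with assms show "0 < colours \<epsilon>" by (cases "colours \<epsilon>") auto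
qed

lemma runs_SetColours:
  assumes "0 < \<epsilon>" "rmem s ''eps'' 0 = \<epsilon>"
  shows "runs SetColours s (2 * colours \<epsilon> + 2) (\<lambda>s'. nmem s' ''m'' 0 = colours \<epsilon>)"
proof -
  have "runs (While (RLess (RMul (RNat (NV ''m'')) (RV ''eps'')) (RAdd (RNat (NConst 1)) (RV ''eps''))) (NInc ''m''))
    (nstore ''m'' 0 1 s) (colours \<epsilon> * (1 + 1) + 1) (\<lambda>s'. nmem s' ''m'' 0 = colours \<epsilon>)"
  proof (rule runs_While[where I = "\<lambda>i s'. nmem s' ''m'' 0 = Suc i \<and> Suc i \<le> colours \<epsilon>"], goal_cases)
    case 1
    show ?case using colours[OF assms(1)] by simp
  next
    case (2 i s')
    have e: "rmem s' ''eps'' 0 = \<epsilon>" using 2(1) assms by (simp add: frame_def)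
    have "real (Suc i) * \<epsilon> < 1 + \<epsilon>" using 2(2,3) e by simp
    then have "Suc i \<noteq> colours \<epsilon>" using colours(1)[OF assms(1)] by (metis not_less)
    with 2 show ?case by simp
  next
    case (3 i s')
    have e: "rmem s' ''eps'' 0 = \<epsilon>" using 3(1) assms by (simp add: frame_def)
    have "colours \<epsilon> \<le> Suc i" unfolding colours_def by (rule Least_le) (use 3 e in \<open>simp add: not_less\<close>)
    with 3 show ?case by simp
  qed
  then show ?thesis unfolding SetColours_def
    by (intro runs_Seq[where U = 1 and W = "colours \<epsilon> * (1 + 1) + 1"]) simp_all
qed

lemma runs_Rows:
  assumes "nmem s ''n'' 0 = n" "nmem s ''m'' 0 = m" "nmem s ''row'' 0 = 0"
  shows "runs Rows s ((n + m) * 3 + 2) (\<lambda>s'. \<forall>i\<le>n + m. nmem s' ''row'' i = i * n)"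
  unfolding Rows_def
proof (rule runs_For[where N = "n + m" and T = 1 and I = "\<lambda>a s'. \<forall>i\<le>a. nmem s' ''row'' i = i * n"],
    goal_cases)
  case (3 s')
  have "nmem s' ''n'' 0 = n" "nmem s' ''m'' 0 = m" using 3 assms by (simp_all add: frame_def)
  then show ?case by simp
next
  case (4 i s')
  have "nmem s' ''n'' 0 = n" using 4(2) assms by (simp add: frame_def)
  with 4 show ?case by (simp add: le_Suc_eq)
qed (use assms in auto)

lemma runs_Powers:
  assumes "nmem s ''k'' 0 = k" "nmem s ''m'' 0 = m" "nmem s ''nb'' 0 = nb"
  shows "runs Powers s (k * 4 + 4) (\<lambda>s'. rmem s' ''M'' 0 = real (m ^ k) \<and> rmem s' ''G'' 0 = real (nb ^ k))"
proof -
  have "runs (For ''a'' (NLess (NV ''a'') (NV ''k''))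
      (Seq (RSet ''M'' (RMul (RV ''M'') (RNat (NV ''m''))))
        (RSet ''G'' (RMul (RV ''G'') (RNat (NV ''nb''))))))
    (rstore ''G'' 0 1 (rstore ''M'' 0 1 s)) (2 + k * 4)
    (\<lambda>s'. rmem s' ''M'' 0 = real (m ^ k) \<and> rmem s' ''G'' 0 = real (nb ^ k))"
  proof (rule runs_For[where N = k and T = 2 and
        I = "\<lambda>a s'. rmem s' ''M'' 0 = real (m ^ a) \<and> rmem s' ''G'' 0 = real (nb ^ a)"], goal_cases)
    case (3 s')
    have "nmem s' ''k'' 0 = k" using 3 assms by (simp add: frame_def)
    then show ?case by simp
  next
    case (4 i s')
    have "nmem s' ''m'' 0 = m" "nmem s' ''nb'' 0 = nb" using 4(2) assms by (simp_all add: frame_def)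
    with 4 show ?case by (simp add: mult.commute)
  qed auto
  then show ?thesis by (simp add: Powers_def add.commute)
qed

section \<open>The geometric list of radii of each client\<close>

context kmedian_nat
begin

lemma base_dist:
  assumes "base \<epsilon> m s" "j < n" "x < n"
  shows "nmem s ''row'' j = j * n" "rmem s ''dist'' (j * n + x) = d j x"
    "nmem s ''facility'' x = (if x \<in> F then 1 else 0)"
  using assms by (simp_all add: base_def)

lemma runs_Next:
  assumes s: "base \<epsilon> m s" and j: "nmem s ''j'' 0 = j" "j < n" and fd: "nmem s ''fd'' 0 = 0"
    and R: "rmem s ''R'' 0 = R"
  shows "runs Next s (n * 5 + 2) (\<lambda>s'.
    if nmem s' ''fd'' 0 = 0 then \<forall>x\<in>F. d j x \<le> R
    else (\<exists>x\<in>F. rmem s' ''bd'' 0 = d j x) \<and> R < rmem s' ''bd'' 0 \<and>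
      (\<forall>x\<in>F. R < d j x \<longrightarrow> rmem s' ''bd'' 0 \<le> d j x))"
  unfolding Next_def
proof (rule runs_For[where N = n and T = 3 and I = "\<lambda>y s'.
    if nmem s' ''fd'' 0 = 0 then \<forall>x\<in>F. x < y \<longrightarrow> d j x \<le> R
    else (\<exists>x\<in>F. rmem s' ''bd'' 0 = d j x) \<and> R < rmem s' ''bd'' 0 \<and>
      (\<forall>x\<in>F. x < y \<longrightarrow> R < d j x \<longrightarrow> rmem s' ''bd'' 0 \<le> d j x)"], goal_cases)
  case (3 s')
  have "nmem s' ''n'' 0 = n" using 3 s by (simp add: frame_def base_def)
  then show ?case by simp
next
  case (4 y s')
  have b: "base \<epsilon> m s'" by (rule base_frame[OF s 4(2)]) simp_all
  note D = base_dist[OF b j(2) 4(1)]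
  have m: "nmem s' ''j'' 0 = j" "rmem s' ''R'' 0 = R" using 4(2) j R by (simp_all add: frame_def)
  show ?case
  proof (cases "y \<in> F \<and> R < d j y \<and> \<not> (0 < nmem s' ''fd'' 0 \<and> \<not> d j y < rmem s' ''bd'' 0)")
    case True
    have "d j y \<le> d j x" if "x \<in> F" "x < Suc y" "R < d j x" for x
    proof (cases "x = y")
      case False
      with that have "x < y" by simp
      with that 4(4) True show ?thesis by (cases "nmem s' ''fd'' 0 = 0") force+
    qed simp
    with True 4(3) show ?thesis by (auto simp: m D)
  next
    case False
    then have "y \<in> F \<Longrightarrow> R < d j y \<Longrightarrow> 0 < nmem s' ''fd'' 0 \<and> rmem s' ''bd'' 0 \<le> d j y" by auto
    with 4(4) have "if nmem s' ''fd'' 0 = 0 then \<forall>x\<in>F. x < Suc y \<longrightarrow> d j x \<le> R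
      else (\<exists>x\<in>F. rmem s' ''bd'' 0 = d j x) \<and> R < rmem s' ''bd'' 0 \<and>
        (\<forall>x\<in>F. x < Suc y \<longrightarrow> R < d j x \<longrightarrow> rmem s' ''bd'' 0 \<le> d j x)"
      by (auto simp: less_Suc_eq not_less[symmetric])
    moreover have "\<not> bval s' (BAnd (NLess (NConst 0) (NLoad ''facility'' (NV ''x'')))
            (BAnd (RLess (RV ''R'') (RLoad ''dist'' (NAdd (NLoad ''row'' (NV ''j'')) (NV ''x''))))
              (BNot (BAnd (NLess (NConst 0) (NV ''fd''))
                (BNot (RLess (RLoad ''dist'' (NAdd (NLoad ''row'' (NV ''j'')) (NV ''x''))) (RV ''bd'')))))))"
      using False 4(3) by (simp add: m D)
    ultimately show ?thesis by (simp only: runs_Cond if_False) simp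
  qed
next
  case (5 s')
  then show ?case using F_less by (auto split: if_splits)
qed (use fd in auto)

definition covered :: "real \<Rightarrow> state \<Rightarrow> nat \<Rightarrow> nat \<Rightarrow> bool" where
  "covered \<epsilon> s j x \<longleftrightarrow> (\<exists>b<nmem s ''nb'' 0. nmem s ''bc'' b = j \<and>
     d j x \<le> rmem s ''br'' b \<and> rmem s ''br'' b \<le> (1 + \<epsilon>) * d j x)"

definition balls_ok :: "state \<Rightarrow> bool" where
  "balls_ok s \<longleftrightarrow> (\<forall>b<nmem s ''nb'' 0. nmem s ''bc'' b \<in> C \<and>
     (\<exists>x\<in>F. d (nmem s ''bc'' b) x \<le> rmem s ''br'' b))"

lemma balls_cong:
  assumes "nmem s' ''nb'' = nmem s ''nb''" "nmem s' ''bc'' = nmem s ''bc''" "rmem s' ''br'' = rmem s ''br''"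
  shows "covered \<epsilon> s' = covered \<epsilon> s" "balls_ok s' = balls_ok s"
  using assms by (simp_all add: covered_def balls_ok_def fun_eq_iff)

text \<open>The values of the radius \<open>R\<close> after \<open>i\<close> rounds for one client, with minimal distance \<open>\<mu>\<close>
  and aspect ratio at most \<open>B\<close>: the first ball may have radius \<open>0\<close>.\<close>

definition radius_ok :: "real \<Rightarrow> real \<Rightarrow> real \<Rightarrow> nat \<Rightarrow> real \<Rightarrow> bool" where
  "radius_ok \<epsilon> \<mu> B i R \<longleftrightarrow>
     (0 < i \<longrightarrow> 0 \<le> R \<and> R \<le> (1 + \<epsilon>) * (\<mu> * B)) \<and> (1 < i \<longrightarrow> \<mu> * (1 + \<epsilon>) ^ (i - 1) \<le> R)"

text \<open>For \<open>i = t + 2\<close> the lower bound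
  \<open>\<mu> * (1 + \<epsilon>) ^ (t + 1)\<close> meets the cap
  \<open>(1 + \<epsilon>) * (\<mu> * B)\<close>, so \<open>(1 + \<epsilon>) ^ t \<le> B\<close>. The
  offset 2 accounts for a first ball of radius 0 and for the factor by which the last radius may
  overshoot the largest distance.\<close>

lemma radius_ok_rounds:
  assumes "radius_ok \<epsilon> \<mu> B i R" "0 < \<mu>" "0 < \<epsilon>" "\<And>t. (1 + \<epsilon>) ^ t \<le> B \<Longrightarrow> t + 2 \<le> N" "2 \<le> N"
  shows "i \<le> N"
proof (cases "i \<le> 1")
  case False
  then obtain t where i: "i = Suc (Suc t)" by (metis One_nat_def not_less_eq_eq not0_implies_Suc less_Suc0 not_le)
  have "\<mu> * (1 + \<epsilon>) ^ Suc t \<le> (1 + \<epsilon>) * (\<mu> * B)" using assms(1) by (simp add: radius_ok_def i)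
  then have "(\<mu> * (1 + \<epsilon>)) * (1 + \<epsilon>) ^ t \<le> (\<mu> * (1 + \<epsilon>)) * B" by (simp add: mult_ac)
  then have "(1 + \<epsilon>) ^ t \<le> B" using assms(2,3) by (subst (asm) mult_le_cancel_left_pos) auto
  then show ?thesis using assms(4) i by simp
qed (use assms in simp)

lemma runs_ClientBalls:
  assumes s: "base \<epsilon> m s" "balls_ok s" and j: "nmem s ''j'' 0 = j" "j \<in> C" and eps: "0 < \<epsilon>"
    and mu: "0 < \<mu>" "\<And>x y. x < n \<Longrightarrow> y < n \<Longrightarrow> x \<noteq> y \<Longrightarrow> \<mu> \<le> d x y" "\<And>x y. x < n \<Longrightarrow> y < n \<Longrightarrow> d x y \<le> \<mu> * B"
    and N: "\<And>t. (1 + \<epsilon>) ^ t \<le> B \<Longrightarrow> t + 2 \<le> N" "2 \<le> N"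
  shows "runs ClientBalls s ((N + 1) * (5 * n + 9) + 3) (\<lambda>s'. balls_ok s' \<and>
    nmem s' ''nb'' 0 \<le> nmem s ''nb'' 0 + N \<and>
    (\<forall>j x. covered \<epsilon> s j x \<longrightarrow> covered \<epsilon> s' j x) \<and> (\<forall>x\<in>F. covered \<epsilon> s' j x))"
proof -
  let ?s = "nstore ''fd'' 0 1 (rstore ''R'' 0 (- 1) s)"
  let ?body = "Seq (NSet ''fd'' (NConst 0)) (Seq Next (Cond (NLess (NConst 0) (NV ''fd'')) AddBall Skip))"
  note jn = C_less[OF j(2)]
  define I where "I = (\<lambda>i s'. balls_ok s' \<and> (\<forall>j x. covered \<epsilon> s j x \<longrightarrow> covered \<epsilon> s' j x) \<and>
    (if nmem s' ''fd'' 0 = 0 then (\<forall>x\<in>F. covered \<epsilon> s' j x) \<and> nmem s' ''nb'' 0 \<le> nmem s ''nb'' 0 + N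
     else nmem s' ''nb'' 0 = nmem s ''nb'' 0 + i \<and> radius_ok \<epsilon> \<mu> B i (rmem s' ''R'' 0) \<and>
       (i = 0 \<longrightarrow> rmem s' ''R'' 0 = - 1) \<and> (\<forall>x\<in>F. d j x \<le> rmem s' ''R'' 0 \<longrightarrow> covered \<epsilon> s' j x)))"
  have "runs (While (NLess (NConst 0) (NV ''fd'')) ?body) ?s ((N + 1) * ((5 * n + 8) + 1) + 1)
    (\<lambda>s'. balls_ok s' \<and> nmem s' ''nb'' 0 \<le> nmem s ''nb'' 0 + N \<and>
      (\<forall>j x. covered \<epsilon> s j x \<longrightarrow> covered \<epsilon> s' j x) \<and> (\<forall>x\<in>F. covered \<epsilon> s' j x))"
  proof (rule runs_While[where I = I], goal_cases)
    case 1
    have "covered \<epsilon> ?s = covered \<epsilon> s" "balls_ok ?s = balls_ok s" by (rule balls_cong; simp)+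
    \<comment> \<open>At the start \<open>R = - 1\<close> lies below all distances, so nothing has
      to be covered yet.\<close>
    moreover have "\<not> d j x \<le> - 1" for x using nonneg[of j x] by linarith
    ultimately show ?case using s(2) by (simp add: I_def radius_ok_def)
  next
    case (2 i s')
    let ?s1 = "nstore ''fd'' 0 0 s'" and ?R = "rmem s' ''R'' 0"
    have fr: "frame ClientBalls s s'" using 2(1) by (auto simp: frame_def)
    have b: "base \<epsilon> m s'" by (rule base_frame[OF s(1) fr]) simp_all
    have b1: "base \<epsilon> m ?s1" by (rule base_frame[OF b, of "NSet ''fd'' (NConst 0)"]) (simp_all add: frame_def)
    have j1: "nmem ?s1 ''j'' 0 = j" using fr j by (simp add: frame_def)
    have I: "balls_ok s'" "\<And>j x. covered \<epsilon> s j x \<Longrightarrow> covered \<epsilon> s' j x"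
      "nmem s' ''nb'' 0 = nmem s ''nb'' 0 + i" "radius_ok \<epsilon> \<mu> B i ?R" "i = 0 \<longrightarrow> ?R = - 1"
      "\<And>x. x \<in> F \<Longrightarrow> d j x \<le> ?R \<Longrightarrow> covered \<epsilon> s' j x"
      using 2(2,3) by (simp_all add: I_def)
    \<comment> \<open>At most \<open>N\<close> balls have been listed when a round begins, so
      \<open>N + 1\<close> rounds suffice, including the one that finds no further facility.\<close>
    have iN: "i \<le> N" by (rule radius_ok_rounds[OF I(4) mu(1) eps N])
    have "runs (Seq Next (Cond (NLess (NConst 0) (NV ''fd'')) AddBall Skip)) ?s1 (7 + n * 5) (I (Suc i))"
    proof (rule runs_seq[where W = 5, OF runs_Next[OF b1 j1 jn, where R = ?R]], simp, simp, simp, goal_cases)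
      case (1 s2)
      have m: "nmem s2 ''nb'' = nmem s' ''nb''" "nmem s2 ''bc'' = nmem s' ''bc''" "rmem s2 ''br'' = rmem s' ''br''"
        "rmem s2 ''R'' = rmem s' ''R''" "nmem s2 ''j'' 0 = j" "rmem s2 ''eps'' 0 = \<epsilon>"
        using 1(1) j1 b by (simp_all add: frame_def base_def)
      note eq = balls_cong[OF m(1,2,3)]
      show ?case
      proof (cases "nmem s2 ''fd'' 0 = 0")
        case True
        then have "\<forall>x\<in>F. d j x \<le> ?R" using 1(2) by simp
        with True I iN have "I (Suc i) s2" by (simp add: I_def eq m)
        with True show ?thesis by simp
      next
        case False
        let ?bd = "rmem s2 ''bd'' 0" and ?nb = "nmem s' ''nb'' 0"
        obtain x0 where x0: "x0 \<in> F" "?bd = d j x0" and bd: "?R < ?bd"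
          "\<And>x. x \<in> F \<Longrightarrow> ?R < d j x \<Longrightarrow> ?bd \<le> d j x"
          using 1(2) False by auto
        have bd0: "0 \<le> ?bd" using x0 by simp
        define s3 where "s3 = nstore ''nb'' 0 (Suc ?nb) (rstore ''br'' ?nb ((1 + \<epsilon>) * ?bd)
          (nstore ''bc'' ?nb j (rstore ''R'' 0 ((1 + \<epsilon>) * ?bd) s2)))"
        have m3: "nmem s3 ''nb'' 0 = Suc ?nb" "nmem s3 ''bc'' = (nmem s' ''bc'')(?nb := j)"
          "rmem s3 ''br'' = (rmem s' ''br'')(?nb := (1 + \<epsilon>) * ?bd)" "rmem s3 ''R'' 0 = (1 + \<epsilon>) * ?bd"
          "nmem s3 ''fd'' 0 \<noteq> 0"
          using False by (simp_all add: s3_def m)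
        have le: "?bd \<le> (1 + \<epsilon>) * ?bd" using bd0 eps by (simp add: algebra_simps)
        have mono: "covered \<epsilon> s3 l x" if "covered \<epsilon> s' l x" for l x
        proof -
          from that obtain b where "b < ?nb" "nmem s' ''bc'' b = l" "d l x \<le> rmem s' ''br'' b"
            "rmem s' ''br'' b \<le> (1 + \<epsilon>) * d l x" unfolding covered_def by blast
          then show ?thesis unfolding covered_def m3 by (intro exI[of _ b]) simp
        qed
        \<comment> \<open>A facility newly reached has distance at least \<open>?bd\<close>, the
          smallest beyond the old radius, so the new radius exceeds its distance by at most the
          factor \<open>1 + \<epsilon>\<close>.\<close>
        have cov: "covered \<epsilon> s3 j x" if "x \<in> F" "d j x \<le> (1 + \<epsilon>) * ?bd" for x
        proof (cases "d j x \<le> ?R")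
          case True
          with I(6) that mono show ?thesis by blast
        next
          case False
          then have "(1 + \<epsilon>) * ?bd \<le> (1 + \<epsilon>) * d j x"
            using bd(2) that eps by (intro mult_left_mono) auto
          then show ?thesis unfolding covered_def m3 using that by (intro exI[of _ ?nb]) simp
        qed
        have ok: "balls_ok s3"
          using I(1) j(2) x0 le unfolding balls_ok_def m3(1) by (auto simp: m3(2,3) less_Suc_eq)
        have "radius_ok \<epsilon> \<mu> B (Suc i) ((1 + \<epsilon>) * ?bd)"
          unfolding radius_ok_def
        proof (intro conjI impI)
          show "0 \<le> (1 + \<epsilon>) * ?bd" using bd0 eps by simp
          show "(1 + \<epsilon>) * ?bd \<le> (1 + \<epsilon>) * (\<mu> * B)"
            using mu(3)[OF jn F_less[OF x0(1)]] x0(2) eps by (intro mult_left_mono) auto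
          assume "1 < Suc i"
          then have i: "0 < i" by simp
          then have "0 \<le> ?R" using I(4) by (simp add: radius_ok_def)
          \<comment> \<open>After the first ball the radius is nonnegative, so the next distance is
            positive and thus at least \<open>\<mu>\<close>. Later the previous radius already has
            this size.\<close>
          have "\<mu> * (1 + \<epsilon>) ^ (i - 1) \<le> ?bd"
          proof (cases "i = 1")
            case True
            have "0 < d j x0" using \<open>0 \<le> ?R\<close> bd(1) x0(2) by simp
            then have "j \<noteq> x0" using jn mdist_zero by force
            with True mu(2)[OF jn F_less[OF x0(1)]] x0(2) show ?thesis by simp
          next
            case False
            with i I(4) bd(1) show ?thesis by (simp add: radius_ok_def)
          qed
          then have "(1 + \<epsilon>) * (\<mu> * (1 + \<epsilon>) ^ (i - 1)) \<le> (1 + \<epsilon>) * ?bd"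
            using eps by (intro mult_left_mono) auto
          moreover have "(1 + \<epsilon>) ^ i = (1 + \<epsilon>) * (1 + \<epsilon>) ^ (i - 1)"
            using i by (cases i) auto
          ultimately show "\<mu> * (1 + \<epsilon>) ^ (Suc i - 1) \<le> (1 + \<epsilon>) * ?bd" by (simp add: mult_ac)
        qed
        then have "I (Suc i) s3"
          unfolding I_def using m3 ok mono cov I(2,3) by simp
        moreover have "runs AddBall s2 4 (\<lambda>s'. s' = s3)"
          by (simp add: AddBall_def m s3_def)
        ultimately have "runs AddBall s2 4 (I (Suc i))" by (blast intro: runs_mono)
        with False show ?thesis by simp
      qed
    qed
    then have "runs ?body s' (5 * n + 8) (I (Suc i))" by (simp add: mult.commute)
    with iN show ?case by simp
  next
    case (3 i s')
    then show ?case by (simp add: I_def)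
  qed
  from runs_mono[OF this[simplified]] show ?thesis by (simp add: ClientBalls_def)
qed

lemma runs_Balls:
  assumes s: "base \<epsilon> m s" "nmem s ''nb'' 0 = 0" and eps: "0 < \<epsilon>"
    and mu: "0 < \<mu>" "\<And>x y. x < n \<Longrightarrow> y < n \<Longrightarrow> x \<noteq> y \<Longrightarrow> \<mu> \<le> d x y" "\<And>x y. x < n \<Longrightarrow> y < n \<Longrightarrow> d x y \<le> \<mu> * B"
    and N: "\<And>t. (1 + \<epsilon>) ^ t \<le> B \<Longrightarrow> t + 2 \<le> N" "2 \<le> N"
  shows "runs Balls s (ball_time n N) (\<lambda>s'. nmem s' ''nb'' 0 \<le> card C * N \<and>
    covering \<epsilon> (nmem s' ''nb'' 0) (nmem s' ''bc'') (rmem s' ''br''))"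
  unfolding Balls_def
proof (rule runs_For[where N = n and T = "(N + 1) * (5 * n + 9) + 4" and I = "\<lambda>j s'. balls_ok s' \<and>
    nmem s' ''nb'' 0 \<le> card (C \<inter> {..<j}) * N \<and> (\<forall>j'\<in>C \<inter> {..<j}. \<forall>x\<in>F. covered \<epsilon> s' j' x)"],
    goal_cases)
  case 2
  show ?case using s(2) by (simp add: balls_ok_def)
next
  case (3 s')
  have "nmem s' ''n'' 0 = n" using 3 s by (simp add: frame_def base_def)
  then show ?case by simp
next
  case (4 j s')
  have fr: "frame Balls s s'" using 4(2) by (simp add: Balls_def)
  have b: "base \<epsilon> m s'" by (rule base_frame[OF s(1) fr]) simp_all
  have eq: "balls_ok (nstore ''j'' 0 (Suc j) s2) = balls_ok s2"
    "covered \<epsilon> (nstore ''j'' 0 (Suc j) s2) = covered \<epsilon> s2" for s2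
    by (rule balls_cong; simp)+
  have cl: "nmem s' ''client'' j = (if j \<in> C then 1 else 0)" using b by (simp add: base_def)
  show ?case
  proof (cases "j \<in> C")
    case True
    have ins: "C \<inter> {..<Suc j} = insert j (C \<inter> {..<j})" using True by auto
    have card: "card (C \<inter> {..<Suc j}) = Suc (card (C \<inter> {..<j}))" by (simp add: ins)
    have "runs ClientBalls s' ((N + 1) * (5 * n + 9) + 3) (\<lambda>s''.
      let s' = nstore ''j'' 0 (Suc j) s'' in balls_ok s' \<and>
      nmem s' ''nb'' 0 \<le> card (C \<inter> {..<Suc j}) * N \<and> (\<forall>j'\<in>C \<inter> {..<Suc j}. \<forall>x\<in>F. covered \<epsilon> s' j' x))"
    proof (rule runs_mono[OF runs_ClientBalls[OF b _ 4(3) True eps mu N] order.refl])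
      show "balls_ok s'" using 4(4) by blast
      fix s'' assume "balls_ok s'' \<and> nmem s'' ''nb'' 0 \<le> nmem s' ''nb'' 0 + N \<and>
        (\<forall>j x. covered \<epsilon> s' j x \<longrightarrow> covered \<epsilon> s'' j x) \<and> (\<forall>x\<in>F. covered \<epsilon> s'' j x)"
      then show "let s' = nstore ''j'' 0 (Suc j) s'' in balls_ok s' \<and>
        nmem s' ''nb'' 0 \<le> card (C \<inter> {..<Suc j}) * N \<and> (\<forall>j'\<in>C \<inter> {..<Suc j}. \<forall>x\<in>F. covered \<epsilon> s' j' x)"
        using 4(4) unfolding Let_def eq ins card by auto
    qed
    with True cl 4(3) show ?thesis by (simp add: Let_def numeral_eq_Suc)
  next
    case False
    then have "C \<inter> {..<Suc j} = C \<inter> {..<j}" by (auto simp: less_Suc_eq)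
    with False cl 4(3,4) eq show ?thesis by simp
  qed
next
  case (5 s')
  have "C \<inter> {..<n} = C" using clients by auto
  with 5 show ?case by (auto simp: covering_def balls_ok_def covered_def)
qed (simp_all add: ball_time_def)

section \<open>Completion to exactly k facilities\<close>

definition out_ok :: "state \<Rightarrow> bool" where
  "out_ok s \<longleftrightarrow> nmem s ''cnt'' 0 \<le> k \<and> card {y. nmem s ''mark'' y \<noteq> 0} = nmem s ''cnt'' 0 \<and>
     {y. nmem s ''mark'' y \<noteq> 0} \<subseteq> F \<and> nmem s ''out'' ` {..<nmem s ''cnt'' 0} = {y. nmem s ''mark'' y \<noteq> 0}"

text \<open>The address \<open>e\<close> is evaluated again after the stores to \<open>out\<close>
  and \<open>cnt\<close>; the assumptions on \<open>e\<close> say that it still denotes the same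
  facility.\<close>

lemma runs_Add:
  assumes s: "base \<epsilon> m s" "out_ok s"
    and e: "\<And>i v w. nval (nstore ''cnt'' 0 w (nstore ''out'' i v s)) e = nval s e"
      "\<And>i v. nval (nstore ''out'' i v s) e = nval s e"
  shows "runs (Add e) s 4 (\<lambda>s'. out_ok s' \<and> nmem s' ''cnt'' 0 \<le> Suc (nmem s ''cnt'' 0) \<and>
    {y. nmem s ''mark'' y \<noteq> 0} \<subseteq> {y. nmem s' ''mark'' y \<noteq> 0} \<and>
    (nmem s ''cnt'' 0 < k \<longrightarrow> nval s e \<in> F \<longrightarrow> nmem s' ''mark'' (nval s e) \<noteq> 0) \<and>
    (nmem s ''cnt'' 0 = k \<longrightarrow> nmem s' ''cnt'' 0 = k))"
proof -
  let ?y = "nval s e" and ?c = "nmem s ''cnt'' 0" and ?X = "{y. nmem s ''mark'' y \<noteq> 0}"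
  have m: "nmem s ''k'' 0 = k" "nmem s ''facility'' ?y = (if ?y \<in> F then 1 else 0)"
    using s(1) by (simp_all add: base_def)
  have X: "?c \<le> k" "card ?X = ?c" "?X \<subseteq> F" "nmem s ''out'' ` {..<?c} = ?X"
    using s(2) by (simp_all add: out_ok_def)
  show ?thesis
  proof (cases "?c < k \<and> ?y \<in> F \<and> nmem s ''mark'' ?y = 0")
    case True
    define s' where "s' = nstore ''mark'' ?y 1 (nstore ''cnt'' 0 (Suc ?c) (nstore ''out'' ?c ?y s))"
    have "runs (Add e) s 4 (\<lambda>x. x = s')"
      using True by (simp add: Add_def m e s'_def)
    moreover have X': "{y. nmem s' ''mark'' y \<noteq> 0} = insert ?y ?X" by (auto simp: s'_def)
    moreover have "finite ?X" using X(3) finite_F finite_subset by blast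
    then have "card (insert ?y ?X) = Suc ?c" using True X(2) by simp
    moreover have "nmem s' ''out'' ` {..<Suc ?c} = insert ?y ?X"
    proof -
      have "{..<?c} \<inter> {x. x \<noteq> ?c} = {..<?c}" by auto
      then show ?thesis using X(4) by (simp add: s'_def lessThan_Suc)
    qed
    moreover have "nmem s' ''cnt'' 0 = Suc ?c" "nmem s' ''mark'' ?y \<noteq> 0" by (simp_all add: s'_def)
    ultimately have "out_ok s'" "runs (Add e) s 4 (\<lambda>x. x = s')" and fin: "nmem s' ''cnt'' 0 = Suc ?c"
      "nmem s' ''mark'' ?y \<noteq> 0" "?X \<subseteq> {y. nmem s' ''mark'' y \<noteq> 0}"
      using True X by (simp_all only: out_ok_def) auto
    then show ?thesis using True by (auto elim!: runs_mono)
  next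
    case False
    have "runs (Add e) s 4 (\<lambda>x. x = s)"
      using False by (auto simp: Add_def m)
    then show ?thesis by (rule runs_mono[OF _ order.refl]) (use False s X in auto)
  qed
qed

lemma runs_Finish:
  assumes s: "base \<epsilon> m s" and zero: "nmem s ''cnt'' 0 = 0" "nmem s ''mark'' = (\<lambda>_. 0)"
  shows "runs Finish s (k * 6 + n * 6 + 4) (\<lambda>s'. kmedian_output k s' \<in> feasible F k \<and>
    (\<forall>i<k. nmem s ''sol'' i \<in> F \<longrightarrow> nmem s ''sol'' i \<in> kmedian_output k s'))"
proof -
  let ?X = "\<lambda>s. {y. nmem s ''mark'' y \<noteq> 0}"
  have 1: "runs (For ''a'' (NLess (NV ''a'') (NV ''k'')) (Add (NLoad ''sol'' (NV ''a'')))) s (k * 6 + 2)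
    (\<lambda>s'. out_ok s' \<and> (\<forall>i<k. nmem s ''sol'' i \<in> F \<longrightarrow> nmem s ''sol'' i \<in> ?X s'))"
  \<comment> \<open>The bound \<open>cnt \<le> a\<close> leaves room in each of the \<open>k\<close>
    rounds, so no facility of the recorded selection is turned away.\<close>
  proof (rule runs_For[where N = k and T = 4 and I = "\<lambda>a s'. out_ok s' \<and> nmem s' ''cnt'' 0 \<le> a \<and>
        (\<forall>i<a. nmem s ''sol'' i \<in> F \<longrightarrow> nmem s ''sol'' i \<in> ?X s')"], goal_cases)
    case 2
    show ?case using zero by (simp add: out_ok_def)
  next
    case (3 s')
    have "nmem s' ''k'' 0 = k" using 3 s by (simp add: frame_def base_def)
    then show ?case by simp
  next
    case (4 a s')
    have b: "base \<epsilon> m s'" by (rule base_frame[OF s 4(2)]) simp_all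
    have sol: "nmem s' ''sol'' = nmem s ''sol''" using 4(2) by (simp add: frame_def)
    show ?case
      by (rule runs_mono[OF runs_Add[OF b]]) (use 4 sol in \<open>auto simp: less_Suc_eq out_ok_def\<close>)
  qed auto
  show ?thesis unfolding Finish_def
  proof (rule runs_seq[OF 1, where W = "n * 6 + 2"], simp, goal_cases)
    case (1 s1)
    have b1: "base \<epsilon> m s1" by (rule base_frame[OF s 1(1)]) simp_all
    show ?case
    proof (rule runs_For[where N = n and T = 4 and I = "\<lambda>a s'. out_ok s' \<and> ?X s1 \<subseteq> ?X s' \<and>
          (nmem s' ''cnt'' 0 = k \<or> (\<forall>y\<in>F. y < a \<longrightarrow> y \<in> ?X s'))"], goal_cases)
      case 2
      show ?case using 1(2) by (simp add: out_ok_def)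
    next
      case (3 s')
      have "nmem s' ''n'' 0 = n" using 3 b1 by (simp add: frame_def base_def)
      then show ?case by simp
    next
      case (4 a s')
      have b: "base \<epsilon> m s'" by (rule base_frame[OF b1 4(2)]) simp_all
      have le: "nmem s' ''cnt'' 0 \<le> k" using 4(4) by (simp add: out_ok_def)
      show ?case
      proof (rule runs_mono[OF runs_Add[OF b]], simp add: 4(4), simp, simp, simp, goal_cases)
        case (1 s2)
        have "out_ok (nstore ''a'' 0 (Suc a) s2) = out_ok s2" by (simp add: out_ok_def)
        with 1 4(3,4) le show ?case by (auto simp: less_Suc_eq)
      qed
    next
      case (5 s')
      have ok: "nmem s' ''cnt'' 0 \<le> k" "card (?X s') = nmem s' ''cnt'' 0" "?X s' \<subseteq> F"
        "nmem s' ''out'' ` {..<nmem s' ''cnt'' 0} = ?X s'"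
        using 5(2) by (simp_all add: out_ok_def)
      \<comment> \<open>If fewer than \<open>k\<close> were marked, the second loop would have
        marked all of \<open>F\<close>, against \<open>k \<le> card F\<close>.\<close>
      have "nmem s' ''cnt'' 0 = k"
      proof (rule ccontr)
        assume ne: "nmem s' ''cnt'' 0 \<noteq> k"
        with 5(2) F_less have "F \<subseteq> ?X s'" by blast
        moreover have "finite (?X s')" using ok(3) finite_F finite_subset by blast
        ultimately have "card F \<le> card (?X s')" by (rule card_mono[rotated])
        with ok ne k_bounds show False by simp
      qed
      with ok have "kmedian_output k s' = ?X s'" "?X s' \<in> feasible F k"
        by (simp_all add: kmedian_output_def feasible_def)
      with 5(2) 1(2) show ?case by auto
    qed auto
  qed
qed

end

section \<open>Running time\<close>

text \<open>All time bounds are polynomials with nonnegative coefficients. Raising every monomial to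
  the top degree in \<open>n\<close> bounds them by their value at \<open>n = 1\<close> times that
  power; the value at 1 becomes the factor \<open>f k \<epsilon>\<close>.\<close>

lemma cost_time_scale: "1 \<le> n \<Longrightarrow> cost_time n k \<le> cost_time 1 k * n"
  by (simp add: cost_time_def algebra_simps)

lemma total_time_scale:
  assumes "1 \<le> n"
  shows "total_time n k M \<le> total_time 1 k M * n"
proof -
  have "total_time n k M \<le> M * (decode_time k M * n + cost_time 1 k * n + 3 * n) + 3 * n"
    unfolding total_time_def using assms cost_time_scale[OF assms] by (intro add_mono mult_le_mono) auto
  also have "\<dots> = total_time 1 k M * n" by (simp add: total_time_def algebra_simps)
  finally show ?thesis .
qed

lemma pick_time_scale:
  assumes "1 \<le> n"
  shows "pick_time n k M \<le> pick_time 1 k M * n ^ 2"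
proof -
  have "pick_time n k M \<le> n * (total_time 1 k M * n + 8 * n) + 4 * n ^ 2"
    unfolding pick_time_def using assms total_time_scale[OF assms] by (intro add_mono mult_le_mono) auto
  also have "\<dots> = pick_time 1 k M * n ^ 2" by (simp add: pick_time_def algebra_simps power2_eq_square)
  finally show ?thesis .
qed

lemma fill_time_scale:
  assumes "1 \<le> n"
  shows "fill_time n k m M \<le> fill_time 1 k m M * n ^ 2"
proof -
  have "fill_time n k m M \<le> m * (k * (pick_time 1 k M * n ^ 2 + 2 * n ^ 2) + 4 * n ^ 2) + 2 * n ^ 2"
    unfolding fill_time_def using assms pick_time_scale[OF assms] by (intro add_mono mult_le_mono) auto
  also have "\<dots> = fill_time 1 k m M * n ^ 2" by (simp add: fill_time_def algebra_simps)
  finally show ?thesis .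
qed

lemma scan_time_scale:
  assumes "1 \<le> n"
  shows "scan_time n k M \<le> scan_time 1 k M * n"
proof -
  have "scan_time n k M \<le> M * (decode_time k M * n + cost_time 1 k * n + 3 * (k * n) + 7 * n) + 2 * n"
    unfolding scan_time_def using assms cost_time_scale[OF assms] by (intro add_mono mult_le_mono) auto
  also have "\<dots> = scan_time 1 k M * n" by (simp add: scan_time_def algebra_simps)
  finally show ?thesis .
qed

lemma decode_time_mono: "x \<le> y \<Longrightarrow> decode_time k x \<le> decode_time k y"
  by (simp add: decode_time_def)

lemma main_time_mono: "G \<le> G' \<Longrightarrow> main_time n k m M G \<le> main_time n k m M G'"
  unfolding main_time_def by (intro add_mono mult_le_mono decode_time_mono) auto

text \<open>One factor \<open>n\<close> comes from the number of guesses, the other two from the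
  work per guess, including the decoding of the guess.\<close>

lemma main_time_scale:
  assumes "1 \<le> n" "G \<le> H * n"
  shows "main_time n k m M G \<le> main_time 1 k m M H * n ^ 3"
proof -
  have "decode_time k (H * n) \<le> k * (3 * (H * n) + 6 * n) + 3 * n"
    unfolding decode_time_def using assms(1) by (intro add_mono mult_le_mono) auto
  also have "\<dots> = decode_time k H * n" by (simp add: decode_time_def algebra_simps)
  also have "\<dots> \<le> decode_time k H * n ^ 2" using assms(1) by (simp add: power2_eq_square)
  finally have dec: "decode_time k (H * n) \<le> decode_time k H * n ^ 2" .
  have "scan_time n k M \<le> scan_time 1 k M * n" by (rule scan_time_scale[OF assms(1)])
  also have "\<dots> \<le> scan_time 1 k M * n ^ 2" using assms(1) by (simp add: power2_eq_square)
  finally have scan: "scan_time n k M \<le> scan_time 1 k M * n ^ 2" .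
  have rst: "m * n * 3 + 2 \<le> (m * 1 * 3 + 2) * n ^ 2"
  proof -
    have "m * n * 3 + 2 \<le> m * n ^ 2 * 3 + 2 * n ^ 2"
      using assms(1) by (intro add_mono mult_le_mono) (auto simp: power2_eq_square)
    then show ?thesis by (simp add: algebra_simps)
  qed
  have "main_time n k m M G \<le> main_time n k m M (H * n)" by (rule main_time_mono[OF assms(2)])
  also have "\<dots> \<le> (H * n) * (decode_time k H * n ^ 2 + (m * 1 * 3 + 2) * n ^ 2 +
      fill_time 1 k m M * n ^ 2 + scan_time 1 k M * n ^ 2 + 2 * n ^ 2) + 2 * n ^ 3"
    unfolding main_time_def using assms(1) fill_time_scale[OF assms(1)] dec scan rst
    by (intro add_mono mult_le_mono) auto
  also have "\<dots> = main_time 1 k m M H * n ^ 3"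
    by (simp add: main_time_def algebra_simps power2_eq_square power3_eq_cube)
  finally show ?thesis .
qed

lemma ball_time_scale:
  assumes "1 \<le> n" "N \<le> L * n"
  shows "ball_time n N \<le> ball_time 1 L * n ^ 3"
proof -
  have "ball_time n N \<le> n * ((L * n + 1 * n) * (5 * n + 9 * n) + 6 * n ^ 2) + 2 * n ^ 3"
    unfolding ball_time_def using assms by (intro add_mono mult_le_mono) auto
  also have "\<dots> = ball_time 1 L * n ^ 3"
    by (simp add: ball_time_def algebra_simps power2_eq_square power3_eq_cube)
  finally show ?thesis .
qed

definition full_time :: "nat \<Rightarrow> nat \<Rightarrow> nat \<Rightarrow> nat \<Rightarrow> nat \<Rightarrow> nat" where
  "full_time n k m N G = (2 * m + 2) + (((n + m) * 3 + 2) + (ball_time n N + ((k * 4 + 4) +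
     (main_time n k m (m ^ k) G + (k * 6 + n * 6 + 4)))))"

lemma full_time_scale:
  assumes "1 \<le> n" "N \<le> L * n" "G \<le> H * n"
  shows "full_time n k m N G \<le> full_time 1 k m L H * n ^ 3"
proof -
  have n: "x \<le> x * n ^ 3" "n \<le> n ^ 3" for x using assms(1) by (auto simp: self_le_power)
  have "full_time n k m N G \<le> (2 * m + 2) * n ^ 3 + (((n ^ 3 + m * n ^ 3) * 3 + 2 * n ^ 3) +
      (ball_time 1 L * n ^ 3 + ((k * 4 + 4) * n ^ 3 +
        (main_time 1 k m (m ^ k) H * n ^ 3 + (k * 6 * n ^ 3 + n ^ 3 * 6 + 4 * n ^ 3)))))"
    unfolding full_time_def
    by (intro add_mono mult_le_mono order.refl n ball_time_scale main_time_scale assms)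
  also have "\<dots> = full_time 1 k m L H * n ^ 3" by (simp add: full_time_def algebra_simps)
  finally show ?thesis .
qed

text \<open>The \<open>j\<close>-th power of \<open>x / j \<le> exp (x / j)\<close>. At
  \<open>x = 1 + ln n\<close> it trades a power of the logarithm for a constant times
  \<open>n\<close>.\<close>

lemma power_le_exp:
  fixes x :: real
  assumes "0 \<le> x" "0 < j"
  shows "x ^ j \<le> real j ^ j * exp x"
proof -
  have "x / real j \<le> exp (x / real j)" using exp_ge_add_one_self[of "x / real j"] by linarith
  then have "(x / real j) ^ j \<le> exp (x / real j) ^ j"
    using assms by (intro power_mono) auto
  also have "\<dots> = exp x" using assms by (simp add: exp_of_nat_mult[symmetric])
  finally show ?thesis using assms by (simp add: power_divide divide_le_eq mult.commute)
qed

text \<open>The logarithm of \<open>n ^ A\<close> to base \<open>1 + \<epsilon>\<close>, rounded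
  down, plus the offset 2 of \<open>radius_ok_rounds\<close>.\<close>

definition round_bound :: "nat \<Rightarrow> real \<Rightarrow> nat \<Rightarrow> nat" where
  "round_bound A \<epsilon> n = nat \<lfloor>real A * ln (real n) / ln (1 + \<epsilon>)\<rfloor> + 2"

lemma round_bound_real:
  assumes "0 < \<epsilon>" "1 \<le> n"
  shows "real (round_bound A \<epsilon> n) \<le> real A / ln (1 + \<epsilon>) * ln (real n) + 2"
proof -
  have "0 \<le> real A * ln (real n) / ln (1 + \<epsilon>)" using assms by simp
  then show ?thesis by (simp add: round_bound_def of_nat_nat)
qed

lemma round_bound:
  assumes "0 < \<epsilon>" "1 \<le> n" "(1 + \<epsilon>) ^ t \<le> real n ^ A"
  shows "t + 2 \<le> round_bound A \<epsilon> n"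
proof -
  have "ln ((1 + \<epsilon>) ^ t) \<le> ln (real n ^ A)" using assms by (intro ln_mono) auto
  then have "real t * ln (1 + \<epsilon>) \<le> real A * ln (real n)"
    using assms by (simp add: ln_realpow)
  then have "real t \<le> real A * ln (real n) / ln (1 + \<epsilon>)"
    using assms by (simp add: pos_le_divide_eq)
  then have "int t \<le> \<lfloor>real A * ln (real n) / ln (1 + \<epsilon>)\<rfloor>" by (simp add: le_floor_iff)
  then show ?thesis by (simp add: round_bound_def)
qed

definition round_coeff :: "nat \<Rightarrow> real \<Rightarrow> nat" where
  "round_coeff A \<epsilon> = nat \<lceil>real A / ln (1 + \<epsilon>) + 2\<rceil>"

lemma round_bound_le:
  assumes "0 < \<epsilon>" "1 \<le> n"
  shows "round_bound A \<epsilon> n \<le> round_coeff A \<epsilon> * n"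
proof -
  have "0 \<le> real A / ln (1 + \<epsilon>)" using assms by simp
  have "real (round_bound A \<epsilon> n) \<le> real A / ln (1 + \<epsilon>) * ln (real n) + 2"
    by (rule round_bound_real[OF assms])
  also have "\<dots> \<le> real A / ln (1 + \<epsilon>) * real n + 2 * real n"
    using assms \<open>0 \<le> real A / ln (1 + \<epsilon>)\<close> ln_bound[of "real n"] by (intro add_mono mult_left_mono) auto
  also have "\<dots> \<le> real (round_coeff A \<epsilon>) * real n"
    unfolding distrib_right[symmetric] round_coeff_def by (intro mult_right_mono real_nat_ceiling_ge) simp
  finally show ?thesis by (metis of_nat_le_iff of_nat_mult)
qed

text \<open>The last factor is \<open>power_le_exp\<close> with \<open>j = 2 * k\<close> and
  \<open>x = 1 + ln n\<close>, where \<open>exp x = exp 1 * n\<close>. Using \<open>1 + ln n\<close>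
  instead of \<open>ln n\<close> absorbs the additive 2 in the number of radii.\<close>

definition guess_coeff :: "real \<Rightarrow> nat \<Rightarrow> real \<Rightarrow> nat \<Rightarrow> nat" where
  "guess_coeff c A \<epsilon> k = nat \<lceil>(c / \<epsilon>\<^sup>2 * real k * (real A / ln (1 + \<epsilon>) + 2)) ^ k
     * (real (2 * k) ^ (2 * k) * exp 1)\<rceil>"

text \<open>With \<open>O(log n)\<close> clients and radii each, \<open>(log n)\<^sup>2\<^sup>k\<close> is at most \<open>(2k)\<^sup>2\<^sup>k n\<close>.\<close>

lemma guesses_le:
  assumes "0 < \<epsilon>" "1 \<le> n" "0 < k" "0 < c" "real M \<le> c / \<epsilon>\<^sup>2 * real k * ln (real n)"
  shows "(M * round_bound A \<epsilon> n) ^ k \<le> guess_coeff c A \<epsilon> k * n"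
proof -
  let ?x = "1 + ln (real n)" and ?a = "c / \<epsilon>\<^sup>2 * real k" and ?b = "real A / ln (1 + \<epsilon>) + 2"
  have ln: "0 \<le> ln (real n)" using assms by simp
  have ab: "0 \<le> ?a" "0 \<le> real A / ln (1 + \<epsilon>)" using assms by simp_all
  have "real M \<le> ?a * ?x" using assms(5) ab by (simp add: distrib_left)
  moreover have "real (round_bound A \<epsilon> n) \<le> ?b * ?x"
  proof -
    have "a * l + 2 \<le> (a + 2) * (1 + l)" if "0 \<le> a" "0 \<le> l" for a l :: real
      using that by (simp add: algebra_simps)
    from this[OF ab(2) ln] round_bound_real[OF assms(1,2), of A] show ?thesis by linarith
  qed
  ultimately have "real (M * round_bound A \<epsilon> n) \<le> (?a * ?x) * (?b * ?x)"
    unfolding of_nat_mult by (intro mult_mono) (use ab ln in auto)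
  then have "real (M * round_bound A \<epsilon> n) ^ k \<le> ((?a * ?b) * ?x ^ 2) ^ k"
    by (intro power_mono) (simp_all add: power2_eq_square mult_ac)
  also have "\<dots> = (?a * ?b) ^ k * ?x ^ (2 * k)" by (subst power_mult_distrib) (simp only: power_mult)
  also have "\<dots> \<le> (?a * ?b) ^ k * (real (2 * k) ^ (2 * k) * exp ?x)"
    by (intro mult_left_mono power_le_exp zero_le_power) (use ab ln assms in auto)
  also have "exp ?x = exp 1 * real n" using assms by (simp add: exp_add)
  also have "(?a * ?b) ^ k * (real (2 * k) ^ (2 * k) * (exp 1 * real n)) =
      ((?a * ?b) ^ k * (real (2 * k) ^ (2 * k) * exp 1)) * real n" by simp
  also have "\<dots> \<le> real (guess_coeff c A \<epsilon> k) * real n"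
    unfolding guess_coeff_def by (intro mult_right_mono real_nat_ceiling_ge) simp
  finally have "real ((M * round_bound A \<epsilon> n) ^ k) \<le> real (guess_coeff c A \<epsilon> k * n)" by simp
  then show ?thesis by (simp only: of_nat_le_iff)
qed

section \<open>The theorem\<close>

context kmedian_nat
begin

lemma output_approx:
  assumes eps: "0 < \<epsilon>" and m: "1 + \<epsilon> \<le> real m * \<epsilon>" and cov: "covering \<epsilon> nb bc br"
    and best: "best_ok s" and all: "\<forall>L\<in>{..<k} \<rightarrow>\<^sub>E {..<nb}. \<exists>T. guess_greedy m bc br L m 0 T \<and>
      (\<forall>c\<in>{..<k} \<rightarrow>\<^sub>E {..<m}. upto s (guess_cost bc br L (\<lambda>i. T (c i) i)))"
    and S: "S \<in> feasible F k" "\<forall>i<k. nmem s ''sol'' i \<in> F \<longrightarrow> nmem s ''sol'' i \<in> S"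
  shows "approx_solution (1 + 2 / exp 1 + 3 * \<epsilon>) d C w F k S"
\<comment> \<open>Without clients there are no balls and no guesses, but every feasible set costs
  0.\<close>
proof (cases "C = {}")
  case True
  have "0 \<le> (1 + 2 / exp 1 + 3 * \<epsilon>) * kmedian_opt d C w F k"
    using eps kmedian_opt_nonneg by (intro mult_nonneg_nonneg add_nonneg_nonneg) auto
  with True S show ?thesis by (simp add: approx_solution_def kmedian_cost_def)
next
  case False
  let ?r = "(1 + 2 / exp 1 + 3 * \<epsilon>) * kmedian_opt d C w F k"
  from good_guess[OF eps m False cov] obtain L where L: "L \<in> {..<k} \<rightarrow>\<^sub>E {..<nb}"
    and good: "\<And>T. guess_greedy m bc br L m 0 T \<Longrightarrow>
      \<exists>c \<in> {..<k} \<rightarrow>\<^sub>E {..<m}. guess_cost bc br L (\<lambda>i. T (c i) i) \<le> ?r" by blast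
  from all L obtain T where T: "guess_greedy m bc br L m 0 T"
    "\<forall>c\<in>{..<k} \<rightarrow>\<^sub>E {..<m}. upto s (guess_cost bc br L (\<lambda>i. T (c i) i))" by blast
  from good[OF T(1)] T(2) have up: "0 < nmem s ''bh'' 0" "rmem s ''best'' 0 \<le> ?r"
    unfolding upto_def by force+
  have fin: "finite S" using S(1) finite_subset[OF _ finite_F] by (simp add: feasible_def)
  have sol: "nmem s ''sol'' ` {..<k} \<subseteq> S"
    using best up(1) S(2) unfolding best_ok_def by auto
  \<comment> \<open>The output contains the recorded selection, so each minimum is over a larger
    set.\<close>
  have "kmedian_cost d C w S \<le> (\<Sum>j\<in>C. w j * Min ((\<lambda>i. d j (nmem s ''sol'' i)) ` {..<k}))"
    unfolding kmedian_cost_def dist_to_set_def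
  proof (intro sum_mono mult_left_mono Min_antimono)
    fix j assume "j \<in> C"
    then show "0 \<le> w j" using weights less_imp_le by blast
    show "(\<lambda>i. d j (nmem s ''sol'' i)) ` {..<k} \<subseteq> d j ` S" using sol by auto
    show "(\<lambda>i. d j (nmem s ''sol'' i)) ` {..<k} \<noteq> {}" using k_bounds by (auto simp: lessThan_empty_iff)
  qed (use fin in simp)
  also have "\<dots> \<le> rmem s ''best'' 0" using best up(1) by (simp add: best_ok_def)
  also note up(2)
  finally show ?thesis using S(1) by (simp add: approx_solution_def)
qed

lemma runs_KMedian:
  assumes eps: "0 < \<epsilon>"
    and mu: "0 < \<mu>" "\<And>x y. x < n \<Longrightarrow> y < n \<Longrightarrow> x \<noteq> y \<Longrightarrow> \<mu> \<le> d x y" "\<And>x y. x < n \<Longrightarrow> y < n \<Longrightarrow> d x y \<le> \<mu> * B"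
    and N: "\<And>t. (1 + \<epsilon>) ^ t \<le> B \<Longrightarrow> t + 2 \<le> N" "2 \<le> N"
  shows "runs KMedian (kmedian_input \<epsilon> n d C w F k) (full_time n k (colours \<epsilon>) N ((card C * N) ^ k))
    (\<lambda>s. approx_solution (1 + 2 / exp 1 + 3 * \<epsilon>) d C w F k (kmedian_output k s))"
proof -
  define m where "m = colours \<epsilon>"
  define s0 where "s0 = kmedian_input \<epsilon> n d C w F k"
  have m: "1 + \<epsilon> \<le> real m * \<epsilon>" "0 < m" using colours[OF eps] by (simp_all add: m_def)
  have dist: "rmem s0 ''dist'' (j * n + x) = d j x" if "j < n" "x < n" for j x
  proof -
    have "j * n + x < Suc j * n" using that by simp
    also have "\<dots> \<le> n * n" using that by (intro mult_le_mono1) simp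
    finally show ?thesis using that by (simp add: s0_def kmedian_input_def)
  qed
  have inp: "nmem s0 ''n'' 0 = n" "nmem s0 ''k'' 0 = k" "rmem s0 ''eps'' 0 = \<epsilon>"
    "\<forall>x. nmem s0 ''client'' x = (if x \<in> C then 1 else 0)"
    "\<forall>x. nmem s0 ''facility'' x = (if x \<in> F then 1 else 0)" "\<forall>j\<in>C. rmem s0 ''weight'' j = w j"
    "nmem s0 ''row'' 0 = 0" "nmem s0 ''nb'' 0 = 0" "nmem s0 ''bh'' 0 = 0" "nmem s0 ''cnt'' 0 = 0"
    "nmem s0 ''mark'' = (\<lambda>_. 0)"
    by (simp_all add: s0_def kmedian_input_def)
  let ?Q = "\<lambda>s. approx_solution (1 + 2 / exp 1 + 3 * \<epsilon>) d C w F k (kmedian_output k s)"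
  let ?G = "(card C * N) ^ k"
  have "runs KMedian s0 (full_time n k m N ?G) ?Q"
    unfolding KMedian_def full_time_def
  proof (rule runs_seq[OF runs_SetColours[OF eps inp(3)]], fold m_def, rule order.refl)
    fix s1 assume 1: "frame SetColours s0 s1" "nmem s1 ''m'' 0 = m"
    show "runs (Seq Rows (Seq Balls (Seq Powers (Seq Main Finish)))) s1
      (((n + m) * 3 + 2) + (ball_time n N + ((k * 4 + 4) + (main_time n k m (m ^ k) ?G + (k * 6 + n * 6 + 4))))) ?Q"
    proof (rule runs_seq[OF runs_Rows[where n = n and m = m] order.refl])
      show "nmem s1 ''n'' 0 = n" "nmem s1 ''row'' 0 = 0" using 1(1) inp by (simp_all add: frame_def)
    next
      fix s2 assume 2: "frame Rows s1 s2" "\<forall>i\<le>n + m. nmem s2 ''row'' i = i * n"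
      have b2: "base \<epsilon> m s2"
        unfolding base_def using 1 2 inp dist by (simp add: frame_def)
      have nb2: "nmem s2 ''nb'' 0 = 0" using 1(1) 2(1) inp by (simp add: frame_def)
      show "runs (Seq Balls (Seq Powers (Seq Main Finish))) s2
        (ball_time n N + ((k * 4 + 4) + (main_time n k m (m ^ k) ?G + (k * 6 + n * 6 + 4)))) ?Q"
      proof (rule runs_seq[OF runs_Balls[OF b2 nb2 eps mu N] order.refl])
        fix s3 :: state
        define nb bc br where "nb = nmem s3 ''nb'' 0" and "bc = nmem s3 ''bc''" and "br = rmem s3 ''br''"
        assume 3: "frame Balls s2 s3" "nmem s3 ''nb'' 0 \<le> card C * N \<and>
          covering \<epsilon> (nmem s3 ''nb'' 0) (nmem s3 ''bc'') (rmem s3 ''br'')"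
        have b3: "base \<epsilon> m s3" by (rule base_frame[OF b2 3(1)]) simp_all
        have nb: "nb \<le> card C * N" and cov: "covering \<epsilon> nb bc br"
          using 3(2) by (simp_all add: nb_def bc_def br_def)
        show "runs (Seq Powers (Seq Main Finish)) s3
          ((k * 4 + 4) + (main_time n k m (m ^ k) ?G + (k * 6 + n * 6 + 4))) ?Q"
        proof (rule runs_seq[OF runs_Powers[where k = k and m = m and nb = nb] order.refl])
          show "nmem s3 ''k'' 0 = k" "nmem s3 ''m'' 0 = m" using b3 by (simp_all add: base_def)
          show "nmem s3 ''nb'' 0 = nb" by (simp add: nb_def)
        next
          fix s4 assume 4: "frame Powers s3 s4" "rmem s4 ''M'' 0 = real (m ^ k) \<and> rmem s4 ''G'' 0 = real (nb ^ k)"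
          have b4: "base \<epsilon> m s4" by (rule base_frame[OF b3 4(1)]) simp_all
          have mem: "nmem s4 ''nb'' 0 = nb" "nmem s4 ''bc'' = bc" "rmem s4 ''br'' = br"
            using 4(1) by (simp_all add: frame_def nb_def bc_def br_def)
          have "nmem s4 ''bh'' 0 = 0" using 1(1) 2(1) 3(1) 4(1) inp by (simp add: frame_def)
          then have best4: "best_ok s4" by (simp add: best_ok_def)
          have balls: "bc b \<in> C \<and> (\<exists>x\<in>F. d (bc b) x \<le> br b)" if "b < nb" for b
            using cov that unfolding covering_def by blast
          \<comment> \<open>The program loops over the balls that it really listed; the estimate
            \<open>card C * N\<close> of their number enters only here.\<close>
          have main: "main_time n k m (m ^ k) (nb ^ k) \<le> main_time n k m (m ^ k) ?G"
            by (intro main_time_mono power_mono nb) simp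
          show "runs (Seq Main Finish) s4 (main_time n k m (m ^ k) ?G + (k * 6 + n * 6 + 4)) ?Q"
          proof (rule runs_seq[OF runs_Main[OF m(2) balls b4 conjunct1[OF 4(2)] conjunct2[OF 4(2)]
                  mem(2,3,1) best4], where W = "k * 6 + n * 6 + 4"])
            fix s5 assume 5: "frame Main s4 s5" "best_ok s5 \<and> (\<forall>L\<in>{..<k} \<rightarrow>\<^sub>E {..<nb}.
              \<exists>T. guess_greedy m bc br L m 0 T \<and>
              (\<forall>c\<in>{..<k} \<rightarrow>\<^sub>E {..<m}. upto s5 (guess_cost bc br L (\<lambda>i. T (c i) i))))"
            have b5: "base \<epsilon> m s5" by (rule base_frame[OF b4 5(1)]) simp_all
            have zero: "nmem s5 ''cnt'' 0 = 0" "nmem s5 ''mark'' = (\<lambda>_. 0)"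
              using 1(1) 2(1) 3(1) 4(1) 5(1) inp by (simp_all add: frame_def)
            show "runs Finish s5 (k * 6 + n * 6 + 4) ?Q"
            proof (rule runs_mono[OF runs_Finish[OF b5 zero] order.refl])
              fix s6 assume "kmedian_output k s6 \<in> feasible F k \<and>
                (\<forall>i<k. nmem s5 ''sol'' i \<in> F \<longrightarrow> nmem s5 ''sol'' i \<in> kmedian_output k s6)"
              then show "?Q s6" using output_approx[OF eps m(1) cov] 5(2) by blast
            qed
          qed (use main in simp_all)
        qed
      qed
    qed (use 1 in simp_all)
  qed
  then show ?thesis by (simp add: s0_def m_def)
qed

end

theorem theorem8:
  fixes c :: real and A :: nat
  assumes "c > 0"
  shows "\<exists>(P :: com) (K :: real) (f :: nat \<Rightarrow> real \<Rightarrow> real) (b :: nat).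
    \<forall>(\<epsilon> :: real) (n :: nat) (d :: nat \<Rightarrow> nat \<Rightarrow> real) (C :: nat set) (w :: nat \<Rightarrow> real)
      (F :: nat set) (k :: nat).
      \<epsilon> > 0 \<and> weighted_kmedian {..<n} d C w F k \<and>
      (\<forall>j\<in>C. 1 \<le> w j \<and> w j \<le> real n) \<and>
      aspect_ratio {..<n} d \<le> real n ^ A \<and>
      real (card C) \<le> c * (1 / \<epsilon>\<^sup>2) * real k * ln (real n) \<longrightarrow>
      (\<exists>t s. exec P (kmedian_input \<epsilon> n d C w F k) t s \<and>
        real t \<le> f k \<epsilon> * real n ^ b \<and>
        approx_solution (1 + 2 / exp 1 + K * \<epsilon>) d C w F k (kmedian_output k s))"
\<comment> \<open>A single program serves all \<open>c\<close> and \<open>A\<close>, which enter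
  only the time factor. \<open>K = 3\<close> is the constant of \<open>good_guess\<close>, the
  exponent 3 comes from \<open>full_time_scale\<close>, and \<open>f\<close> is the time bound at
  \<open>n = 1\<close> with the numbers of radii and guesses divided by \<open>n\<close>.\<close>
proof (rule exI[of _ KMedian], rule exI[of _ 3],
    rule exI[of _ "\<lambda>k \<epsilon>. real (full_time 1 k (colours \<epsilon>) (round_coeff A \<epsilon>) (guess_coeff c A \<epsilon> k))"],
    rule exI[of _ 3], intro allI impI)
  fix \<epsilon> :: real and n :: nat and d C w F and k :: nat
  assume asm: "\<epsilon> > 0 \<and> weighted_kmedian {..<n} d C w F k \<and>
      (\<forall>j\<in>C. 1 \<le> w j \<and> w j \<le> real n) \<and>
      aspect_ratio {..<n} d \<le> real n ^ A \<and>
      real (card C) \<le> c * (1 / \<epsilon>\<^sup>2) * real k * ln (real n)"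
  then have eps: "0 < \<epsilon>" by blast
  interpret weighted_kmedian "{..<n}" d C w F k using asm by blast
  interpret kmedian_nat n d C w F k ..
  have n: "1 \<le> n" using k_le_n k_bounds by simp
  have "Metric_space {..<n} d" by unfold_locales
  then obtain \<mu> where mu: "0 < \<mu>" "\<forall>x<n. \<forall>y<n. x \<noteq> y \<longrightarrow> \<mu> \<le> d x y"
    "\<forall>x<n. \<forall>y<n. d x y \<le> \<mu> * real n ^ A"
    using aspect_ratio_bound[of n d "real n ^ A"] asm by auto
  let ?N = "round_bound A \<epsilon> n" and ?m = "colours \<epsilon>"
  let ?T = "full_time n k ?m ?N ((card C * ?N) ^ k)"
  have "runs KMedian (kmedian_input \<epsilon> n d C w F k) ?T
    (\<lambda>s. approx_solution (1 + 2 / exp 1 + 3 * \<epsilon>) d C w F k (kmedian_output k s))"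
  proof (rule runs_KMedian[OF eps mu(1)])
    show "t + 2 \<le> ?N" if "(1 + \<epsilon>) ^ t \<le> real n ^ A" for t
      by (rule round_bound[OF eps n that])
    show "2 \<le> ?N" by (simp add: round_bound_def)
  qed (use mu in blast)+
  then obtain t s where run: "exec KMedian (kmedian_input \<epsilon> n d C w F k) t s" "t \<le> ?T"
    "approx_solution (1 + 2 / exp 1 + 3 * \<epsilon>) d C w F k (kmedian_output k s)"
    by (auto simp: runs_def)
  have "(card C * ?N) ^ k \<le> guess_coeff c A \<epsilon> k * n"
    by (rule guesses_le[OF eps n _ assms]) (use asm k_bounds in simp_all)
  then have "?T \<le> full_time 1 k ?m (round_coeff A \<epsilon>) (guess_coeff c A \<epsilon> k) * n ^ 3"
    by (intro full_time_scale n round_bound_le eps)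
  with run(2) have "real t \<le> real (full_time 1 k ?m (round_coeff A \<epsilon>) (guess_coeff c A \<epsilon> k)) * real n ^ 3"
    by (metis (mono_tags) le_trans of_nat_le_iff of_nat_mult of_nat_power)
  with run show "\<exists>t s. exec KMedian (kmedian_input \<epsilon> n d C w F k) t s \<and>
    real t \<le> real (full_time 1 k ?m (round_coeff A \<epsilon>) (guess_coeff c A \<epsilon> k)) * real n ^ 3 \<and>
    approx_solution (1 + 2 / exp 1 + 3 * \<epsilon>) d C w F k (kmedian_output k s)" by blast
qed

end
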